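(* Let $\mathcal H$ be a real Hilbert space, $m\ge2$ an integer and $f_i\in\Gamma(\mathcal H)$ for $i=1,\dots,m$. Consider the problem $$(P^{\Sigma})\quad \inf_{x\in\mathcal H}\Big\{\sum_{i=1}^m f_i(x)\Big\}$$ and its Fenchel-type dual $$(D^{\Sigma})\quad \sup_{\substack{v_1,\dots,v_m\in\mathcal H\\ \sum_{i=1}^m v_i=0}}\Big\{-\sum_{i=1}^m f_i^*(v_i)\Big\},$$ with optimal objective values $v(P^{\Sigma})$ and $v(D^{\Sigma})$, respectively. Suppose that $(P^{\Sigma})$ has an optimal solution and that $$0\in\operatorname{sqri}\Big(\prod_{i=1}^m\operatorname{dom} f_i-\{(x,\dots,x):x\in\mathcal H\}\Big).$$ Let $y_i^0,y_i^1,z_i^0,z_i^1\in\mathcal H$, $i=1,\dots,m$, be such that $\sum_{i=1}^m y_i^0=\sum_{i=1}^m y_i^1=0$, let $\gamma>0$, let $(\alpha_k)_{k\ge1}$ be a nondecreasing real sequence with $0\le\alpha_k\le\alpha<1$ for every $k\ge2$, and let $(\lambda_k)_{k\ge1}$ be a real sequence and $\lambda,\sigma,\delta>0$ be such that $$\delta>\frac{\alpha^2(1+\alpha)+\alpha\sigma}{1-\alpha^2}\quad\text{and}\quad 0<\lambda\le\lambda_k\le 2\cdot\frac{\delta-\alpha[\alpha(1+\alpha)+\alpha\delta+\sigma]}{\delta[1+\alpha(1+\alpha)+\alpha\delta+\sigma]}\quad\forall k\ge2.$$ Suppose that either $\alpha_2=0$ or $\lambda_1=\alpha_1=0$. For every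 $k\ge1$ define (for $i=1,\dots,m$ where $i$ appears as a free index) $$x_i^{k+1}=\operatorname*{argmin}_{x\in\mathcal H}\Big\{f_i(x)+\big\langle y_i^k-\alpha_k(y_i^k-y_i^{k-1})-\gamma\alpha_k(z_i^k-z_i^{k-1}),x\big\rangle+\tfrac{\gamma}{2}\|x-z_i^k\|^2\Big\},$$ $$\overline z_i^{k+1}=\alpha_{k+1}\lambda_k(x_i^{k+1}-z_i^k)+\frac{(1-\lambda_k)\alpha_k\alpha_{k+1}}{\gamma}\big(y_i^k-y_i^{k-1}+\gamma(z_i^k-z_i^{k-1})\big),$$ $$u^{k+1}=\frac{\lambda_k(1+\alpha_{k+1})}{m}\sum_{i=1}^m x_i^{k+1}+\frac{1-\alpha_{k+1}\lambda_k-\lambda_k}{m}\sum_{i=1}^m z_i^k+\frac{\alpha_k(1-\lambda_k)(1+\alpha_{k+1})}{m}\sum_{i=1}^m(z_i^k-z_i^{k-1}),$$ $$z_i^{k+1}=u^{k+1}-\overline z_i^{k+1},$$ $$y_i^{k+1}=y_i^k+\gamma\big(\lambda_kx_i^{k+1}+(1-\lambda_k)z_i^k-z_i^{k+1}\big)+(1-\lambda_k)\alpha_k\big(y_i^k-y_i^{k-1}+\gamma(z_i^k-z_i^{k-1})\big).$$ Then there exists $(\overline x,\overline v_1,\dots,\overline v_m)\in\mathcal H\times\mathcal H^m$ satisfying $$\overline v_i\in\partial f_i(\overline x),\ i=1,\dots,m,\quad\text{and}\quad \sum_{i=1}^m\overline v_i=0$$ (hence $\overline x$ is an optimal solution to $(P^{\Sigma})$,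 $(\overline v_1,\dots,\overline v_m)$ is an optimal solution to $(D^{\Sigma})$ and $v(P^{\Sigma})=v(D^{\Sigma})$), such that the following statements are true: (i) $(x_i^k)_{k\ge2}$ converges weakly to $\overline x$, $i=1,\dots,m$; (ii) $(\overline z_i^k)_{k\ge2}$ converges strongly to $0$, $i=1,\dots,m$; (iii) $(z_i^k)_{k\in\mathbb N}$ converges weakly to $\overline x$, $i=1,\dots,m$; (iv) $(x_i^{k+1}-z_i^k)_{k\ge2}$ converges strongly to $0$, $i=1,\dots,m$; (v) $(u^k)_{k\ge2}$ converges weakly to $\overline x$; (vi) $(y_i^k)_{k\in\mathbb N}$ converges weakly to $-\overline v_i$, $i=1,\dots,m$; (vii) if $f_i^*$ is strongly convex for every $i=1,\dots,m$, then $(-y_1^k,\dots,-y_m^k)_{k\in\mathbb N}$ converges strongly to the unique optimal solution to $(D^{\Sigma})$; (viii) $\lim_{k\to+\infty}\sum_{i=1}^m f_i(x_i^{k+1})=v(P^{\Sigma})=v(D^{\Sigma})=\lim_{k\to+\infty}\big(-\sum_{i=1}^m f_i^*(-v_i^k)\big)$, where for every $i=1,\dots,m$ the sequence $(v_i^k)_{k\ge1}$ is defined by $$v_i^k=y_i^k-\gamma z_i^k+\gamma x_i^{k+1}-\alpha_k\big(y_i^k-y_i^{k-1}+\gamma(z_i^k-z_i^{k-1})\big)\quad\forall k\ge1,$$ and $(v_i^k)_{k\ge1}$ converges weakly to $-\overline v_i$.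
   Context: $\Gamma(\mathcal H)$ denotes the family of proper, convex, lower semicontinuous functions $\mathcal H\to\mathbb R\cup\{\pm\infty\}$ (proper: never $-\infty$ and not identically $+\infty$). $\operatorname{dom} f=\{x: f(x)<+\infty\}$; $f^*(u)=\sup_{x}\{\langle u,x\rangle-f(x)\}$ is the conjugate; $\partial f(x)=\{v: f(y)\ge f(x)+\langle v,y-x\rangle\ \forall y\}$ if $f(x)\in\mathbb R$ and $\partial f(x)=\varnothing$ otherwise. $\mathbb N=\{0,1,2,\dots\}$. The product space $\mathcal H^m$ carries the inner product $\langle x,u\rangle=\sum_{i=1}^m\langle x_i,u_i\rangle$ and the associated norm. For a convex set $S$ in a Hilbert space, the strong quasi-relative interior is $\operatorname{sqri}S=\{x\in S:\bigcup_{\lambda>0}\lambda(S-x)\text{ is a closed linear subspace}\}$; in this theorem it is taken in $\mathcal H^m$. A proper function $h$ is strongly convex if, for some $\beta>0$, $h(tx+(1-t)y)+t(1-t)\frac{\beta}{2}\|x-y\|^2\le th(x)+(1-t)h(y)$ for all $x,y\in\operatorname{dom}h$ and $t\in(0,1)$. *)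

theory Defs
  imports "HOL-Analysis.Analysis"
begin

text \<open>
  Extended-real-valued functions on a real Hilbert space have type \<open>'a \<Rightarrow> ereal\<close> with
  \<open>'a :: {real_inner, complete_space}\<close>, and \<open>\<H>\<^sup>m\<close> is \<open>'a ^ 'm\<close> with \<open>m = CARD('m)\<close>, whose library
  inner product is the sum of the inner products of the components.
\<close>

definition proper_fun :: "('a \<Rightarrow> ereal) \<Rightarrow> bool" where
  "proper_fun f \<longleftrightarrow> (\<forall>x. f x \<noteq> -\<infinity>) \<and> (\<exists>x. f x \<noteq> \<infinity>)"

text \<open>
  The inequality below is only used for functions that never take the value \<open>-\<infinity>\<close>, so that
  no sum \<open>\<infinity> + (-\<infinity>)\<close> occurs.
\<close>

definition convex_fun :: "('a::real_vector \<Rightarrow> ereal) \<Rightarrow> bool" where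
  "convex_fun f \<longleftrightarrow> (\<forall>x y. \<forall>t\<in>{0<..<1}.
     f (t *\<^sub>R x + (1 - t) *\<^sub>R y) \<le> ereal t * f x + ereal (1 - t) * f y)"

definition lsc_fun :: "('a::topological_space \<Rightarrow> ereal) \<Rightarrow> bool" where
  "lsc_fun f \<longleftrightarrow> (\<forall>x. f x \<le> Liminf (nhds x) f)"

definition proper_convex_lsc :: "('a::real_normed_vector \<Rightarrow> ereal) set" where
  "proper_convex_lsc = {f. proper_fun f \<and> convex_fun f \<and> lsc_fun f}"

definition eff_dom :: "('a \<Rightarrow> ereal) \<Rightarrow> 'a set" where
  "eff_dom f = {x. f x < \<infinity>}"

definition conjugate :: "('a::real_inner \<Rightarrow> ereal) \<Rightarrow> 'a \<Rightarrow> ereal" where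
  "conjugate f u = (SUP x. ereal (u \<bullet> x) - f x)"

definition subdifferential :: "('a::real_inner \<Rightarrow> ereal) \<Rightarrow> 'a \<Rightarrow> 'a set" where
  "subdifferential f x =
     (if \<bar>f x\<bar> \<noteq> \<infinity> then {v. \<forall>y. f y \<ge> f x + ereal (v \<bullet> (y - x))} else {})"

definition strongly_convex :: "('a::real_normed_vector \<Rightarrow> ereal) \<Rightarrow> bool" where
  "strongly_convex h \<longleftrightarrow> proper_fun h \<and>
     (\<exists>\<beta>>0. \<forall>x\<in>eff_dom h. \<forall>y\<in>eff_dom h. \<forall>t\<in>{0<..<1}.
        h (t *\<^sub>R x + (1 - t) *\<^sub>R y) + ereal (t * (1 - t) * (\<beta> / 2) * (norm (x - y))\<^sup>2)
          \<le> ereal t * h x + ereal (1 - t) * h y)"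

definition sqri :: "'a::real_normed_vector set \<Rightarrow> 'a set" where
  "sqri S = {x \<in> S. let K = (\<Union>l\<in>{0<..}. (\<lambda>s. l *\<^sub>R (s - x)) ` S) in subspace K \<and> closed K}"

definition weakly_tendsto :: "(nat \<Rightarrow> 'a::real_inner) \<Rightarrow> 'a \<Rightarrow> bool" where
  "weakly_tendsto s l \<longleftrightarrow> (\<forall>h. (\<lambda>k. s k \<bullet> h) \<longlonglongrightarrow> l \<bullet> h)"

definition dom_minus_diagonal :: "('m::finite \<Rightarrow> 'a::real_inner \<Rightarrow> ereal) \<Rightarrow> ('a ^ 'm) set" where
  "dom_minus_diagonal f =
     {p - d | p d. (\<forall>i. p $ i \<in> eff_dom (f i)) \<and> d \<in> range (\<lambda>x. \<chi> i. x)}"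

definition primal_obj :: "('m::finite \<Rightarrow> 'a::real_inner \<Rightarrow> ereal) \<Rightarrow> 'a \<Rightarrow> ereal" where
  "primal_obj f x = (\<Sum>i\<in>UNIV. f i x)"

definition primal_val :: "('m::finite \<Rightarrow> 'a::real_inner \<Rightarrow> ereal) \<Rightarrow> ereal" where
  "primal_val f = (INF x. primal_obj f x)"

definition primal_opt :: "('m::finite \<Rightarrow> 'a::real_inner \<Rightarrow> ereal) \<Rightarrow> 'a \<Rightarrow> bool" where
  "primal_opt f x \<longleftrightarrow> primal_obj f x = primal_val f"

definition dual_obj :: "('m::finite \<Rightarrow> 'a::real_inner \<Rightarrow> ereal) \<Rightarrow> 'a ^ 'm \<Rightarrow> ereal" where
  "dual_obj f v = - (\<Sum>i\<in>UNIV. conjugate (f i) (v $ i))"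

definition dual_feasible :: "('a::real_inner ^ 'm::finite) set" where
  "dual_feasible = {v. (\<Sum>i\<in>UNIV. v $ i) = 0}"

definition dual_val :: "('m::finite \<Rightarrow> 'a::real_inner \<Rightarrow> ereal) \<Rightarrow> ereal" where
  "dual_val f = (SUP v\<in>dual_feasible. dual_obj f v)"

definition dual_opt :: "('m::finite \<Rightarrow> 'a::real_inner \<Rightarrow> ereal) \<Rightarrow> 'a ^ 'm \<Rightarrow> bool" where
  "dual_opt f v \<longleftrightarrow> v \<in> dual_feasible \<and> dual_obj f v = dual_val f"

end

theory Submission
  imports Defs
begin

text \<open>
  On the product space, with \<open>P\<close> the projector onto the diagonal and \<open>Q = I - P\<close>, the sequence
  \<open>w\<^sup>k = y\<^sup>k + \<gamma> z\<^sup>k\<close> is an inertial Krasnosel'skii--Mann iteration of the nonexpansive composition of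
  the reflections \<open>P - Q\<close> and \<open>2 prox - I\<close>. Its fixed points are exactly the vectors \<open>\<gamma> x - v\<close>
  with \<open>x\<close> on the diagonal, \<open>v\<close> orthogonal to it and \<open>v\<close> a subgradient at \<open>x\<close>; the sqri condition
  provides one. The Lyapunov function
  \<open>\<parallel>w\<^sup>k\<^sup>+\<^sup>1 - p\<parallel>\<^sup>2 - \<alpha>\<^sub>k \<parallel>w\<^sup>k - p\<parallel>\<^sup>2 + G \<parallel>w\<^sup>k\<^sup>+\<^sup>1 - w\<^sup>k\<parallel>\<^sup>2\<close> decreases, which gives vanishing
  increments and convergence of \<open>\<parallel>w\<^sup>k - p\<parallel>\<close> for every fixed point \<open>p\<close>. The weak limit is obtained as
  the asymptotic centre of the sequence, which needs neither the Riesz representation theorem nor weak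
  compactness. The limits of the objective values follow because \<open>\<langle>v\<^sup>k, x\<^sup>k\<^sup>+\<^sup>1 - x\<rangle>\<close> tends to \<open>0\<close>,
  which also forces strong convergence of the dual sequence under strong convexity.
\<close>

section \<open>Convex analysis in Hilbert spaces\<close>

text \<open>A proximal map is in general not weakly continuous, so the weak limit of
  \<open>x\<close> cannot be read off from the argmin. It comes from linear maps: \<open>P\<close>
  and \<open>Q\<close> preserve weak limits, \<open>s k\<close> splits into the diagonal part
  \<open>\<gamma> U k\<close> and the orthogonal part \<open>y k\<close>, and the vanishing residual
  \<open>R (s k) - s k\<close> is a multiple of \<open>x (k + 1) - U k\<close>. The vanishing of the
  pairing named in the overview has the same origin. A product of two weakly convergent sequences
  need not converge, but \<open>v k\<close> is \<open>y k\<close> plus \<open>\<gamma>\<close> times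
  \<open>x (k + 1) - U k\<close>, and \<open>y k\<close> is orthogonal to the diagonal; against
  \<open>x (k + 1) - xb\<close> only products of a bounded and a strongly vanishing factor survive.
  In the qualification condition, closedness of the generated subspace makes it complete, so that
  Baire's theorem applies inside it, and its symmetry turns the one-sided bounds that domain points
  provide into two-sided ones. The factor 2 in the bound on \<open>lams\<close> reflects that
  \<open>R\<close> is relaxed by \<open>lams k / 2\<close>.\<close>

lemma norm_convex_comb_sq:
  fixes a b :: "'a::real_inner"
  shows "(norm (t *\<^sub>R a + (1 - t) *\<^sub>R b))\<^sup>2 =
    t * (norm a)\<^sup>2 + (1 - t) * (norm b)\<^sup>2 - t * (1 - t) * (norm (a - b))\<^sup>2"
  unfolding power2_norm_eq_inner by (simp add: inner_simps algebra_simps inner_commute)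

text \<open>Points of nearly minimal norm in \<open>C n\<close> form a Cauchy sequence by the
  parallelogram identity, and their limit lies in every \<open>C n\<close>. This is the substitute
  for weak compactness: minimisers, the subgradient and the asymptotic centre are all found as
  points of such an intersection.\<close>

lemma nested_closed_convex_Inter_nonempty:
  fixes C :: "nat \<Rightarrow> 'a::{real_inner, complete_space} set"
  assumes closed: "\<And>n. closed (C n)" and convex: "\<And>n. convex (C n)" and ne: "\<And>n. C n \<noteq> {}"
    and dec: "decseq C" and bdd: "bounded (C 0)"
  shows "\<exists>x. \<forall>n. x \<in> C n"
proof -
  define D where "D n = Inf ((\<lambda>x. (norm x)\<^sup>2) ` C n)" for n
  have bb: "bdd_below ((\<lambda>x. (norm x)\<^sup>2) ` C n)" for n
    by (rule bdd_belowI[of _ 0]) auto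
  have low: "D n \<le> (norm x)\<^sup>2" if "x \<in> C n" for x n
    unfolding D_def using that by (intro cINF_lower bb)
  have "\<exists>a. a \<in> C n \<and> (norm a)\<^sup>2 < D n + 1 / real (Suc n)" for n
    using cInf_lessD[of "(\<lambda>x. (norm x)\<^sup>2) ` C n" "D n + 1 / real (Suc n)"] ne[of n]
    by (auto simp: D_def)
  then obtain a where aC: "\<And>n. a n \<in> C n"
    and a: "\<And>n. (norm (a n))\<^sup>2 < D n + 1 / real (Suc n)" by metis
  have sub: "C m \<subseteq> C n" if "n \<le> m" for m n
    using dec that by (simp add: decseq_def)
  obtain R where R: "\<And>x. x \<in> C 0 \<Longrightarrow> norm x \<le> R"
    using bdd by (auto simp: bounded_iff)
  have "incseq D"
  proof (rule incseq_SucI)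
    fix n
    show "D n \<le> D (Suc n)"
      unfolding D_def[of "Suc n"] by (intro cINF_greatest ne) (use low sub[of n "Suc n"] in auto)
  qed
  moreover have "D n \<le> R\<^sup>2" for n
    using low[OF aC[of n]] R[of "a n"] aC[of n] sub[of 0 n] power_mono[of "norm (a n)" R 2] by force
  ultimately obtain l where l: "D \<longlonglongrightarrow> l" "\<And>n. D n \<le> l"
    using incseq_convergent[of D "R\<^sup>2"] by metis
  \<comment> \<open>The midpoint of \<open>a n\<close> and \<open>a m\<close> lies in
    \<open>C n\<close>, so its squared norm is at least \<open>D n\<close>. Since both ends are
    nearly minimal and \<open>D m\<close> is at most \<open>l\<close>, their distance is bounded in
    terms of \<open>n\<close> alone.\<close>
  have key: "(norm (a n - a m))\<^sup>2 \<le> 2 * (l - D n) + 4 / real (Suc n)" if "n \<le> m" for m n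
  proof -
    have mid: "(1/2) *\<^sub>R a n + (1 - 1/2) *\<^sub>R a m \<in> C n"
      using convex[of n] aC[of n] aC[of m] sub[OF that]
      by (intro convexD) auto
    have "1 / real (Suc m) \<le> 1 / real (Suc n)"
      using that by (intro divide_left_mono) auto
    then show ?thesis
      using low[OF mid] norm_convex_comb_sq[of "1/2" "a n" "a m"] a[of n] a[of m] l(2)[of m]
      by (simp del: of_nat_Suc)
  qed
  have "(\<lambda>n. 2 * (l - D n) + 4 / real (Suc n)) \<longlonglongrightarrow> 2 * (l - l) + 0"
    by (intro tendsto_intros l(1) LIMSEQ_Suc[OF lim_const_over_n])
  then have lim: "(\<lambda>n. 2 * (l - D n) + 4 / real (Suc n)) \<longlonglongrightarrow> 0" by simp
  have "Cauchy a"
  proof (rule metric_CauchyI)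
    fix e :: real assume "e > 0"
    then have "eventually (\<lambda>n. 2 * (l - D n) + 4 / real (Suc n) < (e/2)\<^sup>2) sequentially"
      using order_tendstoD(2)[OF lim, of "(e/2)\<^sup>2"] by simp
    then obtain N where N: "2 * (l - D N) + 4 / real (Suc N) < (e/2)\<^sup>2"
      by (auto simp: eventually_sequentially)
    have h: "dist (a m) (a N) < e/2" if "m \<ge> N" for m
    proof -
      have "(norm (a N - a m))\<^sup>2 < (e/2)\<^sup>2" using key[OF that] N by linarith
      then have "norm (a N - a m) < e/2" by (rule power2_less_imp_less) (use \<open>e>0\<close> in auto)
      then show ?thesis by (simp add: dist_norm norm_minus_commute)
    qed
    have "dist (a m) (a n) < e" if "m \<ge> N" "n \<ge> N" for m n
      using h[OF that(1)] h[OF that(2)] by (rule dist_triangle_half_l)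
    then show "\<exists>M. \<forall>m\<ge>M. \<forall>n\<ge>M. dist (a m) (a n) < e" by blast
  qed
  then obtain x where x: "a \<longlonglongrightarrow> x" using Cauchy_convergent convergentD by blast
  have "x \<in> C n" for n
  proof (rule closed_sequentially[OF closed])
    show "\<And>k. a (k + n) \<in> C n" using aC sub by (meson le_add2 subsetD)
    show "(\<lambda>k. a (k + n)) \<longlonglongrightarrow> x" by (rule LIMSEQ_ignore_initial_segment[OF x])
  qed
  then show ?thesis by blast
qed

section \<open>Lower semicontinuous convex functions: values, sublevel sets, sums, minorants,
  minimisers\<close>

lemma pcl_not_minf: "f \<in> proper_convex_lsc \<Longrightarrow> f x \<noteq> -\<infinity>"
  by (simp add: proper_convex_lsc_def proper_fun_def)

lemma pcl_real:
  assumes "f \<in> proper_convex_lsc" "x \<in> eff_dom f"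
  shows "f x = ereal (real_of_ereal (f x))"
  using assms pcl_not_minf[of f x] by (cases "f x") (auto simp: eff_dom_def)

lemma pcl_dom_nonempty:
  assumes "f \<in> proper_convex_lsc"
  obtains x where "x \<in> eff_dom f"
  using assms by (auto simp: proper_convex_lsc_def proper_fun_def eff_dom_def)

lemma pcl_convexD:
  assumes "f \<in> proper_convex_lsc" "f x \<le> ereal a" "f y \<le> ereal b" "0 < t" "t < 1"
  shows "f (t *\<^sub>R x + (1 - t) *\<^sub>R y) \<le> ereal (t * a + (1 - t) * b)"
proof -
  have "f (t *\<^sub>R x + (1 - t) *\<^sub>R y) \<le> ereal t * f x + ereal (1 - t) * f y"
    using assms by (auto simp: proper_convex_lsc_def convex_fun_def)
  also have "\<dots> \<le> ereal t * ereal a + ereal (1 - t) * ereal b"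
    using assms by (intro add_mono ereal_mult_left_mono) auto
  finally show ?thesis by simp
qed

lemma pcl_lscD:
  assumes "f \<in> proper_convex_lsc" "a < f x"
  shows "eventually (\<lambda>w. a < f w) (nhds x)"
  using assms by (auto simp: proper_convex_lsc_def lsc_fun_def le_Liminf_iff)

lemma pcl_lsc_seq:
  assumes "f \<in> proper_convex_lsc" "X \<longlonglongrightarrow> x" "c \<longlonglongrightarrow> l" "\<And>n. f (X n) \<le> ereal (c n)"
  shows "f x \<le> ereal l"
proof (rule ccontr)
  assume "\<not> ?thesis"
  then obtain b where b: "ereal l < ereal b" "ereal b < f x"
    using ereal_dense2[of "ereal l" "f x"] by force
  have "eventually (\<lambda>n. ereal b < f (X n)) sequentially"
    using filterlim_iff[THEN iffD1, OF assms(2)] pcl_lscD[OF assms(1) b(2)] by blast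
  moreover have "eventually (\<lambda>n. c n < b) sequentially"
    using order_tendstoD(2)[OF assms(3)] b by simp
  ultimately have "eventually (\<lambda>n. False) sequentially"
  proof eventually_elim
    case (elim n)
    then have "ereal b < ereal (c n)" using assms(4)[of n] by (metis order_less_le_trans)
    with elim show ?case by simp
  qed
  then show False by simp
qed

lemma pcl_sublevel_closed:
  assumes "f \<in> proper_convex_lsc"
  shows "closed {x. f x \<le> ereal c}"
  unfolding closed_sequential_limits using pcl_lsc_seq[OF assms _ tendsto_const] by auto

lemma pcl_sublevel_convex:
  assumes "f \<in> proper_convex_lsc"
  shows "convex {x. f x \<le> ereal c}"
proof (rule convexI)
  fix x y u v assume A: "x \<in> {x. f x \<le> ereal c}" "y \<in> {x. f x \<le> ereal c}" "0 \<le> u" "0 \<le> v" "u + v = (1::real)"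
  have v: "v = 1 - u" using A by simp
  show "u *\<^sub>R x + v *\<^sub>R y \<in> {x. f x \<le> ereal c}"
  proof (cases "0 < u \<and> u < 1")
    case True
    then show ?thesis using pcl_convexD[OF assms, of x c y c u] A True unfolding v by (simp add: left_diff_distrib flip: distrib_right)
  next
    case False
    then have "u = 0 \<or> u = 1" using A by auto
    then show ?thesis using A v by auto
  qed
qed

lemma pcl_add_continuous:
  assumes f: "f \<in> proper_convex_lsc" and r: "convex_on UNIV r" and cr: "continuous_on UNIV r"
  shows "(\<lambda>x. f x + ereal (r x)) \<in> proper_convex_lsc"
  unfolding proper_convex_lsc_def mem_Collect_eq
proof (intro conjI)
  show "proper_fun (\<lambda>x. f x + ereal (r x))"
    using f by (auto simp: proper_convex_lsc_def proper_fun_def)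
  show "convex_fun (\<lambda>x. f x + ereal (r x))"
    unfolding convex_fun_def
  proof (intro allI ballI)
    fix x y and t :: real assume t: "t \<in> {0<..<1}"
    have 1: "f (t *\<^sub>R x + (1 - t) *\<^sub>R y) \<le> ereal t * f x + ereal (1 - t) * f y"
      using f t by (auto simp: proper_convex_lsc_def convex_fun_def)
    have 2: "r (t *\<^sub>R x + (1 - t) *\<^sub>R y) \<le> t * r x + (1 - t) * r y"
      using convex_onD[OF r, of "1 - t" x y] t by simp
    have "f (t *\<^sub>R x + (1 - t) *\<^sub>R y) + ereal (r (t *\<^sub>R x + (1 - t) *\<^sub>R y)) \<le>
        (ereal t * f x + ereal (1 - t) * f y) + ereal (t * r x + (1 - t) * r y)"
      using 1 2 by (intro add_mono) auto
    also have "\<dots> = ereal t * (f x + ereal (r x)) + ereal (1 - t) * (f y + ereal (r y))"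
      using pcl_not_minf[OF f, of x] pcl_not_minf[OF f, of y] t
      by (cases "f x"; cases "f y") (auto simp: algebra_simps)
    finally show "f (t *\<^sub>R x + (1 - t) *\<^sub>R y) + ereal (r (t *\<^sub>R x + (1 - t) *\<^sub>R y)) \<le>
      ereal t * (f x + ereal (r x)) + ereal (1 - t) * (f y + ereal (r y))" .
  qed
  show "lsc_fun (\<lambda>x. f x + ereal (r x))"
    unfolding lsc_fun_def le_Liminf_iff
  proof (intro allI impI)
    fix x a assume a: "a < f x + ereal (r x)"
    show "eventually (\<lambda>w. a < f w + ereal (r w)) (nhds x)"
    proof (cases a)
      case (real b)
      have "ereal (b - r x) < f x" using a real by (cases "f x") auto
      then obtain c where c: "b - r x < c" "ereal c < f x"
        using ereal_dense2[of "ereal (b - r x)" "f x"] by force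
      have "eventually (\<lambda>w. b - c < r w) (nhds x)"
        using cr c by (intro order_tendstoD(1)[of r "r x"])
          (auto simp: continuous_on_def tendsto_at_iff_tendsto_nhds dest!: bspec[of _ _ x])
      with pcl_lscD[OF f c(2)] show ?thesis
      proof eventually_elim
        case (elim w)
        then show ?case using real by (cases "f w") auto
      qed
    next
      case MInf
      then show ?thesis using pcl_not_minf[OF f] by (auto intro!: always_eventually)
    qed (use a in auto)
  qed
qed

text \<open>A lower semicontinuous convex function is minorised on a ball by \<open>f x1 - 1\<close>; convexity along
  the segments leaving that ball propagates this to a cone-shaped minorant.\<close>

lemma pcl_lower_bound:
  fixes f :: "'a::real_normed_vector \<Rightarrow> ereal"
  assumes f: "f \<in> proper_convex_lsc" and x1: "f x1 = ereal c"
  obtains B where "B \<ge> 0" "\<And>x. ereal (c - 1 - B * norm (x - x1)) \<le> f x"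
proof -
  have "ereal (c - 1) < f x1" by (simp add: x1)
  from pcl_lscD[OF f this] obtain d where d: "d > 0" "\<And>w. dist w x1 < d \<Longrightarrow> ereal (c - 1) < f w"
    by (auto simp: eventually_nhds_metric)
  define B where "B = 2 / d"
  have "B \<ge> 0" using d by (simp add: B_def)
  moreover have "ereal (c - 1 - B * norm (x - x1)) \<le> f x" for x
  proof (cases "norm (x - x1) < d")
    case True
    then have "ereal (c - 1) < f x" using d(2) by (simp add: dist_norm)
    moreover have "ereal (c - 1 - B * norm (x - x1)) \<le> ereal (c - 1)" using \<open>B \<ge> 0\<close> by simp
    ultimately show ?thesis by (meson less_imp_le order_trans)
  next
    case False
    define N where "N = norm (x - x1)"
    have N: "N \<ge> d" "N > 0" using False d by (auto simp: N_def)
    \<comment> \<open>This \<open>t\<close> places the convex combination at distance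
      \<open>d / 2\<close> from \<open>x1\<close>, inside the ball where the lower bound
      holds.\<close>
    define t where "t = d / (2 * N)"
    have t: "0 < t" "t < 1" using N d by (auto simp: t_def field_simps)
    show ?thesis
    proof (cases "f x")
      case (real a)
      have "f (t *\<^sub>R x + (1 - t) *\<^sub>R x1) \<le> ereal (t * a + (1 - t) * c)"
        by (rule pcl_convexD[OF f]) (use real x1 t in auto)
      moreover have "t *\<^sub>R x + (1 - t) *\<^sub>R x1 - x1 = t *\<^sub>R (x - x1)" by (simp add: algebra_simps)
      then have "norm (t *\<^sub>R x + (1 - t) *\<^sub>R x1 - x1) = d / 2"
        using t N by (simp add: N_def[symmetric]) (simp add: t_def)
      then have "ereal (c - 1) < f (t *\<^sub>R x + (1 - t) *\<^sub>R x1)"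
        using d by (intro d(2)) (simp add: dist_norm)
      ultimately have "ereal (c - 1) < ereal (t * a + (1 - t) * c)" by (metis order_less_le_trans)
      then have "t * (c - a) < 1" by (simp add: algebra_simps)
      then have "c - a < 2 * N / d" using t d N by (simp add: t_def field_simps)
      then show ?thesis using real by (simp add: B_def N_def)
    qed (use pcl_not_minf[OF f] in auto)
  qed
  ultimately show thesis using that by blast
qed

text \<open>The sublevel sets just above the infimum are nested, closed, convex, bounded and
  nonempty; a common point is a minimiser.\<close>

lemma pcl_coercive_minimizer:
  fixes f :: "'a::{real_inner, complete_space} \<Rightarrow> ereal"
  assumes f: "f \<in> proper_convex_lsc" and lb: "\<And>x. ereal b \<le> f x"
    and bdd: "\<And>c. bounded {x. f x \<le> ereal c}"
  obtains p where "\<And>x. f p \<le> f x"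
proof -
  \<comment> \<open>\<open>S\<close> holds the real numbers that dominate some value of
    \<open>f\<close>, so \<open>Inf S\<close> is the infimum of \<open>f\<close> taken in the reals;
    properness makes \<open>S\<close> nonempty and \<open>b\<close> bounds it below.\<close>
  define S where "S = {c. \<exists>x. f x \<le> ereal c}"
  obtain x0 where x0: "x0 \<in> eff_dom f" using pcl_dom_nonempty[OF f] .
  have Sne: "S \<noteq> {}" using pcl_real[OF f x0] by (auto simp: S_def intro!: exI[of _ "real_of_ereal (f x0)"] exI[of _ x0])
  have Sb: "bdd_below S"
  proof (rule bdd_belowI[of _ b])
    fix c assume "c \<in> S"
    then obtain x where "f x \<le> ereal c" by (auto simp: S_def)
    then show "b \<le> c" using lb[of x] by (meson ereal_less_eq(3) order_trans)
  qed
  define C where "C n = {x. f x \<le> ereal (Inf S + 1 / real (Suc n))}" for n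
  have "\<exists>x. \<forall>n. x \<in> C n"
  proof (rule nested_closed_convex_Inter_nonempty)
    fix n
    show "closed (C n)" "convex (C n)"
      unfolding C_def using pcl_sublevel_closed[OF f] pcl_sublevel_convex[OF f] by auto
    obtain c where "c \<in> S" "c < Inf S + 1 / real (Suc n)"
      using cInf_lessD[OF Sne, of "Inf S + 1 / real (Suc n)"] by auto
    then obtain x where "f x \<le> ereal c" "c \<le> Inf S + 1 / real (Suc n)" by (auto simp: S_def)
    then have "x \<in> C n" unfolding C_def by (auto elim: order_trans)
    then show "C n \<noteq> {}" by blast
    show "bounded (C 0)" unfolding C_def by (rule bdd)
    show "decseq C"
      unfolding decseq_def C_def
    proof (intro allI impI subsetI CollectI, elim CollectE)
      fix m n x assume "m \<le> (n::nat)" "f x \<le> ereal (Inf S + 1 / real (Suc n))"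
      moreover from this have "1 / real (Suc n) \<le> 1 / real (Suc m)" by (intro divide_left_mono) auto
      ultimately show "f x \<le> ereal (Inf S + 1 / real (Suc m))" by (auto elim: order_trans)
    qed
  qed
  then obtain p where p: "\<And>n. f p \<le> ereal (Inf S + 1 / real (Suc n))" by (auto simp: C_def)
  have "(\<lambda>n. Inf S + 1 / real (Suc n)) \<longlonglongrightarrow> Inf S + 0"
    by (intro tendsto_intros LIMSEQ_Suc[OF lim_const_over_n])
  then have fp: "f p \<le> ereal (Inf S)"
    using pcl_lsc_seq[OF f, of "\<lambda>n. p" p] p by auto
  have "f p \<le> f x" for x
  proof (cases "f x")
    case (real a)
    then have "a \<in> S" by (auto simp: S_def intro!: exI[of _ x])
    then show ?thesis using fp cInf_lower[OF _ Sb] real by (metis ereal_less_eq(3) order_trans)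
  qed (use pcl_not_minf[OF f] in auto)
  then show thesis using that by blast
qed

lemma convex_on_norm_sq:
  fixes z :: "'a::real_inner"
  assumes "c \<ge> 0"
  shows "convex_on UNIV (\<lambda>x. c * (norm (x - z))\<^sup>2)"
proof (rule convex_onI)
  fix t :: real and x y :: 'a assume t: "0 < t" "t < 1"
  have eq: "(1 - t) *\<^sub>R x + t *\<^sub>R y - z = t *\<^sub>R (y - z) + (1 - t) *\<^sub>R (x - z)" by (simp add: algebra_simps)
  have "(norm ((1 - t) *\<^sub>R x + t *\<^sub>R y - z))\<^sup>2 \<le> (1 - t) * (norm (x - z))\<^sup>2 + t * (norm (y - z))\<^sup>2"
    unfolding eq norm_convex_comb_sq using t by simp
  from mult_left_mono[OF this assms]
  show "c * (norm ((1 - t) *\<^sub>R x + t *\<^sub>R y - z))\<^sup>2 \<le> (1 - t) * (c * (norm (x - z))\<^sup>2) + t * (c * (norm (y - z))\<^sup>2)"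
    by (simp add: algebra_simps)
qed simp

text \<open>Coercivity: the cone-shaped minorant of \<open>f\<close> and the linear term decrease at
  most linearly in the distance to \<open>z\<close>, and the quadratic term dominates both.\<close>

lemma pcl_add_quadratic_minimizer:
  fixes f :: "'a::{real_inner, complete_space} \<Rightarrow> ereal"
  assumes f: "f \<in> proper_convex_lsc" and \<gamma>: "\<gamma> > 0"
  obtains p where "p \<in> eff_dom f"
    "\<And>x. f p + ereal (a \<bullet> p + \<gamma> / 2 * (norm (p - z))\<^sup>2) \<le> f x + ereal (a \<bullet> x + \<gamma> / 2 * (norm (x - z))\<^sup>2)"
proof -
  define r where "r x = a \<bullet> x + \<gamma> / 2 * (norm (x - z))\<^sup>2" for x
  define F where "F x = f x + ereal (r x)" for x
  have "convex_on UNIV r"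
    unfolding r_def using \<gamma>
    by (intro convex_on_add convex_on_norm_sq) (simp_all add: convex_on_def inner_simps)
  then have F: "F \<in> proper_convex_lsc"
    unfolding F_def by (rule pcl_add_continuous[OF f]) (auto simp: r_def intro!: continuous_intros)
  obtain x1 where x1: "x1 \<in> eff_dom f" using pcl_dom_nonempty[OF f] .
  obtain B where B: "B \<ge> 0" "\<And>x. ereal (real_of_ereal (f x1) - 1 - B * norm (x - x1)) \<le> f x"
    using pcl_lower_bound[OF f pcl_real[OF f x1]] by blast
  define A where "A = real_of_ereal (f x1) - 1 - B * norm (z - x1) + a \<bullet> z"
  define E where "E = B + norm a"
  have low: "ereal (A - E * norm (x - z) + \<gamma> / 2 * (norm (x - z))\<^sup>2) \<le> F x" for x
  proof -
    have "norm (x - x1) \<le> norm (x - z) + norm (z - x1)"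
      using norm_triangle_ineq[of "x - z" "z - x1"] by simp
    then have 1: "B * norm (x - x1) \<le> B * (norm (x - z) + norm (z - x1))"
      using B by (intro mult_left_mono)
    have 2: "a \<bullet> x \<ge> a \<bullet> z - norm a * norm (x - z)"
      using Cauchy_Schwarz_ineq2[of a "x - z"] by (simp add: inner_diff_right)
    have "A - E * norm (x - z) + \<gamma> / 2 * (norm (x - z))\<^sup>2 \<le>
       (real_of_ereal (f x1) - 1 - B * norm (x - x1)) + r x"
      using 1 2 by (simp add: A_def E_def r_def algebra_simps)
    then have "ereal (A - E * norm (x - z) + \<gamma> / 2 * (norm (x - z))\<^sup>2) \<le>
       ereal (real_of_ereal (f x1) - 1 - B * norm (x - x1)) + ereal (r x)" by simp
    also have "\<dots> \<le> F x" unfolding F_def by (intro add_mono B) auto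
    finally show ?thesis .
  qed
  \<comment> \<open>Completing the square: half of the quadratic term absorbs the linear one, the
    other half remains for coercivity.\<close>
  have quad: "A - E\<^sup>2 / \<gamma> + \<gamma> / 4 * s\<^sup>2 \<le> A - E * s + \<gamma> / 2 * s\<^sup>2" for s
  proof -
    have "\<gamma> / 4 * (s - 2 * E / \<gamma>)\<^sup>2 = \<gamma> / 4 * s\<^sup>2 - E * s + E\<^sup>2 / \<gamma>"
      using \<gamma> by (simp add: power2_eq_square field_simps)
    moreover have "\<gamma> / 4 * (s - 2 * E / \<gamma>)\<^sup>2 \<ge> 0" using \<gamma> by simp
    ultimately show ?thesis by linarith
  qed
  have low2: "ereal (A - E\<^sup>2 / \<gamma> + \<gamma> / 4 * (norm (x - z))\<^sup>2) \<le> F x" for x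
    using quad low[of x] by (meson ereal_less_eq(3) order_trans)
  have "bounded {x. F x \<le> ereal c}" for c
  proof -
    define R where "R = (c - A + E\<^sup>2 / \<gamma>) * 4 / \<gamma> + 1"
    have "dist z x \<le> R" if "F x \<le> ereal c" for x
    proof -
      have "A - E\<^sup>2 / \<gamma> + \<gamma> / 4 * (norm (x - z))\<^sup>2 \<le> c"
        using low2[of x] that by (meson ereal_less_eq(3) order_trans)
      then have "(norm (x - z))\<^sup>2 \<le> R - 1" using \<gamma> by (simp add: R_def field_simps)
      \<comment> \<open>Bounding \<open>s\<close> by the square of \<open>s\<close> plus
        \<open>1\<close> turns a bound on the squared norm into one on the norm without a square
        root.\<close>
      moreover have "norm (x - z) \<le> (norm (x - z))\<^sup>2 + 1"
        using sum_power2_ge_zero[of "norm (x - z) - 1/2" 0] by (simp add: power2_eq_square algebra_simps)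
      ultimately show ?thesis by (simp add: dist_norm norm_minus_commute)
    qed
    then show ?thesis unfolding bounded_def by blast
  qed
  moreover have "ereal (A - E\<^sup>2 / \<gamma>) \<le> F x" for x
  proof -
    have "ereal (A - E\<^sup>2 / \<gamma>) \<le> ereal (A - E\<^sup>2 / \<gamma> + \<gamma> / 4 * (norm (x - z))\<^sup>2)" using \<gamma> by simp
    then show ?thesis using low2[of x] by (rule order_trans)
  qed
  ultimately obtain p where p: "\<And>x. F p \<le> F x"
    using pcl_coercive_minimizer[OF F] by blast
  have "F p < \<infinity>" using p[of x1] pcl_real[OF f x1] by (auto simp: F_def)
  then have "p \<in> eff_dom f" by (auto simp: F_def eff_dom_def)
  with p show thesis using that by (auto simp: F_def r_def)
qed

text \<open>Compare \<open>p\<close> with the points of the segment towards \<open>q\<close>, divide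
  by \<open>t\<close> and let \<open>t\<close> tend to \<open>0\<close>. Only an upper expansion of
  \<open>r\<close> with slope \<open>L\<close> and quadratic error \<open>C\<close> along this
  segment is required, which serves the plain quadratic and the penalised objectives alike.\<close>

lemma pcl_first_order:
  assumes f: "f \<in> proper_convex_lsc" and p: "p \<in> eff_dom f"
    and min: "\<And>x. f p + ereal (r p) \<le> f x + ereal (r x)"
    and r: "\<And>t. 0 < t \<Longrightarrow> t < 1 \<Longrightarrow> r (t *\<^sub>R q + (1 - t) *\<^sub>R p) \<le> r p + t * L + t\<^sup>2 * C"
  shows "f p \<le> f q + ereal L"
proof (cases "f q")
  case (real a)
  obtain b where b: "f p = ereal b" using pcl_real[OF f p] by blast
  have *: "b \<le> a + L + t * C" if t: "0 < t" "t < 1" for t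
  proof -
    have "f (t *\<^sub>R q + (1 - t) *\<^sub>R p) \<le> ereal (t * a + (1 - t) * b)"
      by (rule pcl_convexD[OF f]) (use real b t in auto)
    with min[of "t *\<^sub>R q + (1 - t) *\<^sub>R p"] have
      "f p + ereal (r p) \<le> ereal (t * a + (1 - t) * b) + ereal (r (t *\<^sub>R q + (1 - t) *\<^sub>R p))"
      by (meson add_right_mono order_trans)
    then have "b + r p \<le> t * a + (1 - t) * b + r (t *\<^sub>R q + (1 - t) *\<^sub>R p)" by (simp add: b)
    with r[OF t] have "t * b \<le> t * (a + L + t * C)" by (simp add: algebra_simps power2_eq_square)
    then show ?thesis using t by simp
  qed
  have "((\<lambda>t. a + L + t * C) \<longlongrightarrow> a + L + 0 * C) (at_right 0)"
    by (intro tendsto_intros)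
  moreover have "eventually (\<lambda>t. b \<le> a + L + t * C) (at_right 0)"
    using * by (auto simp: eventually_at_right_field intro!: exI[of _ 1])
  ultimately have "b \<le> a + L + 0 * C"
    by (intro tendsto_lowerbound) auto
  then show ?thesis by (simp add: real b)
qed (use pcl_not_minf[OF f] in auto)

section \<open>Subgradients, minimisers of quadratic perturbations and proximal points\<close>

lemma subdifferentialI:
  assumes f: "f \<in> proper_convex_lsc" and p: "p \<in> eff_dom f" and "\<And>q. f p + ereal (v \<bullet> (q - p)) \<le> f q"
  shows "v \<in> subdifferential f p"
  using assms pcl_real[OF f p] by (cases "f p") (auto simp: subdifferential_def)

lemma subdifferentialE:
  assumes "v \<in> subdifferential f p"
  obtains c where "f p = ereal c" "\<And>q. ereal (c + v \<bullet> (q - p)) \<le> f q"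
  using assms by (cases "f p") (auto simp: subdifferential_def split: if_splits)

lemma subdifferential_monotone:
  assumes "v \<in> subdifferential f p" "w \<in> subdifferential f q"
  shows "0 \<le> (p - q) \<bullet> (v - w)"
proof -
  obtain c where c: "f p = ereal c" "\<And>q. ereal (c + v \<bullet> (q - p)) \<le> f q" using subdifferentialE[OF assms(1)] by metis
  obtain d where d: "f q = ereal d" "\<And>r. ereal (d + w \<bullet> (r - q)) \<le> f r" using subdifferentialE[OF assms(2)] by metis
  have "c + v \<bullet> (q - p) \<le> d" "d + w \<bullet> (p - q) \<le> c" using c(2)[of q] d(2)[of p] c(1) d(1) by auto
  then show ?thesis by (simp add: inner_simps inner_commute algebra_simps)
qed

lemma quadratic_minimizer_subdifferential:
  fixes f :: "'a::real_inner \<Rightarrow> ereal"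
  assumes f: "f \<in> proper_convex_lsc" and p: "p \<in> eff_dom f"
    and min: "\<And>x. f p + ereal (a \<bullet> p + \<gamma> / 2 * (norm (p - z))\<^sup>2) \<le> f x + ereal (a \<bullet> x + \<gamma> / 2 * (norm (x - z))\<^sup>2)"
  shows "\<gamma> *\<^sub>R (z - p) - a \<in> subdifferential f p"
proof (rule subdifferentialI[OF f p])
  fix q
  define L where "L = a \<bullet> (q - p) + \<gamma> * ((p - z) \<bullet> (q - p))"
  have "f p \<le> f q + ereal L"
  proof (rule pcl_first_order[OF f p min])
    fix t :: real
    show "a \<bullet> (t *\<^sub>R q + (1 - t) *\<^sub>R p) + \<gamma> / 2 * (norm (t *\<^sub>R q + (1 - t) *\<^sub>R p - z))\<^sup>2
      \<le> a \<bullet> p + \<gamma> / 2 * (norm (p - z))\<^sup>2 + t * L + t\<^sup>2 * (\<gamma> / 2 * (norm (q - p))\<^sup>2)"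
      unfolding L_def power2_norm_eq_inner power2_eq_square[of t]
      by (simp add: inner_simps inner_commute field_simps)
  qed
  moreover have "(\<gamma> *\<^sub>R (z - p) - a) \<bullet> (q - p) = - L"
    by (simp add: L_def inner_simps algebra_simps)
  ultimately show "f p + ereal ((\<gamma> *\<^sub>R (z - p) - a) \<bullet> (q - p)) \<le> f q"
    using pcl_real[OF f p] by (cases "f q"; cases "f p"; simp)
qed

text \<open>\<open>arg_min_on\<close> is a choice operator, so \<open>p\<close> is known to be a
  minimiser only once some minimiser exists. This turns the argmin recursion for \<open>x\<close>
  into a subgradient inclusion.\<close>

lemma arg_min_quadratic_subdifferential:
  fixes f :: "'a::{real_inner, complete_space} \<Rightarrow> ereal"
  assumes f: "f \<in> proper_convex_lsc" and \<gamma>: "\<gamma> > 0"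
    and p: "p = arg_min_on (\<lambda>w. f w + ereal (a \<bullet> w + \<gamma> / 2 * (norm (w - z))\<^sup>2)) UNIV"
  shows "\<gamma> *\<^sub>R (z - p) - a \<in> subdifferential f p"
proof -
  let ?F = "\<lambda>w. f w + ereal (a \<bullet> w + \<gamma> / 2 * (norm (w - z))\<^sup>2)"
  obtain p' where p': "p' \<in> eff_dom f" "\<And>x. ?F p' \<le> ?F x"
    using pcl_add_quadratic_minimizer[OF f \<gamma>, of a z] by metis
  have "is_arg_min ?F (\<lambda>x. x \<in> UNIV) p"
    unfolding p arg_min_on_def arg_min_def
    by (rule someI[of _ p']) (use p' in \<open>simp add: is_arg_min_linorder\<close>)
  then have min: "\<And>x. ?F p \<le> ?F x" by (simp add: is_arg_min_linorder)
  have "?F p < \<infinity>" using min[of p'] pcl_real[OF f p'(1)] by (auto simp: eff_dom_def)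
  then have "p \<in> eff_dom f" by (auto simp: eff_dom_def)
  then show ?thesis using min by (intro quadratic_minimizer_subdifferential f)
qed

lemma prox_exists:
  fixes f :: "'a::{real_inner, complete_space} \<Rightarrow> ereal"
  assumes "f \<in> proper_convex_lsc" "\<gamma> > 0"
  shows "\<exists>p. \<gamma> *\<^sub>R (b - p) \<in> subdifferential f p"
  using arg_min_quadratic_subdifferential[OF assms refl, of b 0] by auto

section \<open>A subgradient orthogonal to the constraint subspace\<close>

text \<open>Uniform boundedness by Baire's theorem in the complete space \<open>K\<close>: some set
  \<open>A N\<close> has interior relative to \<open>K\<close>. Upper bounds suffice because
  \<open>K\<close> also contains \<open>- h\<close>.\<close>

lemma pointwise_bounded_imp_bounded_on_closed_subspace:
  fixes W :: "nat \<Rightarrow> 'a::{real_inner, complete_space}"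
  assumes K: "subspace K" "closed K" and W: "\<And>n. W n \<in> K"
    and pw: "\<And>h. h \<in> K \<Longrightarrow> \<exists>c. \<forall>n. W n \<bullet> h \<le> c"
  obtains M where "\<And>n. norm (W n) \<le> M"
proof -
  define A where "A N = {h \<in> K. \<forall>n. W n \<bullet> h \<le> real N}" for N
  have "closed (A N)" for N
  proof -
    have "A N = K \<inter> (\<Inter>n. {h. W n \<bullet> h \<le> real N})" by (auto simp: A_def)
    then show ?thesis
      by (auto intro!: closed_Int K closed_INT closed_Collect_le continuous_intros)
  qed
  then have clA: "closedin (top_of_set K) (A N)" for N
    by (intro closed_subset) (auto simp: A_def)
  have cover: "\<Union>(range A) = K"
  proof
    show "K \<subseteq> \<Union>(range A)"
    proof
      fix h assume h: "h \<in> K"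
      then obtain c where c: "\<And>n. W n \<bullet> h \<le> c" using pw by blast
      obtain N where "c \<le> real N" using real_arch_simple by blast
      then have "h \<in> A N" using h c by (auto simp: A_def intro: order_trans)
      then show "h \<in> \<Union>(range A)" by blast
    qed
  qed (auto simp: A_def)
  have "completely_metrizable_space (top_of_set K)"
    using K(2) completely_metrizable_space_closedin completely_metrizable_space_euclidean closed_closedin by blast
  moreover have "top_of_set K interior_of \<Union>(range A) = K"
    unfolding cover using interior_of_topspace[of "top_of_set K"] by simp
  moreover have "K \<noteq> {}" using subspace_0[OF K(1)] by blast
  ultimately obtain N where "top_of_set K interior_of A N \<noteq> {}"
    using Baire_category_alt[of "top_of_set K" "range A"] clA by auto
  then obtain h0 U where U: "openin (top_of_set K) U" "h0 \<in> U" "U \<subseteq> A N"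
    by (auto simp: interior_of_def)
  then obtain r where r: "r > 0" "ball h0 r \<inter> K \<subseteq> U"
    by (meson openin_contains_ball)
  have h0: "h0 \<in> K" using U by (auto simp: A_def)
  then obtain c where c: "\<And>n. W n \<bullet> (- h0) \<le> c" using pw subspace_neg[OF K(1)] by blast
  have "norm (W n) \<le> (real N + c) * 2 / r" for n
  proof (cases "W n = 0")
    case True
    have "W n \<bullet> h0 \<le> real N" using U by (auto simp: A_def)
    then have "real N + c \<ge> 0" using c[of n] by simp
    then show ?thesis using r True by simp
  next
    case False
    \<comment> \<open>Testing with the multiple of \<open>W n\<close> of norm \<open>r / 2\<close>
      keeps \<open>h0 + h\<close> inside the ball; the bound \<open>c\<close> at \<open>- h0\<close>
      then removes the contribution of the centre.\<close>
    define h where "h = (r / 2 / norm (W n)) *\<^sub>R W n"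
    have "norm h = r / 2" using False r by (simp add: h_def)
    moreover have "h0 + h \<in> K"
      unfolding h_def by (intro subspace_add subspace_scale K h0 W)
    ultimately have "h0 + h \<in> ball h0 r \<inter> K" using r(1) by (simp add: dist_norm)
    then have "h0 + h \<in> A N" using r(2) U(3) by blast
    then have "W n \<bullet> h0 + W n \<bullet> h \<le> real N" by (auto simp: A_def inner_add_right)
    moreover have "W n \<bullet> h = r / 2 * norm (W n)"
      using False by (simp add: h_def power2_norm_eq_inner[symmetric] power2_eq_square)
    ultimately have "r / 2 * norm (W n) \<le> real N + c" using c[of n] by simp
    then show ?thesis using r by (simp add: field_simps)
  qed
  then show thesis using that by blast
qed

text \<open>Continuity is not among the assumptions: symmetry and idempotence make the ranges of
  \<open>P\<close> and \<open>Q\<close> orthogonal, and Pythagoras gives the norm bounds.\<close>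

locale orthogonal_projector =
  fixes P :: "'a::{real_inner, complete_space} \<Rightarrow> 'a"
  assumes lin: "linear P" and idem: "P (P a) = P a" and selfadj: "P a \<bullet> b = a \<bullet> P b"
begin

definition "Q a = a - P a"

lemma linear_Q: "linear Q"
  unfolding Q_def using lin by (intro linear_compose_sub linear_ident)

lemmas P_simps = linear_add[OF lin] linear_diff[OF lin] linear_scale[OF lin] linear_0[OF lin] linear_neg[OF lin]
lemmas Q_simps = linear_add[OF linear_Q] linear_diff[OF linear_Q] linear_scale[OF linear_Q] linear_0[OF linear_Q] linear_neg[OF linear_Q]

lemma P_Q [simp]: "P (Q a) = 0" and Q_P [simp]: "Q (P a) = 0"
  by (simp_all add: Q_def P_simps idem)

lemma inner_Q_P [simp]: "Q a \<bullet> P b = 0" and inner_P_Q [simp]: "P b \<bullet> Q a = 0"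
  using selfadj[of "Q a" b] by (simp_all add: inner_commute)

lemma P_plus_Q: "P a + Q a = a" by (simp add: Q_def)

lemma inner_Q_right: "Q a \<bullet> b = Q a \<bullet> Q b"
  by (subst P_plus_Q[of b, symmetric]) (simp add: inner_add_right)

lemma Q_eq_0: "P a = a \<Longrightarrow> Q a = 0"
  by (simp add: Q_def)

lemma norm_sq_decomp: "(norm a)\<^sup>2 = (norm (P a))\<^sup>2 + (norm (Q a))\<^sup>2"
  by (subst P_plus_Q[of a, symmetric]) (simp add: power2_norm_eq_inner inner_simps P_simps idem Q_simps)

lemma norm_P_le: "norm (P a) \<le> norm a" and norm_Q_le: "norm (Q a) \<le> norm a"
  by (rule power2_le_imp_le; simp add: norm_sq_decomp[of a])+

lemma norm_reflection: "norm (P a - Q a) = norm a"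
proof -
  have "(norm (P a - Q a))\<^sup>2 = (norm a)\<^sup>2"
    unfolding norm_sq_decomp[of a] by (simp add: power2_norm_eq_inner inner_simps)
  then show ?thesis by simp
qed

lemma bounded_linear_P: "bounded_linear P"
  using norm_P_le by (intro bounded_linear_intro[of _ 1]) (auto simp: P_simps)

lemma bounded_linear_Q: "bounded_linear Q"
  using norm_Q_le by (intro bounded_linear_intro[of _ 1]) (auto simp: Q_simps)

lemmas continuous_P = bounded_linear.continuous_on[OF bounded_linear_P]
lemmas continuous_Q = bounded_linear.continuous_on[OF bounded_linear_Q]
lemmas tendsto_Q = bounded_linear.tendsto[OF bounded_linear_Q]

lemma Q_convex_comb_sq:
  "(norm (Q (t *\<^sub>R a + (1 - t) *\<^sub>R b)))\<^sup>2 =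
    t * (norm (Q a))\<^sup>2 + (1 - t) * (norm (Q b))\<^sup>2 - t * (1 - t) * (norm (Q (a - b)))\<^sup>2"
  using norm_convex_comb_sq[of t "Q a" "Q b"] by (simp add: Q_simps)

lemma convex_on_Q_sq:
  assumes "c \<ge> 0"
  shows "convex_on UNIV (\<lambda>x. c * (norm (Q x))\<^sup>2)"
proof (rule convex_onI)
  fix t :: real and x y :: 'a assume t: "0 < t" "t < 1"
  have "(norm (Q ((1 - t) *\<^sub>R x + t *\<^sub>R y)))\<^sup>2 \<le> (1 - t) * (norm (Q x))\<^sup>2 + t * (norm (Q y))\<^sup>2"
    using Q_convex_comb_sq[of t y x] t by (simp add: add.commute)
  from mult_left_mono[OF this assms]
  show "c * (norm (Q ((1 - t) *\<^sub>R x + t *\<^sub>R y)))\<^sup>2 \<le> (1 - t) * (c * (norm (Q x))\<^sup>2) + t * (c * (norm (Q y))\<^sup>2)"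
    by (simp add: algebra_simps)
qed simp

end

text \<open>The minimisers \<open>p n\<close> of the penalised functions \<open>g + n/2 \<parallel>Q p\<parallel>\<^sup>2 + 1/2 \<parallel>p - x0\<parallel>\<^sup>2\<close> converge to
  \<open>x0\<close>, and the multipliers \<open>- n Q (p n)\<close> lie in the closed subspace \<open>K\<close>. The qualification condition
  makes them pointwise bounded on \<open>K\<close>, hence bounded, and a subgradient is found in the intersection
  of the nested sets of approximate multipliers.\<close>

lemma (in orthogonal_projector) constrained_minimizer_subgradient:
  fixes g :: "'a \<Rightarrow> ereal"
  assumes g: "g \<in> proper_convex_lsc"
    and x0: "P x0 = x0" "x0 \<in> eff_dom g" and min: "\<And>d. P d = d \<Longrightarrow> g x0 \<le> g d"
    and K: "subspace K" "closed K"
      "K = (\<Union>l\<in>{0<..}. (\<lambda>s. l *\<^sub>R s) ` {p - d | p d. p \<in> eff_dom g \<and> P d = d})"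
  obtains v where "P v = 0" "v \<in> subdifferential g x0"
proof -
  obtain c0 where c0: "g x0 = ereal c0" using pcl_real[OF g x0(2)] by blast
  define pen where "pen n p = real n / 2 * (norm (Q p))\<^sup>2" for n p
  have "\<exists>p. p \<in> eff_dom g \<and> (\<forall>x. g p + ereal (pen n p + 1 / 2 * (norm (p - x0))\<^sup>2)
      \<le> g x + ereal (pen n x + 1 / 2 * (norm (x - x0))\<^sup>2))" for n
  proof -
    have F: "(\<lambda>x. g x + ereal (pen n x)) \<in> proper_convex_lsc"
      unfolding pen_def
      by (intro pcl_add_continuous g convex_on_Q_sq continuous_intros continuous_Q) auto
    obtain p where p: "p \<in> eff_dom (\<lambda>x. g x + ereal (pen n x))"
      "\<And>x. (g p + ereal (pen n p)) + ereal (0 \<bullet> p + 1 / 2 * (norm (p - x0))\<^sup>2)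
        \<le> (g x + ereal (pen n x)) + ereal (0 \<bullet> x + 1 / 2 * (norm (x - x0))\<^sup>2)"
      using pcl_add_quadratic_minimizer[OF F, of 1 0 x0] by auto
    then show ?thesis by (auto simp: eff_dom_def add.assoc intro!: exI[of _ p])
  qed
  then obtain p where pdom: "\<And>n. p n \<in> eff_dom g" and
    pmin: "\<And>n x. g (p n) + ereal (pen n (p n) + 1 / 2 * (norm (p n - x0))\<^sup>2)
      \<le> g x + ereal (pen n x + 1 / 2 * (norm (x - x0))\<^sup>2)" by metis
  define G where "G n = real_of_ereal (g (p n))" for n
  have G: "g (p n) = ereal (G n)" for n using pcl_real[OF g pdom] by (simp add: G_def)
  \<comment> \<open>Optimality of \<open>p n\<close> as a variational inequality: the penalty has
    gradient \<open>n Q (p n)\<close> and the proximity term has gradient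
    \<open>p n - x0\<close>.\<close>
  have sub: "G n \<le> a + (real n * (Q (p n) \<bullet> (q - p n)) + (p n - x0) \<bullet> (q - p n))" if "g q = ereal a" for n q a
  proof -
    have norm_add_sq: "(norm (t *\<^sub>R a + b))\<^sup>2 = (norm b)\<^sup>2 + t * (2 * (b \<bullet> a)) + t\<^sup>2 * (norm a)\<^sup>2" for a b :: 'a and t
      unfolding power2_norm_eq_inner power2_eq_square[of t] by (simp add: inner_simps inner_commute)
    have "g (p n) \<le> g q + ereal (real n * (Q (p n) \<bullet> (q - p n)) + (p n - x0) \<bullet> (q - p n))"
    proof (rule pcl_first_order[OF g pdom pmin])
      fix t :: real
      have q: "t *\<^sub>R q + (1 - t) *\<^sub>R p n - x0 = t *\<^sub>R (q - p n) + (p n - x0)"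
        and qq: "t *\<^sub>R q + (1 - t) *\<^sub>R p n = t *\<^sub>R (q - p n) + p n" by (simp_all add: algebra_simps)
      show "pen n (t *\<^sub>R q + (1 - t) *\<^sub>R p n) + 1 / 2 * (norm (t *\<^sub>R q + (1 - t) *\<^sub>R p n - x0))\<^sup>2
        \<le> pen n (p n) + 1 / 2 * (norm (p n - x0))\<^sup>2
          + t * (real n * (Q (p n) \<bullet> (q - p n)) + (p n - x0) \<bullet> (q - p n))
          + t\<^sup>2 * (real n / 2 * (norm (Q (q - p n)))\<^sup>2 + 1 / 2 * (norm (q - p n))\<^sup>2)"
        unfolding pen_def q inner_Q_right[of "p n" "q - p n"] unfolding qq linear_add[OF linear_Q] linear_scale[OF linear_Q] norm_add_sq
        by (simp add: field_simps)
    qed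
    then show ?thesis using that G by simp
  qed
  \<comment> \<open>\<open>V n\<close> is the optimal value of the penalised problem; it is at most
    \<open>c0\<close> because \<open>x0\<close> incurs neither penalty nor proximity cost.\<close>
  define V where "V n = G n + pen n (p n) + 1 / 2 * (norm (p n - x0))\<^sup>2" for n
  have Vle: "V n \<le> c0" for n
    using pmin[of n x0] by (simp add: G c0 V_def pen_def Q_eq_0[OF x0(1)] add.assoc)
  \<comment> \<open>The proximity term makes each penalised objective strongly convex with modulus
    1, and the objectives increase with \<open>n\<close>. This one inequality makes \<open>V\<close>
    increasing and \<open>p\<close> a Cauchy sequence.\<close>
  have step: "V n + 1 / 2 * (norm (p m - p n))\<^sup>2 \<le> V m" if "n \<le> m" for m n
  proof -
    define e where "e = p m - p n"
    have pm: "p m = p n + e" by (simp add: e_def)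
    have "G n \<le> G m + (real n * (Q (p n) \<bullet> Q e) + (p n - x0) \<bullet> e)"
      using sub[OF G[of m], of n] inner_Q_right[of "p n" e] by (simp add: e_def)
    moreover have "(norm (p m - x0))\<^sup>2 = (norm (p n - x0))\<^sup>2 + 2 * ((p n - x0) \<bullet> e) + (norm e)\<^sup>2"
      unfolding pm power2_norm_eq_inner by (simp add: inner_simps inner_commute algebra_simps)
    moreover have "pen m (p m) \<ge> pen n (p m)"
      unfolding pen_def using that by (intro mult_right_mono divide_right_mono) auto
    moreover have "pen n (p m) = pen n (p n) + real n * (Q (p n) \<bullet> Q e) + pen n e"
      unfolding pen_def pm power2_norm_eq_inner by (simp add: Q_simps inner_simps inner_commute field_simps)
    moreover have "pen n e \<ge> 0" by (simp add: pen_def)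
    ultimately show ?thesis unfolding V_def e_def[symmetric] by linarith
  qed
  have "incseq V"
  proof (rule incseq_SucI)
    fix n
    have "0 \<le> 1 / 2 * (norm (p (Suc n) - p n))\<^sup>2" by simp
    then show "V n \<le> V (Suc n)" using step[of n "Suc n"] by linarith
  qed
  then obtain l where l: "V \<longlonglongrightarrow> l" "\<And>n. V n \<le> l"
    using incseq_convergent[of V c0] Vle by metis
  have "Cauchy p"
  proof (rule metric_CauchyI)
    fix e :: real assume "e > 0"
    then have "eventually (\<lambda>n. V n > l - 1 / 2 * (e/2)\<^sup>2) sequentially"
      by (intro order_tendstoD(1)[OF l(1)]) simp
    then obtain N where N: "V N > l - 1 / 2 * (e/2)\<^sup>2" by (auto simp: eventually_sequentially)
    have h: "dist (p m) (p N) < e/2" if "m \<ge> N" for m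
    proof -
      have "(norm (p m - p N))\<^sup>2 < (e/2)\<^sup>2" using step[OF that] N l(2)[of m] by linarith
      then show ?thesis unfolding dist_norm by (rule power2_less_imp_less) (use \<open>e>0\<close> in auto)
    qed
    have "dist (p m) (p n) < e" if "m \<ge> N" "n \<ge> N" for m n
      using h[OF that(1)] h[OF that(2)] by (rule dist_triangle_half_l)
    then show "\<exists>M. \<forall>m\<ge>M. \<forall>n\<ge>M. dist (p m) (p n) < e" by blast
  qed
  then obtain p' where p': "p \<longlonglongrightarrow> p'" using Cauchy_convergent convergentD by blast
  then obtain R where R: "\<And>n. norm (p n - x0) \<le> R" "R \<ge> 0"
    using tendsto_diff[OF p' tendsto_const[of x0]] convergent_imp_Bseq[of "\<lambda>n. p n - x0"]
    by (metis BseqE convergentI less_imp_le)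
  obtain B where B: "B \<ge> 0" "\<And>x. ereal (c0 - 1 - B * norm (x - x0)) \<le> g x"
    using pcl_lower_bound[OF g c0] by blast
  have Glow: "c0 - 1 - B * R \<le> G n" for n
    using B(2)[of "p n"] mult_left_mono[OF R(1)[of n] B(1)] by (simp add: G)
  have "Q p' = 0"
  proof -
    \<comment> \<open>The penalty stays bounded, since \<open>V n\<close> is at most
      \<open>c0\<close> while \<open>g\<close> is bounded below along \<open>p\<close>; dividing by
      \<open>n\<close> makes the limit feasible.\<close>
    have "(norm (Q (p n)))\<^sup>2 \<le> (2 * (1 + B * R)) / real n" if "n \<ge> 1" for n
    proof -
      have "0 \<le> 1 / 2 * (norm (p n - x0))\<^sup>2" by simp
      then have "pen n (p n) \<le> 1 + B * R" using Vle[of n] Glow[of n] unfolding V_def by linarith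
      then show ?thesis using that by (simp add: pen_def field_simps)
    qed
    moreover have "(\<lambda>n. (2 * (1 + B * R)) / real n) \<longlonglongrightarrow> 0" by (rule lim_const_over_n)
    moreover have "(\<lambda>n. (norm (Q (p n)))\<^sup>2) \<longlonglongrightarrow> (norm (Q p'))\<^sup>2"
      by (intro tendsto_intros tendsto_Q p')
    ultimately have "(norm (Q p'))\<^sup>2 \<le> 0"
      by (intro LIMSEQ_le) auto
    then show ?thesis by simp
  qed
  then have "P p' = p'" by (simp add: Q_def)
  \<comment> \<open>Lower semicontinuity gives that \<open>g p'\<close> is at most \<open>c0\<close>
    minus half the squared distance from \<open>p'\<close> to \<open>x0\<close>, whereas feasibility
    of \<open>p'\<close> gives that \<open>g p'\<close> is at least \<open>c0\<close>.\<close>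
  have "p' = x0"
  proof -
    have "g (p n) \<le> ereal (c0 - 1 / 2 * (norm (p n - x0))\<^sup>2)" for n
    proof -
      have "0 \<le> pen n (p n)" by (simp add: pen_def)
      then show ?thesis using Vle[of n] unfolding G V_def by simp
    qed
    then have "g p' \<le> ereal (c0 - 1 / 2 * (norm (p' - x0))\<^sup>2)"
      by (rule pcl_lsc_seq[OF g p', rotated]) (intro tendsto_intros p')
    with min[OF \<open>P p' = p'\<close>] have "ereal c0 \<le> ereal (c0 - 1 / 2 * (norm (p' - x0))\<^sup>2)"
      unfolding c0 by (rule order_trans)
    then show ?thesis by simp
  qed
  with p' have px0: "p \<longlonglongrightarrow> x0" by simp
  define W where "W n = - (real n) *\<^sub>R Q (p n)" for n
  \<comment> \<open>\<open>W n\<close> is an approximate subgradient at \<open>x0\<close>: rewriting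
    \<open>sub\<close> around \<open>x0\<close> leaves two squared norms, which have the favourable
    sign and are dropped.\<close>
  have mult: "W n \<bullet> (q - x0) \<le> a - G n + norm (p n - x0) * norm (q - x0)" if "g q = ereal a" for n q a
  proof -
    have "Q (p n) \<bullet> (q - p n) = Q (p n) \<bullet> (q - x0) - Q (p n) \<bullet> Q (p n)"
      using inner_Q_right[of "p n" "x0 - p n"] Q_eq_0[OF x0(1)] by (simp add: inner_simps Q_simps)
    then have "real n * (Q (p n) \<bullet> (q - p n)) = - (W n \<bullet> (q - x0)) - real n * (Q (p n) \<bullet> Q (p n))"
      by (simp only: W_def inner_scaleR_left right_diff_distrib minus_mult_left minus_minus)
    moreover have "real n * (Q (p n) \<bullet> Q (p n)) \<ge> 0" by simp
    moreover have "(p n - x0) \<bullet> (q - p n) = (p n - x0) \<bullet> (q - x0) - (p n - x0) \<bullet> (p n - x0)"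
      by (simp add: inner_simps)
    moreover have "(p n - x0) \<bullet> (p n - x0) \<ge> 0" by simp
    moreover have "(p n - x0) \<bullet> (q - x0) \<le> norm (p n - x0) * norm (q - x0)" by (rule norm_cauchy_schwarz)
    ultimately show ?thesis using sub[OF that, of n] by linarith
  qed
  have PW: "P (W n) = 0" for n by (simp add: W_def P_simps)
  have "W n \<in> K" for n
  proof -
    have "1 *\<^sub>R (p n - P (p n)) \<in> K" unfolding K(3) using pdom[of n] idem
      by (intro UN_I[of 1] imageI) auto
    then show ?thesis unfolding W_def by (intro subspace_scale K) (simp add: Q_def)
  qed
  moreover have "\<exists>c. \<forall>n. W n \<bullet> h \<le> c" if hK: "h \<in> K" for h
  proof -
    obtain t q d where h: "t > 0" "q \<in> eff_dom g" "P d = d" "h = t *\<^sub>R (q - d)"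
      using hK unfolding K(3) by auto
    obtain a where a: "g q = ereal a" using pcl_real[OF g h(2)] by blast
    \<comment> \<open>\<open>W n\<close> is orthogonal to the diagonal part \<open>d\<close> and to
      \<open>x0\<close>, so a pairing with \<open>t (q - d)\<close> becomes one with
      \<open>t (q - x0)\<close>, where \<open>mult\<close> applies with a bound free of
      \<open>n\<close>.\<close>
    have "W n \<bullet> h \<le> t * (a - (c0 - 1 - B * R) + R * norm (q - x0))" for n
    proof -
      have "W n \<bullet> e = 0" if "P e = e" for e
        using selfadj[of "W n" e] PW that by simp
      then have "W n \<bullet> d = 0" "W n \<bullet> x0 = 0" using h(3) x0(1) by blast+
      then have "W n \<bullet> h = t * (W n \<bullet> (q - x0))" by (simp add: h(4) inner_simps)
      moreover have "W n \<bullet> (q - x0) \<le> a - (c0 - 1 - B * R) + R * norm (q - x0)"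
        using mult[OF a, of n] Glow[of n] mult_right_mono[OF R(1)[of n], of "norm (q - x0)"] by simp
      ultimately show ?thesis using h(1) by (simp only: mult_left_mono less_imp_le)
    qed
    then show ?thesis by blast
  qed
  ultimately obtain M where M: "\<And>n. norm (W n) \<le> M"
    using pointwise_bounded_imp_bounded_on_closed_subspace[OF K(1,2)] by metis
  \<comment> \<open>Subgradients at \<open>x0\<close> up to an error. Its summand \<open>1\<close>
    comes from the drop of \<open>g (p n)\<close> below \<open>c0\<close>, its summand
    \<open>norm (q - x0)\<close> from the distance of \<open>p n\<close> to \<open>x0\<close>. These
    conditions are closed and convex in \<open>w\<close>, so a common point replaces a weak limit of
    \<open>W\<close>.\<close>
  define C where "C j = {w. P w = 0 \<and> norm w \<le> M \<and>
    (\<forall>q a. g q = ereal a \<longrightarrow> w \<bullet> (q - x0) \<le> a - c0 + (1 + norm (q - x0)) * (1 / real (Suc j)))}" for j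
  have "\<exists>v. \<forall>j. v \<in> C j"
  proof (rule nested_closed_convex_Inter_nonempty)
    fix j
    have C: "C j = {w. P w = 0} \<inter> cball 0 M \<inter>
      (\<Inter>(q, a)\<in>{(q, a). g q = ereal a}. {w. (q - x0) \<bullet> w \<le> a - c0 + (1 + norm (q - x0)) * (1 / real (Suc j))})"
      by (auto simp: C_def inner_commute)
    show "closed (C j)" unfolding C
      by (intro closed_Int closed_INT ballI closed_cball closed_Collect_eq)
        (auto intro!: continuous_intros continuous_P closed_halfspace_le)
    have "convex {w. P w = 0}" by (auto intro!: convexI simp: P_simps)
    then show "convex (C j)" unfolding C
      by (intro convex_Int convex_INT convex_cball) (auto simp: convex_halfspace_le)
    show "bounded (C 0)" by (rule bounded_subset[OF bounded_cball[of 0 M]]) (auto simp: C_def)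
    have "eventually (\<lambda>n. ereal (c0 - 1 / real (Suc j)) < g (p n)) sequentially"
      using filterlim_iff[THEN iffD1, OF px0] pcl_lscD[OF g, of "ereal (c0 - 1 / real (Suc j))" x0] c0 by auto
    moreover have "eventually (\<lambda>n. dist (p n) x0 < 1 / real (Suc j)) sequentially"
      by (rule tendstoD[OF px0]) simp
    ultimately have "eventually (\<lambda>n. W n \<in> C j) sequentially"
    proof eventually_elim
      case (elim n)
      have "W n \<bullet> (q - x0) \<le> a - c0 + (1 + norm (q - x0)) * (1 / real (Suc j))" if "g q = ereal a" for q a
      proof -
        have "norm (p n - x0) * norm (q - x0) \<le> (1 / real (Suc j)) * norm (q - x0)"
          using elim(2) by (intro mult_right_mono) (auto simp: dist_norm)
        then show ?thesis using mult[OF that, of n] elim(1) by (simp add: G add_divide_distrib del: of_nat_Suc)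
      qed
      then show ?case using PW M by (simp add: C_def)
    qed
    then show "C j \<noteq> {}" by (auto simp: eventually_sequentially)
    show "decseq C"
      unfolding decseq_def
    proof (intro allI impI subsetI)
      fix m n w assume "m \<le> (n::nat)" and w: "w \<in> C n"
      then have *: "(1 + norm (q - x0)) * (1 / real (Suc n)) \<le> (1 + norm (q - x0)) * (1 / real (Suc m))" for q
        by (intro mult_left_mono divide_left_mono) auto
      have "w \<bullet> (q - x0) \<le> a - c0 + (1 + norm (q - x0)) * (1 / real (Suc m))" if "g q = ereal a" for q a
      proof -
        have "w \<bullet> (q - x0) \<le> a - c0 + (1 + norm (q - x0)) * (1 / real (Suc n))"
          using w that unfolding C_def by blast
        then show ?thesis using *[of q] by linarith
      qed
      then show "w \<in> C m" using w by (simp add: C_def)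
    qed
  qed
  then obtain v where v: "\<And>j. v \<in> C j" by blast
  have "v \<in> subdifferential g x0"
  proof (rule subdifferentialI[OF g x0(2)])
    fix q
    show "g x0 + ereal (v \<bullet> (q - x0)) \<le> g q"
    proof (cases "g q")
      case (real a)
      have "(\<lambda>j. a - c0 + (1 + norm (q - x0)) * (1 / real (Suc j))) \<longlonglongrightarrow> a - c0 + (1 + norm (q - x0)) * 0"
        by (intro tendsto_intros LIMSEQ_Suc[OF lim_const_over_n])
      moreover have "v \<bullet> (q - x0) \<le> a - c0 + (1 + norm (q - x0)) * (1 / real (Suc j))" for j
        using v[of j] real unfolding C_def by blast
      ultimately have "v \<bullet> (q - x0) \<le> a - c0 + (1 + norm (q - x0)) * 0"
        by (intro LIMSEQ_le_const) auto
      then show ?thesis by (simp add: c0 real)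
    qed (use pcl_not_minf[OF g] in auto)
  qed
  moreover have "P v = 0" using v[of 0] by (simp add: C_def)
  ultimately show thesis using that by blast
qed

section \<open>Weak convergence of inertial Krasnosel'skii--Mann iterations\<close>

text \<open>\<open>limsup_sqdist_le w h \<rho>\<close> says that \<open>limsup \<parallel>w n - h\<parallel>\<^sup>2 \<le> \<rho>\<close>. The asymptotic centre of a bounded
  sequence is the unique minimiser of this limit superior.\<close>

definition limsup_sqdist_le :: "(nat \<Rightarrow> 'a::real_inner) \<Rightarrow> 'a \<Rightarrow> real \<Rightarrow> bool" where
  "limsup_sqdist_le w h \<rho> \<longleftrightarrow> (\<forall>e>0. eventually (\<lambda>n. (norm (w n - h))\<^sup>2 \<le> \<rho> + e) sequentially)"

lemma limsup_sqdist_le_mono: "limsup_sqdist_le w h \<rho> \<Longrightarrow> \<rho> \<le> \<rho>' \<Longrightarrow> limsup_sqdist_le w h \<rho>'"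
  unfolding limsup_sqdist_le_def
  by (intro allI impI; drule spec; drule (1) mp; erule eventually_mono; linarith)

lemma limsup_sqdist_le_nonneg:
  assumes "limsup_sqdist_le w h \<rho>" shows "0 \<le> \<rho>"
proof (rule field_le_epsilon)
  fix e :: real assume "e > 0"
  then have "eventually (\<lambda>n. (norm (w n - h))\<^sup>2 \<le> \<rho> + e) sequentially"
    using assms by (simp add: limsup_sqdist_le_def)
  then obtain n where "(norm (w n - h))\<^sup>2 \<le> \<rho> + e" by (auto simp: eventually_sequentially)
  then show "0 \<le> \<rho> + e" using zero_le_power2[of "norm (w n - h)"] by linarith
qed

text \<open>Used in two ways: with vanishing \<open>d\<close> and \<open>c = 0\<close> to compare a
  centre with its image under \<open>T\<close>, and with \<open>d = 0\<close> and a negative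
  \<open>c\<close> to show that a shifted centre would be better.\<close>

lemma limsup_sqdist_le_perturb:
  assumes "limsup_sqdist_le w h \<rho>" "d \<longlonglongrightarrow> 0" "\<And>n. (norm (w n - h'))\<^sup>2 \<le> (norm (w n - h))\<^sup>2 + d n + c"
  shows "limsup_sqdist_le w h' (\<rho> + c)"
  unfolding limsup_sqdist_le_def
proof (intro allI impI)
  fix e :: real assume "e > 0"
  then have "eventually (\<lambda>n. (norm (w n - h))\<^sup>2 \<le> \<rho> + e/2) sequentially" "eventually (\<lambda>n. d n < e/2) sequentially"
    using assms(1) order_tendstoD(2)[OF assms(2), of "e/2"] by (auto simp: limsup_sqdist_le_def)
  then show "eventually (\<lambda>n. (norm (w n - h'))\<^sup>2 \<le> \<rho> + c + e) sequentially"
  proof eventually_elim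
    case (elim n)
    then show ?case using assms(3)[of n] by linarith
  qed
qed

text \<open>Uniform convexity of the limsup functional, inherited from the squared norm; it yields
  both convex sublevel sets and uniqueness of the centre.\<close>

lemma limsup_sqdist_le_convex_comb:
  assumes "limsup_sqdist_le w h \<rho>" "limsup_sqdist_le w k \<rho>" "0 \<le> t" "t \<le> 1"
  shows "limsup_sqdist_le w (t *\<^sub>R h + (1 - t) *\<^sub>R k) (\<rho> - t * (1 - t) * (norm (h - k))\<^sup>2)"
  unfolding limsup_sqdist_le_def
proof (intro allI impI)
  fix e :: real assume "e > 0"
  then have "eventually (\<lambda>n. (norm (w n - h))\<^sup>2 \<le> \<rho> + e) sequentially" "eventually (\<lambda>n. (norm (w n - k))\<^sup>2 \<le> \<rho> + e) sequentially"
    using assms(1,2) by (auto simp: limsup_sqdist_le_def)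
  then show "eventually (\<lambda>n. (norm (w n - (t *\<^sub>R h + (1 - t) *\<^sub>R k)))\<^sup>2 \<le> \<rho> - t * (1 - t) * (norm (h - k))\<^sup>2 + e) sequentially"
  proof eventually_elim
    case (elim n)
    have eq: "w n - (t *\<^sub>R h + (1 - t) *\<^sub>R k) = t *\<^sub>R (w n - h) + (1 - t) *\<^sub>R (w n - k)" by (simp add: algebra_simps)
    have "t * (norm (w n - h))\<^sup>2 + (1 - t) * (norm (w n - k))\<^sup>2 \<le> t * (\<rho> + e) + (1 - t) * (\<rho> + e)"
      using elim assms(3,4) by (intro add_mono mult_left_mono) auto
    then show ?case unfolding eq norm_convex_comb_sq by (simp add: algebra_simps norm_minus_commute)
  qed
qed

lemma asymptotic_center_unique:
  assumes "limsup_sqdist_le w c \<rho>" "limsup_sqdist_le w c' \<rho>" "\<And>h \<rho>'. limsup_sqdist_le w h \<rho>' \<Longrightarrow> \<rho> \<le> \<rho>'"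
  shows "c' = c"
  using assms(3)[OF limsup_sqdist_le_convex_comb[OF assms(1,2), of "1/2"]] by simp

text \<open>The limsup functional is convex, continuous and coercive, so its sublevel sets slightly
  above the infimum \<open>r\<close> are nested, closed, convex and bounded.\<close>

lemma asymptotic_center_exists:
  fixes w :: "nat \<Rightarrow> 'a::{real_inner, complete_space}"
  assumes M: "\<And>n. norm (w n) \<le> M"
  obtains c \<rho> where "limsup_sqdist_le w c \<rho>" "\<And>h \<rho>'. limsup_sqdist_le w h \<rho>' \<Longrightarrow> \<rho> \<le> \<rho>'"
proof -
  define S where "S = {\<rho>. \<exists>h. limsup_sqdist_le w h \<rho>}"
  have "limsup_sqdist_le w 0 (M\<^sup>2)"
    unfolding limsup_sqdist_le_def using power_mono[OF M norm_ge_zero, of _ 2]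
    by (auto intro!: always_eventually add_increasing2)
  then have Sne: "S \<noteq> {}" by (auto simp: S_def)
  have Sb: "bdd_below S" using limsup_sqdist_le_nonneg by (auto simp: S_def bdd_below_def)
  define r where "r = Inf S"
  define C where "C j = {h. limsup_sqdist_le w h (r + 1 / real (Suc j))}" for j
  have "\<exists>x. \<forall>j. x \<in> C j"
  proof (rule nested_closed_convex_Inter_nonempty)
    fix j
    show "closed (C j)"
      unfolding closed_sequential_limits
    proof (intro allI impI, elim conjE)
      fix X l assume X: "\<forall>n. X n \<in> C j" "X \<longlonglongrightarrow> l"
      define \<rho> where "\<rho> = r + 1 / real (Suc j)"
      have "limsup_sqdist_le w l \<rho>"
        unfolding limsup_sqdist_le_def
      proof (intro allI impI)
        fix e :: real assume "e > 0"
        \<comment> \<open>\<open>A\<close> bounds the factor \<open>2 * b + d\<close> below once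
          \<open>d\<close> is at most \<open>1\<close>, so replacing \<open>X k\<close> by
          \<open>l\<close> costs at most \<open>d * A\<close>, uniformly in
          \<open>n\<close>.\<close>
        define A where "A = 2 * (M + norm l + 1) + 1"
        have "M \<ge> 0" using M[of 0] norm_ge_zero order_trans by blast
        then have "A > 0" by (simp add: A_def add_pos_nonneg)
        then have "eventually (\<lambda>k. dist (X k) l < min 1 (e / (2 * A))) sequentially"
          using \<open>e > 0\<close> by (intro tendstoD X) auto
        then obtain k where k: "dist (X k) l < min 1 (e / (2 * A))" by (auto simp: eventually_sequentially)
        define d where "d = norm (X k - l)"
        have d: "0 \<le> d" "d \<le> 1" "d * A \<le> e / 2" using k \<open>A > 0\<close> by (auto simp: d_def dist_norm field_simps)
        have "eventually (\<lambda>n. (norm (w n - X k))\<^sup>2 \<le> \<rho> + e / 2) sequentially"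
          using X \<open>e > 0\<close> by (auto simp: C_def limsup_sqdist_le_def \<rho>_def)
        then show "eventually (\<lambda>n. (norm (w n - l))\<^sup>2 \<le> \<rho> + e) sequentially"
        proof eventually_elim
          case (elim n)
          define b where "b = norm (w n - X k)"
          have "norm (X k) \<le> norm l + d" unfolding d_def by norm
          then have b: "b \<le> M + norm l + 1" using M[of n] norm_triangle_ineq4[of "w n" "X k"] d(2) by (simp add: b_def)
          have "norm (w n - l) \<le> b + d" unfolding b_def d_def by norm
          then have "(norm (w n - l))\<^sup>2 \<le> (b + d)\<^sup>2" by (intro power_mono) auto
          also have "\<dots> = b\<^sup>2 + d * (2 * b + d)" by (simp add: power2_eq_square algebra_simps)
          also have "d * (2 * b + d) \<le> d * A" unfolding A_def using b d by (intro mult_left_mono) auto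
          finally show ?case using d(3) elim unfolding b_def by linarith
        qed
      qed
      then show "l \<in> C j" by (simp add: C_def \<rho>_def)
    qed
    show "convex (C j)"
    proof (rule convexI)
      fix x y and u v :: real assume *: "x \<in> C j" "y \<in> C j" "0 \<le> u" "0 \<le> v" "u + v = 1"
      have v: "v = 1 - u" using * by simp
      have "limsup_sqdist_le w (u *\<^sub>R x + (1 - u) *\<^sub>R y) (r + 1 / real (Suc j) - u * (1 - u) * (norm (x - y))\<^sup>2)"
        using * by (intro limsup_sqdist_le_convex_comb) (auto simp: C_def)
      then show "u *\<^sub>R x + v *\<^sub>R y \<in> C j" unfolding C_def v mem_Collect_eq
        by (rule limsup_sqdist_le_mono) (use * v in simp)
    qed
    obtain \<rho> where "\<rho> \<in> S" "\<rho> < r + 1 / real (Suc j)"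
      using cInf_lessD[OF Sne, of "r + 1 / real (Suc j)"] by (auto simp: r_def)
    then show "C j \<noteq> {}" unfolding C_def S_def using limsup_sqdist_le_mono less_imp_le by blast
    show "bounded (C 0)"
    proof -
      have "norm h \<le> M + (r + 2 + 1)" if "h \<in> C 0" for h
      proof -
        have "eventually (\<lambda>n. (norm (w n - h))\<^sup>2 \<le> r + 1 + 1) sequentially"
          using that by (auto simp: C_def limsup_sqdist_le_def dest: spec[of _ 1])
        then obtain n where n: "(norm (w n - h))\<^sup>2 \<le> r + 2" by (auto simp: eventually_sequentially add.commute)
        have "norm (w n - h) \<le> (norm (w n - h))\<^sup>2 + 1"
          using zero_le_power2[of "norm (w n - h) - 1/2"] by (simp add: power2_eq_square algebra_simps)
        moreover have "norm h \<le> norm (w n) + norm (w n - h)" by norm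
        ultimately show ?thesis using n M[of n] by linarith
      qed
      then show ?thesis unfolding bounded_iff by blast
    qed
    show "decseq C"
      unfolding decseq_def
    proof (intro allI impI subsetI)
      fix m n x assume "m \<le> (n::nat)" and x: "x \<in> C n"
      then have "1 / real (Suc n) \<le> 1 / real (Suc m)" by (intro divide_left_mono) auto
      then show "x \<in> C m" using x unfolding C_def by (auto elim!: limsup_sqdist_le_mono)
    qed
  qed
  then obtain c where c: "\<And>j. limsup_sqdist_le w c (r + 1 / real (Suc j))" by (auto simp: C_def)
  have "limsup_sqdist_le w c r"
    unfolding limsup_sqdist_le_def
  proof (intro allI impI)
    fix e :: real assume "e > 0"
    then obtain j where "1 / real (Suc j) < e / 2" using nat_approx_posE[of "e/2"] by auto
    moreover have "eventually (\<lambda>n. (norm (w n - c))\<^sup>2 \<le> r + 1 / real (Suc j) + e / 2) sequentially"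
      using c[of j] \<open>e > 0\<close> by (simp add: limsup_sqdist_le_def)
    ultimately show "eventually (\<lambda>n. (norm (w n - c))\<^sup>2 \<le> r + e) sequentially"
      by (auto elim!: eventually_mono)
  qed
  moreover have "r \<le> \<rho>'" if "limsup_sqdist_le w h \<rho>'" for h \<rho>'
    unfolding r_def using that Sb by (intro cInf_lower) (auto simp: S_def)
  ultimately show thesis using that by blast
qed

lemma limsup_sqdist_le_limit:
  assumes "(\<lambda>n. (norm (w n - p))\<^sup>2) \<longlonglongrightarrow> l"
  shows "limsup_sqdist_le w p \<rho> \<longleftrightarrow> l \<le> \<rho>"
proof
  assume L: "limsup_sqdist_le w p \<rho>"
  show "l \<le> \<rho>"
  proof (rule field_le_epsilon)
    fix e :: real assume "e > 0"
    then show "l \<le> \<rho> + e" using L assms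
      by (intro tendsto_upperbound[OF assms]) (auto simp: limsup_sqdist_le_def)
  qed
next
  assume "l \<le> \<rho>"
  show "limsup_sqdist_le w p \<rho>"
    unfolding limsup_sqdist_le_def
  proof (intro allI impI)
    fix e :: real assume "e > 0"
    then have "eventually (\<lambda>n. (norm (w n - p))\<^sup>2 < \<rho> + e) sequentially"
      using \<open>l \<le> \<rho>\<close> by (intro order_tendstoD(2)[OF assms]) simp
    then show "eventually (\<lambda>n. (norm (w n - p))\<^sup>2 \<le> \<rho> + e) sequentially"
      by (rule eventually_mono) simp
  qed
qed

text \<open>Nonexpansiveness and the vanishing residual make \<open>T c\<close> as good a centre as
  \<open>c\<close>, and the centre is unique. This plays the part of demiclosedness, without any
  weak limit in sight.\<close>

lemma asymptotic_center_fixpoint: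
  fixes w :: "nat \<Rightarrow> 'a::real_inner"
  assumes M: "\<And>n. norm (w n) \<le> M" and T: "\<And>a b. norm (T a - T b) \<le> norm (a - b)"
    and Tw: "(\<lambda>n. T (w n) - w n) \<longlonglongrightarrow> 0"
    and c: "limsup_sqdist_le w c \<rho>" "\<And>h \<rho>'. limsup_sqdist_le w h \<rho>' \<Longrightarrow> \<rho> \<le> \<rho>'"
  shows "T c = c"
proof -
  define d where "d n = norm (T (w n) - w n)" for n
  have d: "d \<longlonglongrightarrow> 0" unfolding d_def using tendsto_norm[OF Tw] by simp
  have "(\<lambda>n. d n * (2 * (M + norm c) + d n)) \<longlonglongrightarrow> 0 * (2 * (M + norm c) + 0)"
    by (intro tendsto_intros d)
  then have "limsup_sqdist_le w (T c) (\<rho> + 0)"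
  proof (intro limsup_sqdist_le_perturb[OF c(1)])
    fix n
    have "norm (w n - T c) \<le> norm (T (w n) - T c) + d n" unfolding d_def by norm
    also have "\<dots> \<le> norm (w n - c) + d n" using T by simp
    finally have "(norm (w n - T c))\<^sup>2 \<le> (norm (w n - c) + d n)\<^sup>2" by (intro power_mono) auto
    also have "\<dots> = (norm (w n - c))\<^sup>2 + d n * (2 * norm (w n - c) + d n)"
      by (simp add: power2_eq_square algebra_simps)
    also have "d n * (2 * norm (w n - c) + d n) \<le> d n * (2 * (M + norm c) + d n)"
      using M[of n] norm_triangle_ineq4[of "w n" c] by (intro mult_left_mono) (auto simp: d_def)
    finally show "(norm (w n - T c))\<^sup>2 \<le> (norm (w n - c))\<^sup>2 + d n * (2 * (M + norm c) + d n) + 0" by simp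
  qed simp
  then have "limsup_sqdist_le w (T c) \<rho>" by simp
  then show ?thesis by (rule asymptotic_center_unique[OF c(1) _ c(2)])
qed

text \<open>The asymptotic centre of every subsequence is a fixed point, at which the distances converge,
  so all subsequences share the same centre; this forces weak convergence to it.\<close>

lemma weak_convergence_to_fixpoint:
  fixes w :: "nat \<Rightarrow> 'a::{real_inner, complete_space}"
  assumes M: "\<And>n. norm (w n) \<le> M" and T: "\<And>a b. norm (T a - T b) \<le> norm (a - b)"
    and Tw: "(\<lambda>n. T (w n) - w n) \<longlonglongrightarrow> 0"
    and conv: "\<And>p. T p = p \<Longrightarrow> convergent (\<lambda>n. (norm (w n - p))\<^sup>2)"
  obtains c where "T c = c" "weakly_tendsto w c"
proof -
  obtain c \<rho> where c: "limsup_sqdist_le w c \<rho>" "\<And>h \<rho>'. limsup_sqdist_le w h \<rho>' \<Longrightarrow> \<rho> \<le> \<rho>'"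
    using asymptotic_center_exists[of w] M by metis
  have Tc: "T c = c" by (rule asymptotic_center_fixpoint[OF M T Tw c])
  \<comment> \<open>No subsequence has a smaller asymptotic radius: its centre \<open>c'\<close> is
    a fixed point, so the distances of the whole sequence to \<open>c'\<close> converge to some
    \<open>l\<close>, and minimality for the whole sequence puts \<open>\<rho>\<close> below
    \<open>l\<close>, which is at most \<open>\<rho>0\<close>.\<close>
  have sub: "\<rho> \<le> \<rho>'" if \<sigma>: "strict_mono \<sigma>" and h: "limsup_sqdist_le (\<lambda>n. w (\<sigma> n)) h \<rho>'" for \<sigma> :: "nat \<Rightarrow> nat" and h \<rho>'
  proof -
    obtain c' \<rho>0 where c': "limsup_sqdist_le (\<lambda>n. w (\<sigma> n)) c' \<rho>0"
      "\<And>h \<rho>'. limsup_sqdist_le (\<lambda>n. w (\<sigma> n)) h \<rho>' \<Longrightarrow> \<rho>0 \<le> \<rho>'"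
      using asymptotic_center_exists[of "\<lambda>n. w (\<sigma> n)"] M by metis
    have "(\<lambda>n. T (w (\<sigma> n)) - w (\<sigma> n)) \<longlonglongrightarrow> 0"
      using LIMSEQ_subseq_LIMSEQ[OF Tw \<sigma>] by (simp add: o_def)
    then have "T c' = c'" by (rule asymptotic_center_fixpoint[OF M T _ c'])
    then obtain l where l: "(\<lambda>n. (norm (w n - c'))\<^sup>2) \<longlonglongrightarrow> l" using conv by (auto simp: convergent_def)
    then have "(\<lambda>n. (norm (w (\<sigma> n) - c'))\<^sup>2) \<longlonglongrightarrow> l"
      using LIMSEQ_subseq_LIMSEQ[OF l \<sigma>] by (simp add: o_def)
    then have "l \<le> \<rho>0" using c'(1) limsup_sqdist_le_limit[of "\<lambda>n. w (\<sigma> n)" c' l] by simp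
    moreover have "\<rho> \<le> l" using c(2) limsup_sqdist_le_limit[OF l] by blast
    ultimately show ?thesis using c'(2)[OF h] by linarith
  qed
  have half: "eventually (\<lambda>n. (w n - c) \<bullet> h < e) sequentially" if "e > 0" for h e
  proof (rule ccontr)
    assume "\<not> ?thesis"
    then have "\<exists>\<^sub>F n in sequentially. e \<le> (w n - c) \<bullet> h" by (simp add: frequently_def not_le)
    then have "infinite {n. e \<le> (w n - c) \<bullet> h}" by (simp add: frequently_cofinite flip: cofinite_eq_sequentially)
    then obtain \<sigma> :: "nat \<Rightarrow> nat" where \<sigma>: "strict_mono \<sigma>" "\<And>n. e \<le> (w (\<sigma> n) - c) \<bullet> h"
      using infinite_enumerate[of "{n. e \<le> (w n - c) \<bullet> h}"] by blast
    \<comment> \<open>Moving the centre by \<open>t h\<close> changes the limsup by at most minus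
      \<open>2 t e\<close> plus the square of \<open>t * norm h\<close>. With this \<open>t\<close>
      the second term is at most \<open>t e\<close>, so the subsequence would have a strictly
      smaller radius.\<close>
    define t where "t = e / ((norm h)\<^sup>2 + 1)"
    have pos: "(norm h)\<^sup>2 + 1 > 0" by (simp add: add_nonneg_pos)
    have t: "t > 0" using \<open>e > 0\<close> pos by (simp add: t_def)
    have "t * (norm h)\<^sup>2 \<le> t * ((norm h)\<^sup>2 + 1)" using t by (intro mult_left_mono) auto
    then have te: "t * (norm h)\<^sup>2 \<le> e" using pos by (simp add: t_def)
    have "limsup_sqdist_le (\<lambda>n. w (\<sigma> n)) c \<rho>"
      unfolding limsup_sqdist_le_def
    proof (intro allI impI)
      fix e :: real assume "e > 0"
      then have "eventually (\<lambda>n. (norm (w n - c))\<^sup>2 \<le> \<rho> + e) sequentially"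
        using c(1) by (simp add: limsup_sqdist_le_def)
      then show "eventually (\<lambda>n. (norm (w (\<sigma> n) - c))\<^sup>2 \<le> \<rho> + e) sequentially"
        by (rule eventually_subseq[OF \<sigma>(1)])
    qed
    then have "limsup_sqdist_le (\<lambda>n. w (\<sigma> n)) (c + t *\<^sub>R h) (\<rho> + (- 2 * t * e + t\<^sup>2 * (norm h)\<^sup>2))"
    proof (rule limsup_sqdist_le_perturb[OF _ tendsto_const])
      fix n
      have "(norm (w (\<sigma> n) - (c + t *\<^sub>R h)))\<^sup>2 = (norm (w (\<sigma> n) - c))\<^sup>2 - 2 * t * ((w (\<sigma> n) - c) \<bullet> h) + t\<^sup>2 * (norm h)\<^sup>2"
        unfolding power2_norm_eq_inner power2_eq_square[of t] by (simp add: inner_simps inner_commute algebra_simps)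
      moreover have "2 * t * e \<le> 2 * t * ((w (\<sigma> n) - c) \<bullet> h)" using \<sigma>(2)[of n] t by (intro mult_left_mono) auto
      ultimately show "(norm (w (\<sigma> n) - (c + t *\<^sub>R h)))\<^sup>2 \<le> (norm (w (\<sigma> n) - c))\<^sup>2 + 0 + (- 2 * t * e + t\<^sup>2 * (norm h)\<^sup>2)"
        by linarith
    qed
    from sub[OF \<sigma>(1) this] have "2 * t * e \<le> t * (t * (norm h)\<^sup>2)" by (simp add: power2_eq_square mult.assoc)
    also have "\<dots> \<le> t * e" using te t by (intro mult_left_mono) auto
    finally show False using t \<open>e > 0\<close> by simp
  qed
  have "(\<lambda>n. w n \<bullet> h) \<longlonglongrightarrow> c \<bullet> h" for h
  proof (rule tendstoI)
    fix e :: real assume "e > 0"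
    from half[OF this, of h] half[OF this, of "- h"]
    show "eventually (\<lambda>n. dist (w n \<bullet> h) (c \<bullet> h) < e) sequentially"
      by eventually_elim (auto simp: dist_real_def inner_simps)
  qed
  then have "weakly_tendsto w c" by (simp add: weakly_tendsto_def)
  with Tc show thesis using that by blast
qed

text \<open>\<open>X 0\<close> and \<open>X 1\<close> are free starting points, and
  \<open>s n\<close> extrapolates from \<open>X (Suc n)\<close>; with this shift every hypothesis
  holds from index \<open>0\<close>. The quantity converging by monotonicity is not the distance to
  a fixed point but a Lyapunov function, from which the distance is recovered.\<close>

lemma inertial_KM_weak_convergence:
  fixes X s :: "nat \<Rightarrow> 'a::{real_inner, complete_space}"
  assumes R: "\<And>a b. norm (R a - R b) \<le> norm (a - b)" and p0: "R p0 = p0"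
    and s: "\<And>n. s n = X (Suc n) + a n *\<^sub>R (X (Suc n) - X n)"
    and X: "\<And>n. X (Suc (Suc n)) = s n + \<mu> n *\<^sub>R (R (s n) - s n)"
    and a: "\<And>n. 0 \<le> a n" "\<And>n. a n \<le> \<alpha>" "incseq a" "\<alpha> < 1"
    and pos: "0 < \<mu>0" "0 < \<sigma>" "0 < \<delta>"
    and \<mu>: "\<And>n. \<mu>0 \<le> \<mu> n" "\<And>n. \<mu> n \<le> (\<delta> - \<alpha> * (\<alpha> * (1 + \<alpha>) + \<alpha> * \<delta> + \<sigma>)) / (\<delta> * (1 + \<alpha> * (1 + \<alpha>) + \<alpha> * \<delta> + \<sigma>))"
  obtains c where "R c = c" "weakly_tendsto X c" "(\<lambda>n. X (Suc n) - X n) \<longlonglongrightarrow> 0" "(\<lambda>n. R (s n) - s n) \<longlonglongrightarrow> 0"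
proof -
  define G where "G = \<alpha> * (1 + \<alpha>) + \<alpha> * \<delta>"
  define D where "D n = X (Suc n) - X n" for n
  have \<alpha>0: "0 \<le> \<alpha>" using a(1,2) order_trans by blast
  have G0: "G \<ge> 0" using \<alpha>0 pos by (simp add: G_def)
  have \<mu>0: "0 < \<mu> n" for n using \<mu>(1)[of n] pos by linarith
  \<comment> \<open>The upper bound on \<open>\<mu>\<close> cleared of denominators, in the form
    that balances the new increment in the descent estimate.\<close>
  have \<mu>bound: "(G + \<sigma>) * (\<alpha> + \<delta> * \<mu> n) \<le> (1 - \<mu> n) * \<delta>" for n
  proof -
    have "\<delta> * (1 + (G + \<sigma>)) > 0" using G0 pos by (intro mult_pos_pos) auto
    moreover have "\<mu> n \<le> (\<delta> - \<alpha> * (G + \<sigma>)) / (\<delta> * (1 + (G + \<sigma>)))"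
      using \<mu>(2)[of n] by (simp add: G_def add.assoc)
    ultimately have "\<mu> n * (\<delta> * (1 + (G + \<sigma>))) \<le> \<delta> - \<alpha> * (G + \<sigma>)"
      by (simp add: pos_le_divide_eq)
    then show ?thesis by (simp add: algebra_simps)
  qed
  have \<mu>1: "0 \<le> (1 - \<mu> n) * \<delta>" for n
  proof -
    have "0 \<le> (G + \<sigma>) * (\<alpha> + \<delta> * \<mu> n)" using G0 pos \<alpha>0 \<mu>0[of n] by (intro mult_nonneg_nonneg) auto
    then show ?thesis using \<mu>bound[of n] by linarith
  qed
  have ER: "D (Suc n) - a n *\<^sub>R D n = \<mu> n *\<^sub>R (R (s n) - s n)" for n
    by (simp add: D_def X s)
  define \<phi> where "\<phi> p n = (norm (X n - p))\<^sup>2" for p n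
  define m where "m p n = \<phi> p (Suc n) - a n * \<phi> p n + G * (norm (D n))\<^sup>2" for p n
  \<comment> \<open>The coefficient \<open>G\<close> of \<open>\<parallel>D n\<parallel>\<^sup>2\<close> absorbs the inertial error, and the upper bound on \<open>\<mu>\<close> is exactly
    what leaves a decrease of \<open>\<sigma> \<parallel>D (Suc n)\<parallel>\<^sup>2\<close>.\<close>
  have descent: "m p (Suc n) \<le> m p n - \<sigma> * (norm (D (Suc n)))\<^sup>2" if p: "R p = p" for p n
  proof -
    define A where "A = norm (R (s n) - s n)"
    define E2 where "E2 = (norm (D (Suc n)))\<^sup>2"
    define D2 where "D2 = (norm (D n))\<^sup>2"
    have \<mu>le1: "\<mu> n \<le> 1" using \<mu>1[of n] pos by (simp add: zero_le_mult_iff)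
    have 1: "\<phi> p (Suc (Suc n)) \<le> (norm (s n - p))\<^sup>2 - \<mu> n * (1 - \<mu> n) * A\<^sup>2"
    proof -
      have eq: "X (Suc (Suc n)) - p = \<mu> n *\<^sub>R (R (s n) - p) + (1 - \<mu> n) *\<^sub>R (s n - p)"
        by (simp add: X algebra_simps)
      have "norm (R (s n) - p) \<le> norm (s n - p)" using R[of "s n" p] p by simp
      then have "(norm (R (s n) - p))\<^sup>2 \<le> (norm (s n - p))\<^sup>2" by (intro power_mono) auto
      then have "\<mu> n * (norm (R (s n) - p))\<^sup>2 \<le> \<mu> n * (norm (s n - p))\<^sup>2"
        using \<mu>0[of n] by (intro mult_left_mono) auto
      then show ?thesis unfolding \<phi>_def eq norm_convex_comb_sq by (simp add: A_def algebra_simps)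
    qed
    \<comment> \<open>Extrapolation is an affine combination with weight \<open>1 + a n\<close>; the
      convexity identity for squared norms holds for every real weight, so the last term here enters
      with a plus sign.\<close>
    have 2: "(norm (s n - p))\<^sup>2 = (1 + a n) * \<phi> p (Suc n) - a n * \<phi> p n + a n * (1 + a n) * D2"
    proof -
      define u v where "u = X (Suc n) - p" and "v = X n - p"
      have eq: "s n - p = (1 + a n) *\<^sub>R u + (1 - (1 + a n)) *\<^sub>R v" "D n = u - v"
        by (simp_all add: s u_def v_def D_def algebra_simps)
      show ?thesis unfolding eq(1) norm_convex_comb_sq by (simp add: \<phi>_def D2_def eq(2) u_def v_def algebra_simps)
    qed
    \<comment> \<open>\<open>q\<close> is the weight in Young's inequality for the cross term of
      \<open>D (Suc n)\<close> and \<open>D n\<close>. Since \<open>q - a n\<close> equals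
      \<open>\<delta> * \<mu> n\<close>, both remaining coefficients share this factor, and one
      \<open>\<mu> n\<close> cancels.\<close>
    define q where "q = a n + \<delta> * \<mu> n"
    have q: "q > 0" using a(1)[of n] pos \<mu>0[of n] by (simp add: q_def add_nonneg_pos)
    have 3: "\<mu> n * (1 - \<mu> n) * A\<^sup>2 \<ge> (1 - \<mu> n) * \<delta> * (E2 / q - a n * D2)"
    proof -
      have "(\<mu> n)\<^sup>2 * A\<^sup>2 = (norm (D (Suc n) - a n *\<^sub>R D n))\<^sup>2"
        unfolding ER A_def by (simp add: power_mult_distrib)
      also have "\<dots> = E2 - 2 * a n * (D (Suc n) \<bullet> D n) + (a n)\<^sup>2 * D2"
        unfolding E2_def D2_def power2_norm_eq_inner power2_eq_square[of "a n"]
        by (simp add: inner_simps inner_commute algebra_simps)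
      finally have eq: "(\<mu> n)\<^sup>2 * A\<^sup>2 = E2 - 2 * a n * (D (Suc n) \<bullet> D n) + (a n)\<^sup>2 * D2" .
      have "0 \<le> (norm ((1 / q) *\<^sub>R D (Suc n) - D n))\<^sup>2 * q" using q by simp
      also have "\<dots> = E2 / q - 2 * (D (Suc n) \<bullet> D n) + q * D2"
        unfolding E2_def D2_def power2_norm_eq_inner using q
        by (simp add: inner_simps inner_commute field_simps)
      finally have "a n * (2 * (D (Suc n) \<bullet> D n)) \<le> a n * (E2 / q + q * D2)"
        using a(1) by (intro mult_left_mono) auto
      then have "(\<mu> n)\<^sup>2 * A\<^sup>2 \<ge> E2 - a n * (E2 / q + q * D2) + (a n)\<^sup>2 * D2"
        using eq by (simp add: mult.commute mult.left_commute)
      also have "E2 - a n * (E2 / q + q * D2) + (a n)\<^sup>2 * D2 = \<delta> * \<mu> n * (E2 / q - a n * D2)"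
      proof -
        have "E2 = q * (E2 / q)" using q by simp
        then show ?thesis unfolding q_def[symmetric]
          by (smt (verit, ccfv_threshold) q_def left_diff_distrib' power2_eq_square right_diff_distrib distrib_left distrib_right mult.assoc mult.commute)
      qed
      finally have "\<mu> n * (\<delta> * (E2 / q - a n * D2)) \<le> \<mu> n * (\<mu> n * A\<^sup>2)"
        by (simp add: power2_eq_square mult.assoc mult.left_commute)
      then have "\<delta> * (E2 / q - a n * D2) \<le> \<mu> n * A\<^sup>2" using \<mu>0[of n] by simp
      then have "(1 - \<mu> n) * (\<delta> * (E2 / q - a n * D2)) \<le> (1 - \<mu> n) * (\<mu> n * A\<^sup>2)"
        using \<mu>le1 by (intro mult_left_mono) auto
      then show ?thesis by (simp add: mult.assoc mult.left_commute)
    qed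
    have 4: "(G + \<sigma>) * E2 \<le> (1 - \<mu> n) * \<delta> * (E2 / q)"
    proof -
      have "(G + \<sigma>) * q \<le> (G + \<sigma>) * (\<alpha> + \<delta> * \<mu> n)"
        unfolding q_def using a(2) G0 pos by (intro mult_left_mono) auto
      then have "(G + \<sigma>) * q \<le> (1 - \<mu> n) * \<delta>" using \<mu>bound[of n] by linarith
      then have "(G + \<sigma>) * q * (E2 / q) \<le> (1 - \<mu> n) * \<delta> * (E2 / q)"
        using q by (intro mult_right_mono) (auto simp: E2_def)
      then show ?thesis using q by simp
    qed
    have 5: "(a n * (1 + a n) + (1 - \<mu> n) * \<delta> * a n) * D2 \<le> G * D2"
    proof -
      have "a n * (1 + a n) \<le> \<alpha> * (1 + \<alpha>)" using a(1,2)[of n] \<alpha>0 by (intro mult_mono) auto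
      moreover have "(1 - \<mu> n) * \<delta> * a n \<le> \<delta> * \<alpha>"
        using a(1,2)[of n] \<mu>0[of n] \<mu>1[of n] pos by (intro mult_mono) auto
      ultimately show ?thesis unfolding G_def by (intro mult_right_mono) (auto simp: D2_def mult.commute)
    qed
    have 6: "a n * \<phi> p (Suc n) \<le> a (Suc n) * \<phi> p (Suc n)"
      using incseq_SucD[OF a(3)] by (intro mult_right_mono) (auto simp: \<phi>_def)
    have "m p (Suc n) = \<phi> p (Suc (Suc n)) - a (Suc n) * \<phi> p (Suc n) + G * E2"
      "m p n = \<phi> p (Suc n) - a n * \<phi> p n + G * D2" by (simp_all add: m_def E2_def D2_def)
    then show ?thesis using 1 2 3 4 5 6 unfolding E2_def[symmetric] by (simp add: algebra_simps)
  qed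
  have mdec: "decseq (m p)" if "R p = p" for p
  proof (rule decseq_SucI)
    fix n
    have "0 \<le> \<sigma> * (norm (D (Suc n)))\<^sup>2" using pos by simp
    then show "m p (Suc n) \<le> m p n" using descent[OF that, of n] by linarith
  qed
  have \<phi>bdd: "\<exists>B. \<forall>n. \<phi> p n \<le> B" if p: "R p = p" for p
  proof -
    \<comment> \<open>Monotonicity of \<open>m p\<close> gives that \<open>\<phi> p (Suc n)\<close>
      is at most \<open>\<alpha> * B\<close> plus the absolute value of \<open>m p 0\<close>; the
      geometric factor \<open>1 / (1 - \<alpha>)\<close> makes \<open>B\<close> stable under this
      recursion.\<close>
    define B where "B = \<phi> p 0 + \<bar>m p 0\<bar> / (1 - \<alpha>)"
    have "\<phi> p n \<le> B" for n
    proof (induction n)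
      case 0
      then show ?case using a(4) by (simp add: B_def)
    next
      case (Suc n)
      have "m p n \<le> \<bar>m p 0\<bar>" using decseqD[OF mdec[OF p], of 0 n] by simp
      moreover have "a n * \<phi> p n \<le> \<alpha> * B"
        using a(1,2) \<alpha>0 Suc by (intro mult_mono) (auto simp: \<phi>_def)
      moreover have "0 \<le> G * (norm (D n))\<^sup>2" using G0 by simp
      ultimately have "\<phi> p (Suc n) \<le> \<alpha> * B + \<bar>m p 0\<bar>" unfolding m_def by linarith
      also have "\<dots> = \<alpha> * \<phi> p 0 + \<bar>m p 0\<bar> / (1 - \<alpha>)" using a(4) by (simp add: B_def field_simps)
      also have "\<dots> \<le> B" unfolding B_def using a(4) by (simp add: \<phi>_def mult_left_le_one_le \<alpha>0)
      finally show ?case .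
    qed
    then show ?thesis by blast
  qed
  have mconv: "convergent (m p)" if p: "R p = p" for p
  proof -
    obtain B where B: "\<And>n. \<phi> p n \<le> B" using \<phi>bdd[OF p] by blast
    \<comment> \<open>\<open>m p\<close> may be negative because of its middle term, so the bound on
      \<open>\<phi> p\<close> must precede its convergence.\<close>
    have "- (\<alpha> * B) \<le> m p n" for n
    proof -
      have "a n * \<phi> p n \<le> \<alpha> * B"
        using a(1,2) \<alpha>0 B by (intro mult_mono) (auto simp: \<phi>_def)
      moreover have "0 \<le> G * (norm (D n))\<^sup>2" using G0 by simp
      moreover have "0 \<le> \<phi> p (Suc n)" by (simp add: \<phi>_def)
      ultimately show ?thesis unfolding m_def by linarith
    qed
    then show ?thesis using decseq_convergent[OF mdec[OF p], of "- (\<alpha> * B)"] unfolding convergent_def by metis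
  qed
  have D0: "D \<longlonglongrightarrow> 0"
  proof -
    obtain l where l: "m p0 \<longlonglongrightarrow> l" using mconv[OF p0] by (auto simp: convergent_def)
    have lim: "(\<lambda>n. (m p0 n - m p0 (Suc n)) / \<sigma>) \<longlonglongrightarrow> (l - l) / \<sigma>"
      using pos by (intro tendsto_intros l LIMSEQ_Suc) auto
    have "(\<lambda>n. (norm (D (Suc n)))\<^sup>2) \<longlonglongrightarrow> 0"
    proof (rule tendsto_sandwich[OF _ _ tendsto_const])
      show "(\<lambda>n. (m p0 n - m p0 (Suc n)) / \<sigma>) \<longlonglongrightarrow> 0" using lim by simp
      show "eventually (\<lambda>n. (norm (D (Suc n)))\<^sup>2 \<le> (m p0 n - m p0 (Suc n)) / \<sigma>) sequentially"
        using descent[OF p0] pos by (auto simp: pos_le_divide_eq algebra_simps intro!: always_eventually)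
    qed auto
    then have "(\<lambda>n. sqrt ((norm (D (Suc n)))\<^sup>2)) \<longlonglongrightarrow> sqrt 0" by (intro tendsto_intros)
    then have "(\<lambda>n. D (Suc n)) \<longlonglongrightarrow> 0" by (simp add: tendsto_norm_zero_iff)
    then show ?thesis by (simp add: filterlim_sequentially_Suc)
  qed
  have nD0: "(\<lambda>n. norm (D n)) \<longlonglongrightarrow> 0" using tendsto_norm[OF D0] by simp
  have Rs: "(\<lambda>n. R (s n) - s n) \<longlonglongrightarrow> 0"
  proof (rule tendsto_norm_zero_cancel, rule tendsto_sandwich[OF _ _ tendsto_const])
    show "(\<lambda>n. (norm (D (Suc n)) + norm (D n)) / \<mu>0) \<longlonglongrightarrow> 0"
      using tendsto_divide[OF tendsto_add[OF LIMSEQ_Suc[OF nD0] nD0] tendsto_const[of \<mu>0]] pos by simp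
    have "norm (R (s n) - s n) \<le> (norm (D (Suc n)) + norm (D n)) / \<mu>0" for n
    proof -
      have "\<mu>0 * norm (R (s n) - s n) \<le> \<mu> n * norm (R (s n) - s n)" using \<mu>(1) by (intro mult_right_mono) auto
      also have "\<dots> = norm (D (Suc n) - a n *\<^sub>R D n)" unfolding ER using \<mu>0[of n] by simp
      also have "\<dots> \<le> norm (D (Suc n)) + a n * norm (D n)"
        using norm_triangle_ineq4[of "D (Suc n)" "a n *\<^sub>R D n"] a(1)[of n] by simp
      also have "a n * norm (D n) \<le> 1 * norm (D n)" using a(2)[of n] a(4) by (intro mult_right_mono) auto
      finally show ?thesis using pos by (simp add: pos_le_divide_eq mult.commute)
    qed
    then show "eventually (\<lambda>n. norm (R (s n) - s n) \<le> (norm (D (Suc n)) + norm (D n)) / \<mu>0) sequentially" by simp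
  qed auto
  have \<phi>conv: "convergent (\<phi> p)" if p: "R p = p" for p
  proof -
    obtain l where l: "m p \<longlonglongrightarrow> l" using mconv[OF p] by (auto simp: convergent_def)
    obtain a' where a': "a \<longlonglongrightarrow> a'" using incseq_convergent[OF a(3), of \<alpha>] a(2) by metis
    have "a' \<le> \<alpha>" using LIMSEQ_le_const2[OF a'] a(2) by blast
    obtain B where B: "\<And>n. \<phi> p n \<le> B" using \<phi>bdd[OF p] by blast
    have nB: "norm (X n - p) \<le> B + 1" for n
      using B[of n] zero_le_power2[of "norm (X n - p) - 1/2"] by (simp add: \<phi>_def power2_eq_square algebra_simps)
    have diff: "(\<lambda>n. \<phi> p (Suc n) - \<phi> p n) \<longlonglongrightarrow> 0"
    proof (rule Lim_null_comparison)
      show "(\<lambda>n. norm (D n) * (2 * (B + 1))) \<longlonglongrightarrow> 0" using tendsto_mult_left_zero[OF nD0] .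
      have "norm (\<phi> p (Suc n) - \<phi> p n) \<le> norm (D n) * (2 * (B + 1))" for n
      proof -
        have "\<phi> p (Suc n) - \<phi> p n = (norm (X (Suc n) - p) - norm (X n - p)) * (norm (X (Suc n) - p) + norm (X n - p))"
          by (simp add: \<phi>_def power2_eq_square algebra_simps)
        moreover have "\<bar>norm (X (Suc n) - p) - norm (X n - p)\<bar> \<le> norm (D n)"
          using norm_triangle_ineq3[of "X (Suc n) - p" "X n - p"] by (simp add: D_def)
        ultimately show ?thesis using nB[of n] nB[of "Suc n"]
          by (simp add: abs_mult) (intro mult_mono, auto)
      qed
      then show "eventually (\<lambda>n. norm (\<phi> p (Suc n) - \<phi> p n) \<le> norm (D n) * (2 * (B + 1))) sequentially" by simp
    qed
    \<comment> \<open>The definition of \<open>m\<close> solved for \<open>\<phi> p (Suc n)\<close>.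
      The division is safe in the limit because \<open>a\<close> increases to a limit at most
      \<open>\<alpha>\<close>, which is below \<open>1\<close>.\<close>
    have "(\<lambda>n. (m p n - a n * (\<phi> p (Suc n) - \<phi> p n) - G * (norm (D n))\<^sup>2) / (1 - a n)) \<longlonglongrightarrow> (l - a' * 0 - G * 0\<^sup>2) / (1 - a')"
      using \<open>a' \<le> \<alpha>\<close> a(4) by (intro tendsto_intros l a' diff nD0) auto
    moreover have "(m p n - a n * (\<phi> p (Suc n) - \<phi> p n) - G * (norm (D n))\<^sup>2) / (1 - a n) = \<phi> p (Suc n)" for n
      using a(2)[of n] a(4) by (simp add: m_def field_simps)
    ultimately have "(\<lambda>n. \<phi> p (Suc n)) \<longlonglongrightarrow> (l - a' * 0 - G * 0\<^sup>2) / (1 - a')" by simp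
    then show ?thesis unfolding filterlim_sequentially_Suc by (auto simp: convergent_def)
  qed
  obtain B where B: "\<And>n. \<phi> p0 n \<le> B" using \<phi>bdd[OF p0] by blast
  have XM: "norm (X n) \<le> B + 1 + norm p0" for n
    using B[of n] zero_le_power2[of "norm (X n - p0) - 1/2"] norm_triangle_ineq[of "X n - p0" p0]
    by (simp add: \<phi>_def power2_eq_square algebra_simps)
  have sX: "(\<lambda>n. norm (s n - X (Suc n))) \<longlonglongrightarrow> 0"
  proof (rule tendsto_sandwich[OF _ _ tendsto_const nD0])
    have "norm (s n - X (Suc n)) \<le> norm (D n)" for n
      using a(1,2)[of n] a(4) by (simp add: s D_def mult_left_le_one_le)
    then show "eventually (\<lambda>n. norm (s n - X (Suc n)) \<le> norm (D n)) sequentially" by simp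
  qed auto
  have "(\<lambda>n. R (X (Suc n)) - X (Suc n)) \<longlonglongrightarrow> 0"
  proof (rule Lim_null_comparison)
    have "norm (R (X (Suc n)) - X (Suc n)) \<le> 2 * norm (s n - X (Suc n)) + norm (R (s n) - s n)" for n
    proof -
      have "norm (R (X (Suc n)) - X (Suc n)) \<le> norm (R (s n) - R (X (Suc n))) + norm (R (s n) - s n) + norm (s n - X (Suc n))"
        by norm
      then show ?thesis using R[of "s n" "X (Suc n)"] by linarith
    qed
    then show "eventually (\<lambda>n. norm (R (X (Suc n)) - X (Suc n)) \<le> 2 * norm (s n - X (Suc n)) + norm (R (s n) - s n)) sequentially" by simp
    show "(\<lambda>n. 2 * norm (s n - X (Suc n)) + norm (R (s n) - s n)) \<longlonglongrightarrow> 0"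
      using tendsto_add[OF tendsto_mult[OF tendsto_const[of 2] sX] tendsto_norm[OF Rs]] by simp
  qed
  then have RX: "(\<lambda>n. R (X n) - X n) \<longlonglongrightarrow> 0"
    using filterlim_sequentially_Suc[of "\<lambda>n. R (X n) - X n"] by simp
  obtain c where "R c = c" "weakly_tendsto X c"
    using weak_convergence_to_fixpoint[OF XM R RX] \<phi>conv unfolding \<phi>_def by blast
  then show thesis using that D0 Rs unfolding D_def by blast
qed

section \<open>Separable sums on the product space\<close>

lemma sum_ereal_of_real:
  fixes h :: "'i \<Rightarrow> ereal"
  assumes "finite A" "\<And>i. i \<in> A \<Longrightarrow> h i \<noteq> -\<infinity>" "(\<Sum>i\<in>A. h i) \<noteq> \<infinity>" "i \<in> A"
  shows "h i = ereal (real_of_ereal (h i))"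
proof -
  have "h i \<noteq> \<infinity>" using assms sum_Pinfty[of h A] by auto
  then show ?thesis using assms(2)[OF assms(4)] by (cases "h i") auto
qed

definition separable_sum :: "('m::finite \<Rightarrow> 'a \<Rightarrow> ereal) \<Rightarrow> 'a ^ 'm \<Rightarrow> ereal" where
  "separable_sum f p = (\<Sum>i\<in>UNIV. f i (p $ i))"

lemma lsc_fun_add:
  fixes f g :: "'a::topological_space \<Rightarrow> ereal"
  assumes f: "lsc_fun f" "\<And>x. f x \<noteq> -\<infinity>" and g: "lsc_fun g" "\<And>x. g x \<noteq> -\<infinity>"
  shows "lsc_fun (\<lambda>x. f x + g x)"
  unfolding lsc_fun_def le_Liminf_iff
proof (intro allI impI)
  fix x a assume a: "a < f x + g x"
  \<comment> \<open>Real lower bounds for the two summands separately. When both values are finite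
    the slack is split evenly; when one is infinite, its bound is taken as large as the other
    summand requires.\<close>
  have "\<exists>b c. ereal b < f x \<and> ereal c < g x \<and> a \<le> ereal (b + c)"
  proof (cases "f x")
    case (real p)
    show ?thesis
    proof (cases "g x")
      case (real q)
      obtain d where d: "a < ereal d" "ereal d < ereal (p + q)"
        using a \<open>f x = ereal p\<close> real ereal_dense2[of a "ereal (p + q)"] by auto
      show ?thesis using d real \<open>f x = ereal p\<close>
        by (intro exI[of _ "p - (p + q - d) / 2"] exI[of _ "q - (p + q - d) / 2"]) (auto simp: field_simps)
    next
      case PInf
      have "a \<noteq> \<infinity>" using a by auto
      then obtain d where "a \<le> ereal d" by (cases a) auto
      then show ?thesis using real PInf
        by (intro exI[of _ "p - 1"] exI[of _ "d - (p - 1)"]) auto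
    qed (use g(2) in auto)
  next
    case PInf
    have "a \<noteq> \<infinity>" using a by auto
    then obtain d where d: "a \<le> ereal d" by (cases a) auto
    obtain c where "ereal c < g x" using g(2)[of x] by (cases "g x") (auto simp: intro: that lt_ex[THEN exE])
    then show ?thesis using d PInf
      by (intro exI[of _ "d - c"] exI[of _ c]) auto
  qed (use f(2) in auto)
  then obtain b c where bc: "ereal b < f x" "ereal c < g x" "a \<le> ereal (b + c)" by blast
  have "eventually (\<lambda>w. ereal b < f w) (nhds x)" "eventually (\<lambda>w. ereal c < g w) (nhds x)"
    using f(1) g(1) bc by (auto simp: lsc_fun_def le_Liminf_iff)
  then show "eventually (\<lambda>w. a < f w + g w) (nhds x)"
  proof eventually_elim
    case (elim w)
    have "ereal (b + c) < f w + g w" using elim by (cases "f w"; cases "g w") auto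
    then show ?case using bc(3) by (rule le_less_trans[rotated])
  qed
qed

lemma lsc_fun_compose:
  assumes "lsc_fun f" "continuous_on UNIV h"
  shows "lsc_fun (\<lambda>x. f (h x))"
  unfolding lsc_fun_def le_Liminf_iff
proof (intro allI impI)
  fix x a assume "a < f (h x)"
  then have "eventually (\<lambda>w. a < f w) (nhds (h x))" using assms(1) by (auto simp: lsc_fun_def le_Liminf_iff)
  moreover have "filterlim h (nhds (h x)) (nhds x)"
    using assms(2) by (auto simp: continuous_on_def tendsto_at_iff_tendsto_nhds)
  ultimately show "eventually (\<lambda>w. a < f (h w)) (nhds x)" by (auto simp: filterlim_iff)
qed

lemma lsc_fun_sum:
  fixes f :: "'i \<Rightarrow> 'a::topological_space \<Rightarrow> ereal"
  assumes "finite A" "\<And>i. lsc_fun (f i)" "\<And>i x. f i x \<noteq> -\<infinity>"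
  shows "lsc_fun (\<lambda>x. \<Sum>i\<in>A. f i x) \<and> (\<forall>x. (\<Sum>i\<in>A. f i x) \<noteq> -\<infinity>)"
  using assms(1)
proof (induction A rule: finite_induct)
  case empty
  show ?case by (simp add: lsc_fun_def le_Liminf_iff)
next
  case (insert j A)
  then show ?case using assms by (auto intro!: lsc_fun_add)
qed

lemma separable_sum_pcl:
  fixes f :: "'m::finite \<Rightarrow> 'a::real_inner \<Rightarrow> ereal"
  assumes f: "\<And>i. f i \<in> proper_convex_lsc"
  shows "separable_sum f \<in> proper_convex_lsc"
proof -
  have nm: "f i x \<noteq> -\<infinity>" for i x using pcl_not_minf[OF f] .
  have L: "lsc_fun (\<lambda>p::'a^'m. \<Sum>i\<in>UNIV. f i (p $ i)) \<and> (\<forall>p::'a^'m. (\<Sum>i\<in>UNIV. f i (p $ i)) \<noteq> -\<infinity>)"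
  proof (rule lsc_fun_sum)
    show "lsc_fun (\<lambda>p::'a^'m. f i (p $ i))" for i
      by (rule lsc_fun_compose[of "f i"]) (use f[of i] in \<open>auto simp: proper_convex_lsc_def intro!: continuous_intros\<close>)
  qed (use nm in auto)
  have "\<exists>x. f i x \<noteq> \<infinity>" for i using f[of i] by (auto simp: proper_convex_lsc_def proper_fun_def)
  then obtain q where q: "\<And>i. f i (q i) \<noteq> \<infinity>" by metis
  have "separable_sum f (\<chi> i. q i) \<noteq> \<infinity>" using q by (simp add: separable_sum_def sum_Pinfty)
  moreover have "convex_fun (separable_sum f)"
    unfolding convex_fun_def
  proof (intro allI ballI)
    fix x y :: "'a^'m" and t :: real assume t: "t \<in> {0<..<1}"
    show "separable_sum f (t *\<^sub>R x + (1 - t) *\<^sub>R y) \<le> ereal t * separable_sum f x + ereal (1 - t) * separable_sum f y"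
    proof (cases "separable_sum f x = \<infinity> \<or> separable_sum f y = \<infinity>")
      case True
      moreover have "separable_sum f x \<noteq> -\<infinity>" "separable_sum f y \<noteq> -\<infinity>"
        using L by (auto simp: separable_sum_def)
      ultimately show ?thesis
        using t by (cases "separable_sum f x"; cases "separable_sum f y") auto
    next
      case False
      define a b where "a i = real_of_ereal (f i (x $ i))" and "b i = real_of_ereal (f i (y $ i))" for i
      have ab: "f i (x $ i) = ereal (a i)" "f i (y $ i) = ereal (b i)" for i
        unfolding a_def b_def using False nm
        by (auto simp: separable_sum_def intro!: sum_ereal_of_real[of UNIV "\<lambda>i. f i (_ $ i)"])
      have "separable_sum f (t *\<^sub>R x + (1 - t) *\<^sub>R y) \<le> (\<Sum>i\<in>UNIV. ereal (t * a i + (1 - t) * b i))"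
        unfolding separable_sum_def using pcl_convexD[OF f] t ab by (intro sum_mono) auto
      also have "\<dots> = ereal t * separable_sum f x + ereal (1 - t) * separable_sum f y"
        by (simp add: separable_sum_def ab sum.distrib sum_distrib_left)
      finally show ?thesis .
    qed
  qed
  moreover have "lsc_fun (separable_sum f)" "separable_sum f p \<noteq> -\<infinity>" for p
    using L by (auto simp: separable_sum_def[abs_def])
  ultimately show ?thesis
    unfolding proper_convex_lsc_def proper_fun_def by blast
qed

lemma eff_dom_separable_sum:
  "p \<in> eff_dom (separable_sum f) \<longleftrightarrow> (\<forall>i. p $ i \<in> eff_dom (f i))"
  by (simp add: eff_dom_def separable_sum_def less_top[symmetric] top_ereal_def sum_Pinfty)

text \<open>Adding the componentwise inequalities gives one direction. For the other, only component
  \<open>i\<close> of \<open>p\<close> is varied; the remaining summands are finite at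
  \<open>p\<close> and cancel.\<close>

lemma separable_sum_subdifferential_iff:
  fixes f :: "'m::finite \<Rightarrow> 'a::real_inner \<Rightarrow> ereal"
  assumes f: "\<And>i. f i \<in> proper_convex_lsc"
  shows "v \<in> subdifferential (separable_sum f) p \<longleftrightarrow> (\<forall>i. v $ i \<in> subdifferential (f i) (p $ i))"
proof
  assume "\<forall>i. v $ i \<in> subdifferential (f i) (p $ i)"
  then have "\<forall>i. \<exists>c. f i (p $ i) = ereal c \<and> (\<forall>q. ereal (c + v $ i \<bullet> (q - p $ i)) \<le> f i q)"
    by (meson subdifferentialE)
  then obtain c where c: "\<And>i. f i (p $ i) = ereal (c i)"
    "\<And>i q. ereal (c i + v $ i \<bullet> (q - p $ i)) \<le> f i q" by metis
  show "v \<in> subdifferential (separable_sum f) p"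
  proof (rule subdifferentialI[OF separable_sum_pcl[OF f]])
    show "p \<in> eff_dom (separable_sum f)" unfolding eff_dom_separable_sum by (simp add: eff_dom_def c(1))
    fix q
    have "separable_sum f p + ereal (v \<bullet> (q - p)) = (\<Sum>i\<in>UNIV. ereal (c i + v $ i \<bullet> (q $ i - p $ i)))"
      by (simp add: separable_sum_def c(1) inner_vec_def sum.distrib)
    also have "\<dots> \<le> separable_sum f q"
      unfolding separable_sum_def by (intro sum_mono c(2))
    finally show "separable_sum f p + ereal (v \<bullet> (q - p)) \<le> separable_sum f q" .
  qed
next
  assume v: "v \<in> subdifferential (separable_sum f) p"
  then have fin: "separable_sum f p \<noteq> \<infinity>" by (auto simp: subdifferential_def split: if_splits)
  define c where "c i = real_of_ereal (f i (p $ i))" for i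
  have c: "f i (p $ i) = ereal (c i)" for i
    unfolding c_def using fin pcl_not_minf[OF f]
    by (auto simp: separable_sum_def intro!: sum_ereal_of_real[of UNIV "\<lambda>i. f i (p $ i)"])
  show "\<forall>i. v $ i \<in> subdifferential (f i) (p $ i)"
  proof
    fix i
    show "v $ i \<in> subdifferential (f i) (p $ i)"
    proof (rule subdifferentialI[OF f])
      show "p $ i \<in> eff_dom (f i)" by (simp add: eff_dom_def c)
      fix y
      define q where "q = (\<chi> j. if j = i then y else p $ j)"
      have "q - p = axis i (y - p $ i)" by (simp add: q_def vec_eq_iff axis_def)
      then have "v \<bullet> (q - p) = v $ i \<bullet> (y - p $ i)" by (simp add: inner_axis)
      moreover have "separable_sum f p = ereal (c i) + ereal (\<Sum>j\<in>UNIV - {i}. c j)"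
        unfolding separable_sum_def by (subst sum.remove[of UNIV i]) (simp_all add: c)
      moreover have "separable_sum f q = f i y + ereal (\<Sum>j\<in>UNIV - {i}. c j)"
      proof -
        have "(\<Sum>j\<in>UNIV - {i}. f j (q $ j)) = (\<Sum>j\<in>UNIV - {i}. ereal (c j))"
          by (intro sum.cong) (auto simp: q_def c)
        then show ?thesis unfolding separable_sum_def by (subst sum.remove[of UNIV i]) (simp_all add: q_def)
      qed
      moreover have "separable_sum f p + ereal (v \<bullet> (q - p)) \<le> separable_sum f q"
        using v by (auto simp: subdifferential_def split: if_splits)
      ultimately show "f i (p $ i) + ereal (v $ i \<bullet> (y - p $ i)) \<le> f i y"
        unfolding c by (cases "f i y") auto
    qed
  qed
qed

text \<open>Its range is the diagonal and its kernel the vectors with zero sum, so orthogonality to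
  the diagonal is dual feasibility.\<close>

definition mean_proj :: "'a::real_inner ^ 'm::finite \<Rightarrow> 'a ^ 'm" where
  "mean_proj p = (\<chi> i. (1 / real CARD('m)) *\<^sub>R (\<Sum>j\<in>UNIV. p $ j))"

lemma mean_proj_const [simp]: "mean_proj (\<chi> i. x) = (\<chi> i. x)"
  by (simp add: mean_proj_def vec_eq_iff sum_constant_scaleR)

lemma mean_proj_eq_self: "mean_proj p = p \<longleftrightarrow> p \<in> range (\<lambda>x. \<chi> i. x)"
proof
  assume "mean_proj p = p"
  then have "p = (\<chi> i. (1 / real CARD('b)) *\<^sub>R (\<Sum>j\<in>UNIV. p $ j))" by (simp add: mean_proj_def)
  then show "p \<in> range (\<lambda>x. \<chi> i. x)" by blast
qed auto

lemma mean_proj_eq_0: "mean_proj (p :: 'a::real_inner ^ 'm::finite) = 0 \<longleftrightarrow> (\<Sum>i\<in>UNIV. p $ i) = 0"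
  by (simp add: mean_proj_def vec_eq_iff)

lemma orthogonal_projector_mean_proj:
  "orthogonal_projector (mean_proj :: 'a::{real_inner, complete_space} ^ 'm::finite \<Rightarrow> _)"
proof (rule orthogonal_projector.intro)
  show "linear (mean_proj :: 'a ^ 'm \<Rightarrow> _)"
    by (rule linearI) (auto simp: mean_proj_def vec_eq_iff sum.distrib scaleR_right_distrib scaleR_sum_right scaleR_left_commute)
  fix a b :: "'a ^ 'm"
  show "mean_proj (mean_proj a) = mean_proj a"
    unfolding mean_proj_def[of a] by (rule mean_proj_const)
  show "mean_proj a \<bullet> b = a \<bullet> mean_proj b"
    by (simp add: mean_proj_def inner_vec_def flip: sum_divide_distrib inner_sum_left inner_sum_right)
qed

interpretation mean: orthogonal_projector "mean_proj :: 'a::{real_inner, complete_space} ^ 'm::finite \<Rightarrow> _"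
  by (rule orthogonal_projector_mean_proj)

section \<open>Duality\<close>

lemma conjugate_ge: "ereal (u \<bullet> x) - f x \<le> conjugate f u"
  unfolding conjugate_def by (rule SUP_upper) simp

lemma conjugate_subgradient:
  assumes "v \<in> subdifferential f x" "f x = ereal c"
  shows "conjugate f v = ereal (v \<bullet> x - c)"
proof (rule antisym)
  show "conjugate f v \<le> ereal (v \<bullet> x - c)"
    unfolding conjugate_def
  proof (rule SUP_least)
    fix y
    have "ereal (c + v \<bullet> (y - x)) \<le> f y" using assms by (auto simp: subdifferential_def)
    then show "ereal (v \<bullet> y) - f y \<le> ereal (v \<bullet> x - c)"
      by (cases "f y") (auto simp: inner_simps)
  qed
  show "ereal (v \<bullet> x - c) \<le> conjugate f v"
    using conjugate_ge[of v x f] assms(2) by simp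
qed

text \<open>Strong convexity at the midpoint \<open>h\<close> of \<open>v\<close> and
  \<open>w\<close>, with the Fenchel-Young equality at \<open>v\<close> and \<open>w\<close> and the
  inequality at \<open>h\<close> tested with both \<open>p\<close> and \<open>q\<close>. Using the
  midpoint alone halves the modulus, which is harmless for convergence.\<close>

lemma strongly_convex_conjugate_strongly_monotone:
  assumes sc: "strongly_convex (conjugate f)"
  obtains \<beta> where "\<beta> > 0"
    "\<And>v w p q. v \<in> subdifferential f p \<Longrightarrow> w \<in> subdifferential f q \<Longrightarrow> \<beta> * (norm (v - w))\<^sup>2 \<le> (p - q) \<bullet> (v - w)"
proof -
  obtain \<beta> where \<beta>: "\<beta> > 0" and ineq: "\<And>x y t. x \<in> eff_dom (conjugate f) \<Longrightarrow> y \<in> eff_dom (conjugate f) \<Longrightarrow> t \<in> {0<..<1} \<Longrightarrow>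
        conjugate f (t *\<^sub>R x + (1 - t) *\<^sub>R y) + ereal (t * (1 - t) * (\<beta> / 2) * (norm (x - y))\<^sup>2)
          \<le> ereal t * conjugate f x + ereal (1 - t) * conjugate f y"
    using sc unfolding strongly_convex_def by blast
  have "\<beta> / 2 * (norm (v - w))\<^sup>2 \<le> (p - q) \<bullet> (v - w)"
    if v: "v \<in> subdifferential f p" and w: "w \<in> subdifferential f q" for v w p q
  proof -
    obtain c where c: "f p = ereal c" using subdifferentialE[OF v] by metis
    obtain d where d: "f q = ereal d" using subdifferentialE[OF w] by metis
    define h where "h = (1/2) *\<^sub>R v + (1 - 1/2) *\<^sub>R w"
    have cv: "conjugate f v = ereal (v \<bullet> p - c)" "conjugate f w = ereal (w \<bullet> q - d)"
      using conjugate_subgradient v w c d by auto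
    then have "v \<in> eff_dom (conjugate f)" "w \<in> eff_dom (conjugate f)" by (auto simp: eff_dom_def)
    from ineq[OF this, of "1/2"] have
      *: "conjugate f h + ereal (\<beta> / 8 * (norm (v - w))\<^sup>2) \<le> ereal ((1/2) * (v \<bullet> p - c) + (1/2) * (w \<bullet> q - d))"
      by (simp add: cv h_def field_simps)
    have "ereal (h \<bullet> p - c) \<le> conjugate f h" "ereal (h \<bullet> q - d) \<le> conjugate f h"
      using conjugate_ge[of h p f] conjugate_ge[of h q f] c d by auto
    with * obtain e where e: "h \<bullet> p - c \<le> e" "h \<bullet> q - d \<le> e"
      "e + \<beta> / 8 * (norm (v - w))\<^sup>2 \<le> (1/2) * (v \<bullet> p - c) + (1/2) * (w \<bullet> q - d)"
      by (cases "conjugate f h") auto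
    have "2 * (h \<bullet> p) = v \<bullet> p + w \<bullet> p" "2 * (h \<bullet> q) = v \<bullet> q + w \<bullet> q"
      by (simp_all add: h_def inner_simps)
    moreover have "(p - q) \<bullet> (v - w) = v \<bullet> p - w \<bullet> p - v \<bullet> q + w \<bullet> q"
      by (simp add: inner_simps inner_commute)
    ultimately show ?thesis using e by (simp add: field_simps)
  qed
  then show thesis using that[of "\<beta> / 2"] \<beta> by simp
qed

text \<open>The multipliers sum to zero, so all linear terms vanish when the subgradient
  inequalities are added. The last conclusion, that every dual solution consists of subgradients at
  the same \<open>x\<close>, supplies the uniqueness of the dual solution under strong
  convexity.\<close>

lemma fenchel_duality:
  fixes f :: "'m::finite \<Rightarrow> 'a::real_inner \<Rightarrow> ereal"
  assumes v: "\<And>i. v $ i \<in> subdifferential (f i) x" "(\<Sum>i\<in>UNIV. v $ i) = 0"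
  shows "primal_opt f x" "dual_opt f v" "primal_val f = dual_val f"
    and "dual_opt f w \<Longrightarrow> w $ i \<in> subdifferential (f i) x"
proof -
  have "\<forall>i. \<exists>c. f i x = ereal c \<and> (\<forall>q. ereal (c + v $ i \<bullet> (q - x)) \<le> f i q)"
    by (meson subdifferentialE v(1))
  then obtain G where G: "\<And>i. f i x = ereal (G i)" "\<And>i q. ereal (G i + v $ i \<bullet> (q - x)) \<le> f i q"
    by metis
  have sum_inner: "(\<Sum>i\<in>UNIV. w $ i \<bullet> y) = 0" if "(\<Sum>i\<in>UNIV. w $ i) = 0" for w :: "'a^'m" and y
    using that by (simp flip: inner_sum_left)
  have px: "primal_obj f x = ereal (sum G UNIV)" by (simp add: primal_obj_def G(1))
  have dv: "dual_obj f v = ereal (sum G UNIV)"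
    by (simp add: dual_obj_def conjugate_subgradient[OF v(1) G(1)] sum_subtractf sum_inner[OF v(2)])
  have weak1: "ereal (sum G UNIV) \<le> primal_obj f y" for y
  proof -
    have "ereal (sum G UNIV) = (\<Sum>i\<in>UNIV. ereal (G i + v $ i \<bullet> (y - x)))"
      by (simp add: sum.distrib sum_inner[OF v(2)])
    also have "\<dots> \<le> primal_obj f y" unfolding primal_obj_def by (intro sum_mono G)
    finally show ?thesis .
  qed
  have conj_ge: "ereal (w $ i \<bullet> x - G i) \<le> conjugate (f i) (w $ i)" for w :: "'a^'m" and i
    using conjugate_ge[of "w $ i" x "f i"] by (simp add: G)
  have weak2: "dual_obj f w \<le> ereal (sum G UNIV)" if "w \<in> dual_feasible" for w
  proof -
    have "ereal (- sum G UNIV) = (\<Sum>i\<in>UNIV. ereal (w $ i \<bullet> x - G i))"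
      using that by (simp add: dual_feasible_def sum_subtractf sum_inner)
    also have "\<dots> \<le> (\<Sum>i\<in>UNIV. conjugate (f i) (w $ i))" by (intro sum_mono conj_ge)
    finally show ?thesis unfolding dual_obj_def by (simp add: ereal_uminus_le_reorder)
  qed
  have vf: "v \<in> dual_feasible" using v(2) by (simp add: dual_feasible_def)
  have pv: "primal_val f = ereal (sum G UNIV)"
    unfolding primal_val_def using weak1 px by (intro antisym INF_greatest INF_lower2[of x]) auto
  have dval: "dual_val f = ereal (sum G UNIV)"
    unfolding dual_val_def using weak2 dv vf by (intro antisym SUP_least SUP_upper2[of v]) auto
  show "primal_opt f x" by (simp add: primal_opt_def px pv)
  show "dual_opt f v" by (simp add: dual_opt_def vf dv dval)
  show "primal_val f = dual_val f" by (simp add: pv dval)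
  assume w: "dual_opt f w"
  have fin: "(\<Sum>i\<in>UNIV. conjugate (f i) (w $ i)) = ereal (- sum G UNIV)"
    using w dval by (simp add: dual_opt_def dual_obj_def ereal_uminus_eq_reorder)
  have nm: "conjugate (f i) (w $ i) \<noteq> -\<infinity>" for i using conj_ge[of w i] by auto
  define c where "c i = real_of_ereal (conjugate (f i) (w $ i))" for i
  have c: "conjugate (f i) (w $ i) = ereal (c i)" for i
    unfolding c_def using fin nm by (intro sum_ereal_of_real[of UNIV "\<lambda>i. conjugate (f i) (w $ i)"]) auto
  have ge: "w $ i \<bullet> x - G i \<le> c i" for i using conj_ge[of w i] c by simp
  \<comment> \<open>The Fenchel-Young gaps are nonnegative and, at a dual optimum, sum to zero;
    hence each gap vanishes, which is the subgradient condition.\<close>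
  have "(\<Sum>i\<in>UNIV. c i - (w $ i \<bullet> x - G i)) = 0"
    using fin w by (simp add: c sum_subtractf sum_inner dual_opt_def dual_feasible_def)
  then have "\<forall>i\<in>UNIV. c i - (w $ i \<bullet> x - G i) = 0" using ge by (subst (asm) sum_nonneg_eq_0_iff) auto
  then have ceq: "c i = w $ i \<bullet> x - G i" by simp
  show "w $ i \<in> subdifferential (f i) x"
    unfolding subdifferential_def
  proof (simp add: G(1), intro allI)
    fix y
    have "ereal (w $ i \<bullet> y) - f i y \<le> ereal (w $ i \<bullet> x - G i)"
      using conjugate_ge[of "w $ i" y "f i"] by (simp add: c ceq)
    then show "ereal (G i + w $ i \<bullet> (y - x)) \<le> f i y"
      by (cases "f i y") (auto simp: inner_simps)
  qed
qed

section \<open>Weak convergence\<close>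

lemma weakly_tendsto_offset: "weakly_tendsto (\<lambda>n. s (n + k)) l \<longleftrightarrow> weakly_tendsto s l"
  unfolding weakly_tendsto_def using LIMSEQ_offset[of "\<lambda>n. s n \<bullet> _" k] LIMSEQ_ignore_initial_segment[of "\<lambda>n. s n \<bullet> _" _ k]
  by blast

lemma tendsto_imp_weakly_tendsto: "s \<longlonglongrightarrow> l \<Longrightarrow> weakly_tendsto s l"
  unfolding weakly_tendsto_def by (auto intro!: tendsto_intros)

lemma weakly_tendsto_add: "weakly_tendsto s l \<Longrightarrow> weakly_tendsto t m \<Longrightarrow> weakly_tendsto (\<lambda>n. s n + t n) (l + m)"
  by (simp add: weakly_tendsto_def inner_add_left tendsto_add)

lemma weakly_tendsto_scaleR: "weakly_tendsto s l \<Longrightarrow> weakly_tendsto (\<lambda>n. c *\<^sub>R s n) (c *\<^sub>R l)"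
  by (simp add: weakly_tendsto_def tendsto_mult_left)

lemma weakly_tendsto_component:
  fixes s :: "nat \<Rightarrow> 'a::real_inner ^ 'm::finite"
  assumes "weakly_tendsto s l"
  shows "weakly_tendsto (\<lambda>n. s n $ i) (l $ i)"
  unfolding weakly_tendsto_def
proof
  fix h
  show "(\<lambda>n. s n $ i \<bullet> h) \<longlonglongrightarrow> l $ i \<bullet> h"
    using assms unfolding weakly_tendsto_def by (auto dest!: spec[of _ "axis i h"] simp: inner_axis)
qed

lemma weakly_tendsto_bounded:
  fixes s :: "nat \<Rightarrow> 'a::{real_inner, complete_space}"
  assumes "weakly_tendsto s l"
  obtains M where "\<And>n. norm (s n) \<le> M"
proof (rule pointwise_bounded_imp_bounded_on_closed_subspace[of UNIV s])
  fix h
  have "Bseq (\<lambda>n. s n \<bullet> h)"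
    using assms unfolding weakly_tendsto_def by (intro convergent_imp_Bseq) (auto simp: convergent_def)
  then obtain c where "\<And>n. \<bar>s n \<bullet> h\<bar> \<le> c" by (auto simp: Bseq_def)
  then have "s n \<bullet> h \<le> c" for n using abs_le_D1 by blast
  then show "\<exists>c. \<forall>n. s n \<bullet> h \<le> c" by blast
qed (use that in auto)

lemma tendsto_inner_bounded_zero:
  fixes s t :: "nat \<Rightarrow> 'a::real_inner"
  assumes "\<And>n. norm (s n) \<le> M" "t \<longlonglongrightarrow> 0"
  shows "(\<lambda>n. s n \<bullet> t n) \<longlonglongrightarrow> 0"
proof (rule Lim_null_comparison)
  show "(\<lambda>n. M * norm (t n)) \<longlonglongrightarrow> 0"
    using tendsto_mult[OF tendsto_const[of M] tendsto_norm[OF assms(2)]] by simp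
  have "norm (s n \<bullet> t n) \<le> M * norm (t n)" for n
    using Cauchy_Schwarz_ineq2[of "s n" "t n"] mult_right_mono[OF assms(1)[of n], of "norm (t n)"] by simp
  then show "eventually (\<lambda>n. norm (s n \<bullet> t n) \<le> M * norm (t n)) sequentially" by simp
qed

lemma (in orthogonal_projector) weakly_tendsto_P: "weakly_tendsto s l \<Longrightarrow> weakly_tendsto (\<lambda>n. P (s n)) (P l)"
  unfolding weakly_tendsto_def selfadj by blast

lemma (in orthogonal_projector) weakly_tendsto_Q:
  assumes "weakly_tendsto s l" shows "weakly_tendsto (\<lambda>n. Q (s n)) (Q l)"
proof -
  have "Q a = a + (- 1) *\<^sub>R P a" for a by (simp add: Q_def)
  then show ?thesis
    using weakly_tendsto_add[OF assms weakly_tendsto_scaleR[OF weakly_tendsto_P[OF assms], of "- 1"]] by simp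
qed

section \<open>The Douglas--Rachford operator\<close>

text \<open>The proximal point of \<open>g\<close> scaled by \<open>1 / \<gamma>\<close>, introduced
  through its optimality condition, the form in which the iterates deliver it.\<close>

definition prox :: "real \<Rightarrow> ('a::real_inner \<Rightarrow> ereal) \<Rightarrow> 'a \<Rightarrow> 'a" where
  "prox \<gamma> g b = (SOME p. \<gamma> *\<^sub>R (b - p) \<in> subdifferential g p)"

lemma prox_subdifferential:
  fixes g :: "'a::{real_inner, complete_space} \<Rightarrow> ereal"
  assumes "g \<in> proper_convex_lsc" "\<gamma> > 0"
  shows "\<gamma> *\<^sub>R (b - prox \<gamma> g b) \<in> subdifferential g (prox \<gamma> g b)"
  unfolding prox_def by (rule someI_ex[OF prox_exists[OF assms]])

text \<open>Monotonicity of the subdifferential. Being stated for arbitrary solutions of the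
  inclusions, it also yields uniqueness of the proximal point in the case
  \<open>b = c\<close>.\<close>

lemma prox_reflection_nonexpansive:
  fixes g :: "'a::{real_inner, complete_space} \<Rightarrow> ereal"
  assumes \<gamma>: "\<gamma> > 0" and p: "\<gamma> *\<^sub>R (b - p) \<in> subdifferential g p" and q: "\<gamma> *\<^sub>R (c - q) \<in> subdifferential g q"
  shows "norm ((2 *\<^sub>R p - b) - (2 *\<^sub>R q - c)) \<le> norm (b - c)"
proof (rule power2_le_imp_le)
  have "0 \<le> \<gamma> * ((p - q) \<bullet> ((b - p) - (c - q)))"
    using subdifferential_monotone[OF p q] by (simp flip: scaleR_diff_right)
  moreover have "(b - p) - (c - q) = (b - c) - (p - q)" by simp
  ultimately have "0 \<le> (p - q) \<bullet> ((b - c) - (p - q))"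
    using \<gamma> by (simp only: zero_le_mult_iff) simp
  moreover have "(2 *\<^sub>R p - b) - (2 *\<^sub>R q - c) = 2 *\<^sub>R (p - q) - (b - c)" by (simp add: algebra_simps)
  then have "(norm ((2 *\<^sub>R p - b) - (2 *\<^sub>R q - c)))\<^sup>2 = (norm (b - c))\<^sup>2 - 4 * ((p - q) \<bullet> ((b - c) - (p - q)))"
    unfolding power2_norm_eq_inner by (simp add: inner_simps inner_commute)
  ultimately show "(norm ((2 *\<^sub>R p - b) - (2 *\<^sub>R q - c)))\<^sup>2 \<le> (norm (b - c))\<^sup>2" by simp
qed simp

lemma prox_unique:
  fixes g :: "'a::{real_inner, complete_space} \<Rightarrow> ereal"
  assumes "g \<in> proper_convex_lsc" "\<gamma> > 0" "\<gamma> *\<^sub>R (b - p) \<in> subdifferential g p"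
  shows "prox \<gamma> g b = p"
  using prox_reflection_nonexpansive[OF assms(2) prox_subdifferential[OF assms(1,2), of b] assms(3)]
  by simp

context orthogonal_projector
begin

text \<open>The scaled map sending \<open>b\<close> to \<open>\<gamma>\<close> times
  \<open>prox \<gamma> g (b / \<gamma>)\<close> is the resolvent of the operator that assigns to
  \<open>q\<close> the subdifferential of \<open>g\<close> at \<open>q / \<gamma>\<close>. The
  formula reflects in the range of \<open>P\<close> and then applies the reflected resolvent, in the
  units of \<open>y + \<gamma> z\<close>.\<close>

definition DR_reflection :: "real \<Rightarrow> ('a \<Rightarrow> ereal) \<Rightarrow> 'a \<Rightarrow> 'a" where
  "DR_reflection \<gamma> g s = (2 * \<gamma>) *\<^sub>R prox \<gamma> g ((1 / \<gamma>) *\<^sub>R (P s - Q s)) - (P s - Q s)"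

lemma DR_reflection_nonexpansive:
  assumes g: "g \<in> proper_convex_lsc" and \<gamma>: "\<gamma> > 0"
  shows "norm (DR_reflection \<gamma> g a - DR_reflection \<gamma> g b) \<le> norm (a - b)"
proof -
  define p where "p a = prox \<gamma> g ((1 / \<gamma>) *\<^sub>R (P a - Q a))" for a
  have eq: "DR_reflection \<gamma> g a = \<gamma> *\<^sub>R (2 *\<^sub>R p a - (1 / \<gamma>) *\<^sub>R (P a - Q a))" for a
    using \<gamma> by (simp add: DR_reflection_def p_def scaleR_diff_right mult.commute)
  have "norm (DR_reflection \<gamma> g a - DR_reflection \<gamma> g b)
    = \<gamma> * norm ((2 *\<^sub>R p a - (1 / \<gamma>) *\<^sub>R (P a - Q a)) - (2 *\<^sub>R p b - (1 / \<gamma>) *\<^sub>R (P b - Q b)))"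
    unfolding eq scaleR_diff_right[symmetric] using \<gamma> by simp
  also have "\<dots> \<le> \<gamma> * norm ((1 / \<gamma>) *\<^sub>R (P a - Q a) - (1 / \<gamma>) *\<^sub>R (P b - Q b))"
    using \<gamma> unfolding p_def
    by (intro mult_left_mono prox_reflection_nonexpansive[where g = g, OF \<gamma>] prox_subdifferential[OF g \<gamma>]) auto
  also have "(1 / \<gamma>) *\<^sub>R (P a - Q a) - (1 / \<gamma>) *\<^sub>R (P b - Q b) = (1 / \<gamma>) *\<^sub>R (P (a - b) - Q (a - b))"
    by (simp add: P_simps Q_simps algebra_simps)
  also have "\<gamma> * norm ((1 / \<gamma>) *\<^sub>R (P (a - b) - Q (a - b))) = norm (a - b)"
    using \<gamma> norm_reflection[of "a - b"] by simp
  finally show ?thesis .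
qed

text \<open>The inclusion identifies \<open>x\<close> as the proximal point, so an iterate known
  only through its subgradient gives the residual explicitly.\<close>

lemma DR_reflection_diff:
  assumes g: "g \<in> proper_convex_lsc" and \<gamma>: "\<gamma> > 0" and x: "P s - Q s - \<gamma> *\<^sub>R x \<in> subdifferential g x"
  shows "DR_reflection \<gamma> g s - s = 2 *\<^sub>R (\<gamma> *\<^sub>R x - P s)"
proof -
  have "\<gamma> *\<^sub>R ((1 / \<gamma>) *\<^sub>R (P s - Q s) - x) \<in> subdifferential g x"
    using x \<gamma> by (simp add: scaleR_diff_right)
  then have "prox \<gamma> g ((1 / \<gamma>) *\<^sub>R (P s - Q s)) = x" by (rule prox_unique[OF g \<gamma>])
  then have "DR_reflection \<gamma> g s - (P s + Q s) = 2 *\<^sub>R (\<gamma> *\<^sub>R x - P s)"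
    by (simp add: DR_reflection_def algebra_simps scaleR_2)
  then show ?thesis by (simp add: P_plus_Q)
qed

lemma DR_reflection_fixpointI:
  assumes g: "g \<in> proper_convex_lsc" and \<gamma>: "\<gamma> > 0" and v: "v \<in> subdifferential g p" "P p = p" "P v = 0"
  shows "DR_reflection \<gamma> g (\<gamma> *\<^sub>R p - v) = \<gamma> *\<^sub>R p - v"
proof -
  have *: "P (\<gamma> *\<^sub>R p - v) = \<gamma> *\<^sub>R p" "Q (\<gamma> *\<^sub>R p - v) = - v"
    using v(2,3) by (simp_all add: P_simps Q_def)
  show ?thesis using DR_reflection_diff[OF g \<gamma>, of "\<gamma> *\<^sub>R p - v" p] v(1) unfolding * by simp
qed

text \<open>The proximal point \<open>p\<close> always satisfies an inclusion with subgradient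
  \<open>P c - Q c - \<gamma> p\<close>; a vanishing residual means that \<open>\<gamma> p\<close>
  is \<open>P c\<close>, and only \<open>- Q c\<close> is left.\<close>

lemma DR_reflection_fixpointD:
  assumes g: "g \<in> proper_convex_lsc" and \<gamma>: "\<gamma> > 0" and c: "DR_reflection \<gamma> g c = c"
  shows "- Q c \<in> subdifferential g ((1 / \<gamma>) *\<^sub>R P c)"
proof -
  define p where "p = prox \<gamma> g ((1 / \<gamma>) *\<^sub>R (P c - Q c))"
  have sub: "\<gamma> *\<^sub>R ((1 / \<gamma>) *\<^sub>R (P c - Q c) - p) \<in> subdifferential g p"
    unfolding p_def by (rule prox_subdifferential[OF g \<gamma>])
  have "\<gamma> *\<^sub>R ((1 / \<gamma>) *\<^sub>R (P c - Q c) - p) = P c - Q c - \<gamma> *\<^sub>R p"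
    using \<gamma> by (simp add: scaleR_diff_right)
  with sub have sub': "P c - Q c - \<gamma> *\<^sub>R p \<in> subdifferential g p" by simp
  have "\<gamma> *\<^sub>R p = P c" using DR_reflection_diff[OF g \<gamma> sub'] c by simp
  moreover from this have "p = (1 / \<gamma>) *\<^sub>R P c" using \<gamma> by (metis divide_self_if less_numeral_extra(3) scaleR_one scaleR_scaleR times_divide_eq_left mult_1)
  ultimately show ?thesis using sub' by simp
qed

end

lemma dual_multiplier_exists:
  fixes f :: "'m::finite \<Rightarrow> 'a::{real_inner, complete_space} \<Rightarrow> ereal"
  assumes f: "\<And>i. f i \<in> proper_convex_lsc" and opt: "primal_opt f x0"
    and qual: "0 \<in> sqri (dom_minus_diagonal f)"
  obtains v where "mean_proj v = 0" "v \<in> subdifferential (separable_sum f) (\<chi> i. x0)"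
proof -
  let ?g = "separable_sum f"
  define S where "S = {p - d | p d. p \<in> eff_dom ?g \<and> mean_proj d = d}"
  have S: "dom_minus_diagonal f = S"
    by (simp add: dom_minus_diagonal_def S_def eff_dom_separable_sum mean_proj_eq_self)
  define K where "K = (\<Union>l\<in>{0<..}. (\<lambda>s. l *\<^sub>R s) ` S)"
  have K: "subspace K" "closed K" and S0: "0 \<in> S"
    using qual by (simp_all add: sqri_def S K_def Let_def)
  have obj: "primal_obj f x = ?g (\<chi> i. x)" for x by (simp add: primal_obj_def separable_sum_def)
  have min: "?g (\<chi> i. x0) \<le> ?g d" if d: "mean_proj d = d" for d
  proof -
    obtain x where "d = (\<chi> i. x)" using d mean_proj_eq_self by blast
    then show ?thesis using opt by (simp add: primal_opt_def primal_val_def obj[symmetric] INF_lower)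
  qed
  \<comment> \<open>\<open>primal_opt\<close> alone would allow the value infinity. Membership of
    \<open>0\<close> in \<open>S\<close> provides a diagonal point with finite objective, so the
    minimum is finite too.\<close>
  obtain d where d: "d \<in> eff_dom ?g" "mean_proj d = d" using S0 by (auto simp: S_def)
  then have dom: "(\<chi> i. x0) \<in> eff_dom ?g" using min[OF d(2)] by (auto simp: eff_dom_def)
  show thesis
    using mean.constrained_minimizer_subgradient[OF separable_sum_pcl[OF f] mean_proj_const dom min K] that
    unfolding K_def S_def by blast
qed

text \<open>Entries that the recursions leave undetermined, such as \<open>x 0\<close>,
  \<open>x 1\<close>, \<open>zbar 1\<close> or \<open>v 0\<close>, are arbitrary; limits ignore
  finitely many terms, so the conclusions are stated without index shifts.\<close>

theorem theorem15:
  fixes f :: "'m::finite \<Rightarrow> 'a::{real_inner, complete_space} \<Rightarrow> ereal"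
    and x y z zbar v :: "nat \<Rightarrow> 'a ^ 'm"
    and u :: "nat \<Rightarrow> 'a"
    and \<alpha>s lams :: "nat \<Rightarrow> real"
    and \<alpha> lam \<sigma> \<delta> \<gamma> :: real
  assumes m: "CARD('m) \<ge> 2"
    and f: "\<And>i. f i \<in> proper_convex_lsc"
    and primal_sol: "\<exists>x0. primal_opt f x0"
    and qualification: "0 \<in> sqri (dom_minus_diagonal f)"
    and y0: "(\<Sum>i\<in>UNIV. y 0 $ i) = 0"
    and y1: "(\<Sum>i\<in>UNIV. y 1 $ i) = 0"
    and \<gamma>: "\<gamma> > 0"
    and \<alpha>s_mono: "mono_on {1..} \<alpha>s"
    and \<alpha>s_bounds: "\<And>k. k \<ge> 2 \<Longrightarrow> 0 \<le> \<alpha>s k \<and> \<alpha>s k \<le> \<alpha>"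
    and \<alpha>: "\<alpha> < 1"
    and pos: "lam > 0" "\<sigma> > 0" "\<delta> > 0"
    and \<delta>: "\<delta> > (\<alpha>\<^sup>2 * (1 + \<alpha>) + \<alpha> * \<sigma>) / (1 - \<alpha>\<^sup>2)"
    and lams_bounds: "\<And>k. k \<ge> 2 \<Longrightarrow> lam \<le> lams k \<and>
          lams k \<le> 2 * ((\<delta> - \<alpha> * (\<alpha> * (1 + \<alpha>) + \<alpha> * \<delta> + \<sigma>))
                         / (\<delta> * (1 + \<alpha> * (1 + \<alpha>) + \<alpha> * \<delta> + \<sigma>)))"
    and start: "\<alpha>s 2 = 0 \<or> (lams 1 = 0 \<and> \<alpha>s 1 = 0)"
    and x_def: "\<And>k i. k \<ge> 1 \<Longrightarrow> x (k + 1) $ i =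
          arg_min_on (\<lambda>w. f i w
            + ereal ((y k $ i - \<alpha>s k *\<^sub>R (y k $ i - y (k - 1) $ i)
                      - (\<gamma> * \<alpha>s k) *\<^sub>R (z k $ i - z (k - 1) $ i)) \<bullet> w
                    + \<gamma> / 2 * (norm (w - z k $ i))\<^sup>2)) UNIV"
    and zbar_def: "\<And>k i. k \<ge> 1 \<Longrightarrow> zbar (k + 1) $ i =
          (\<alpha>s (k + 1) * lams k) *\<^sub>R (x (k + 1) $ i - z k $ i)
          + ((1 - lams k) * \<alpha>s k * \<alpha>s (k + 1) / \<gamma>) *\<^sub>R
              (y k $ i - y (k - 1) $ i + \<gamma> *\<^sub>R (z k $ i - z (k - 1) $ i))"
    and u_def: "\<And>k. k \<ge> 1 \<Longrightarrow> u (k + 1) =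
          (lams k * (1 + \<alpha>s (k + 1)) / real CARD('m)) *\<^sub>R (\<Sum>i\<in>UNIV. x (k + 1) $ i)
          + ((1 - \<alpha>s (k + 1) * lams k - lams k) / real CARD('m)) *\<^sub>R (\<Sum>i\<in>UNIV. z k $ i)
          + (\<alpha>s k * (1 - lams k) * (1 + \<alpha>s (k + 1)) / real CARD('m)) *\<^sub>R
              (\<Sum>i\<in>UNIV. z k $ i - z (k - 1) $ i)"
    and z_def: "\<And>k i. k \<ge> 1 \<Longrightarrow> z (k + 1) $ i = u (k + 1) - zbar (k + 1) $ i"
    and y_def: "\<And>k i. k \<ge> 1 \<Longrightarrow> y (k + 1) $ i =
          y k $ i
          + \<gamma> *\<^sub>R (lams k *\<^sub>R x (k + 1) $ i + (1 - lams k) *\<^sub>R z k $ i - z (k + 1) $ i)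
          + ((1 - lams k) * \<alpha>s k) *\<^sub>R
              (y k $ i - y (k - 1) $ i + \<gamma> *\<^sub>R (z k $ i - z (k - 1) $ i))"
    and v_def: "\<And>k i. k \<ge> 1 \<Longrightarrow> v k $ i =
          y k $ i - \<gamma> *\<^sub>R z k $ i + \<gamma> *\<^sub>R x (k + 1) $ i
          - \<alpha>s k *\<^sub>R (y k $ i - y (k - 1) $ i + \<gamma> *\<^sub>R (z k $ i - z (k - 1) $ i))"
  shows "\<exists>(xbar::'a) (vbar::'a ^ 'm).
      (\<forall>i. vbar $ i \<in> subdifferential (f i) xbar) \<and> (\<Sum>i\<in>UNIV. vbar $ i) = 0 \<and>
      primal_opt f xbar \<and> dual_opt f vbar \<and> primal_val f = dual_val f \<and>
      \<comment> \<open>(i)\<close> (\<forall>i. weakly_tendsto (\<lambda>k. x k $ i) xbar) \<and>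
      \<comment> \<open>(ii)\<close> (\<forall>i. (\<lambda>k. zbar k $ i) \<longlonglongrightarrow> 0) \<and>
      \<comment> \<open>(iii)\<close> (\<forall>i. weakly_tendsto (\<lambda>k. z k $ i) xbar) \<and>
      \<comment> \<open>(iv)\<close> (\<forall>i. (\<lambda>k. x (k + 1) $ i - z k $ i) \<longlonglongrightarrow> 0) \<and>
      \<comment> \<open>(v)\<close> weakly_tendsto u xbar \<and>
      \<comment> \<open>(vi)\<close> (\<forall>i. weakly_tendsto (\<lambda>k. y k $ i) (- vbar $ i)) \<and>
      \<comment> \<open>(vii)\<close> ((\<forall>i. strongly_convex (conjugate (f i))) \<longrightarrow>
        (\<exists>!w. dual_opt f w) \<and> (\<forall>w. dual_opt f w \<longrightarrow> (\<lambda>k. - y k) \<longlonglongrightarrow> w)) \<and>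
      \<comment> \<open>(viii)\<close> (\<lambda>k. \<Sum>i\<in>UNIV. f i (x (k + 1) $ i)) \<longlonglongrightarrow> primal_val f \<and>
        (\<lambda>k. - (\<Sum>i\<in>UNIV. conjugate (f i) (- v k $ i))) \<longlonglongrightarrow> dual_val f \<and>
        (\<forall>i. weakly_tendsto (\<lambda>k. v k $ i) (- vbar $ i))"
proof -
  let ?g = "separable_sum f"
  let ?P = "mean_proj :: 'a ^ 'm \<Rightarrow> 'a ^ 'm"
  let ?Q = "mean.Q :: 'a ^ 'm \<Rightarrow> 'a ^ 'm"
  define R where "R = mean.DR_reflection \<gamma> ?g"
  have g: "?g \<in> proper_convex_lsc" by (rule separable_sum_pcl[OF f])
  \<comment> \<open>From \<open>k = 2\<close> on, the component of \<open>s k\<close> along the diagonal is \<open>\<gamma> U k\<close> and the orthogonal one is \<open>y k\<close>,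
    so \<open>W\<close> is an inertial Krasnosel'skii--Mann iteration of the Douglas--Rachford reflection \<open>R\<close>,
    relaxed by \<open>lams k / 2\<close>.\<close>
  define W where "W k = y k + \<gamma> *\<^sub>R z k" for k
  define U where "U k = (\<chi> i::'m. u k)" for k
  define s where "s k = W k + \<alpha>s k *\<^sub>R (W k - W (k - 1))" for k

  \<comment> \<open>The scheme rewritten as a relaxed inertial iteration of \<open>R\<close>\<close>
  have x_sub: "- v k \<in> subdifferential ?g (x (k + 1))" if k: "k \<ge> 1" for k
    unfolding separable_sum_subdifferential_iff[OF f]
  proof
    fix i
    have "- v k $ i = \<gamma> *\<^sub>R (z k $ i - x (k + 1) $ i) - (y k $ i - \<alpha>s k *\<^sub>R (y k $ i - y (k - 1) $ i)
                      - (\<gamma> * \<alpha>s k) *\<^sub>R (z k $ i - z (k - 1) $ i))"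
      using v_def[OF k, of i] by (simp add: algebra_simps)
    then show "(- v k) $ i \<in> subdifferential (f i) (x (k + 1) $ i)"
      using arg_min_quadratic_subdifferential[OF f \<gamma> x_def[OF k]] by simp
  qed
  \<comment> \<open>The coefficients of \<open>u\<close> make the components of
    \<open>z (j + 1)\<close> sum to \<open>lams j\<close> times \<open>Sx\<close>, plus
    \<open>1 - lams j\<close> times \<open>Sz\<close> and \<open>\<alpha>s j * Sd\<close>, exactly
    what the update of \<open>y\<close> adds. The recursion reaches back two indices, hence the
    strong induction.\<close>
  have y_sum: "(\<Sum>i\<in>UNIV. y k $ i) = 0" for k
  proof (induction k rule: less_induct)
    case (less k)
    show ?case
    proof (cases "k \<le> 1")
      case True
      then show ?thesis using y0 y1 by (cases k) auto
    next
      case False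
      then obtain j where j: "k = j + 1" "j \<ge> 1" by (metis Suc_eq_plus1 less_eq_Suc_le not_le not_less_eq_eq One_nat_def Suc_le_D)
      have IH: "(\<Sum>i\<in>UNIV. y j $ i) = 0" "(\<Sum>i\<in>UNIV. y (j - 1) $ i) = 0" using less j by auto
      define Sx Sz Sd where "Sx = (\<Sum>i\<in>UNIV. x (j + 1) $ i)" and "Sz = (\<Sum>i\<in>UNIV. z j $ i)"
        and "Sd = (\<Sum>i\<in>UNIV. z j $ i - z (j - 1) $ i)"
      have zb: "(\<Sum>i\<in>UNIV. zbar (j + 1) $ i) = (\<alpha>s (j + 1) * lams j) *\<^sub>R (Sx - Sz)
          + ((1 - lams j) * \<alpha>s j * \<alpha>s (j + 1)) *\<^sub>R Sd"
        using \<gamma> IH unfolding zbar_def[OF j(2)] Sx_def Sz_def Sd_def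
        by (simp add: sum.distrib sum_subtractf flip: scaleR_sum_right)
      have mu: "real CARD('m) *\<^sub>R u (j + 1) = (lams j * (1 + \<alpha>s (j + 1))) *\<^sub>R Sx
          + (1 - \<alpha>s (j + 1) * lams j - lams j) *\<^sub>R Sz + (\<alpha>s j * (1 - lams j) * (1 + \<alpha>s (j + 1))) *\<^sub>R Sd"
        unfolding u_def[OF j(2)] Sx_def[symmetric] Sz_def[symmetric] Sd_def[symmetric]
        by (simp add: scaleR_right_distrib)
      have zs: "(\<Sum>i\<in>UNIV. z (j + 1) $ i) = real CARD('m) *\<^sub>R u (j + 1) - (\<Sum>i\<in>UNIV. zbar (j + 1) $ i)"
        unfolding z_def[OF j(2)] by (simp add: sum_subtractf sum_constant_scaleR)
      have "(\<Sum>i\<in>UNIV. y (j + 1) $ i) = \<gamma> *\<^sub>R (lams j *\<^sub>R Sx + (1 - lams j) *\<^sub>R Sz - (\<Sum>i\<in>UNIV. z (j + 1) $ i))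
          + ((1 - lams j) * \<alpha>s j) *\<^sub>R (\<gamma> *\<^sub>R Sd)"
        using IH unfolding y_def[OF j(2)] Sx_def Sz_def Sd_def
        by (simp add: sum.distrib sum_subtractf flip: scaleR_sum_right)
      also have "\<dots> = 0" unfolding zs zb mu by (simp add: algebra_simps)
      finally show ?thesis by (simp add: j)
    qed
  qed
  have Py: "?P (y k) = 0" for k using y_sum by (simp add: mean_proj_eq_0)
  have PU: "?P (U k) = U k" for k by (simp add: U_def)
  \<comment> \<open>In \<open>y + \<gamma> z\<close> the new \<open>z (k + 1)\<close> cancels, so
    \<open>W\<close> obeys a recursion without \<open>u\<close> and \<open>zbar\<close>.\<close>
  have W_step: "W (k + 1) - W k = (lams k * \<gamma>) *\<^sub>R (x (k + 1) - z k) + ((1 - lams k) * \<alpha>s k) *\<^sub>R (W k - W (k - 1))"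
    if k: "k \<ge> 1" for k
  proof (rule vec_eq_iff[THEN iffD2, rule_format])
    fix i
    show "(W (k + 1) - W k) $ i = ((lams k * \<gamma>) *\<^sub>R (x (k + 1) - z k) + ((1 - lams k) * \<alpha>s k) *\<^sub>R (W k - W (k - 1))) $ i"
      by (simp add: W_def y_def[OF k, simplified] algebra_simps)
  qed
  \<comment> \<open>\<open>zbar\<close> is the inertial displacement in disguise. Its recursion
    starts at index \<open>2\<close>, which is where the description of the scheme through
    \<open>R\<close> begins.\<close>
  have zbar_W: "\<gamma> *\<^sub>R zbar k = \<alpha>s k *\<^sub>R (W k - W (k - 1))" if k: "k \<ge> 2" for k
  proof -
    obtain j where j: "k = j + 1" "j \<ge> 1" using k by (metis Suc_eq_plus1 Suc_le_D Suc_le_mono numeral_2_eq_2 One_nat_def)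
    have "\<gamma> *\<^sub>R zbar (j + 1) = \<alpha>s (j + 1) *\<^sub>R (W (j + 1) - W j)"
    proof (rule vec_eq_iff[THEN iffD2, rule_format])
      fix i
      have "\<gamma> *\<^sub>R zbar (j + 1) $ i = (\<gamma> * (\<alpha>s (j + 1) * lams j)) *\<^sub>R (x (j + 1) $ i - z j $ i)
          + ((1 - lams j) * \<alpha>s j * \<alpha>s (j + 1)) *\<^sub>R (y j $ i - y (j - 1) $ i + \<gamma> *\<^sub>R (z j $ i - z (j - 1) $ i))"
        using \<gamma> unfolding zbar_def[OF j(2)] by (simp add: scaleR_add_right[of \<gamma>])
      then show "(\<gamma> *\<^sub>R zbar (j + 1)) $ i = (\<alpha>s (j + 1) *\<^sub>R (W (j + 1) - W j)) $ i"
        unfolding W_step[OF j(2)] by (simp add: W_def algebra_simps)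
    qed
    then show ?thesis by (simp add: j)
  qed
  have zU: "z k = U k - zbar k" if k: "k \<ge> 2" for k
  proof -
    obtain j where j: "k = j + 1" "j \<ge> 1" using k by (metis Suc_eq_plus1 Suc_le_D Suc_le_mono numeral_2_eq_2 One_nat_def)
    show ?thesis unfolding j(1) by (simp add: vec_eq_iff z_def[OF j(2), simplified] U_def)
  qed
  \<comment> \<open>Extrapolating \<open>W\<close> adds back exactly the \<open>zbar\<close> that
    was subtracted from \<open>u\<close> to form \<open>z\<close>.\<close>
  have s_eq: "s k = \<gamma> *\<^sub>R U k + y k" if k: "k \<ge> 2" for k
    unfolding s_def zbar_W[OF k, symmetric] unfolding W_def zU[OF k] by (simp add: algebra_simps)
  have Ps: "?P (s k) = \<gamma> *\<^sub>R U k" and Qs: "?Q (s k) = y k" if k: "k \<ge> 2" for k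
    using s_eq[OF k] by (simp_all add: mean.P_simps mean.Q_def Py PU)
  have v_eq: "v k = y k + \<gamma> *\<^sub>R (x (k + 1) - U k)" if k: "k \<ge> 2" for k
  proof -
    have "v k = y k - \<gamma> *\<^sub>R z k + \<gamma> *\<^sub>R x (k + 1) - \<alpha>s k *\<^sub>R (W k - W (k - 1))"
      using k by (simp add: vec_eq_iff v_def W_def algebra_simps)
    then show ?thesis unfolding zbar_W[OF k, symmetric] zU[OF k] by (simp add: algebra_simps)
  qed
  have Rs: "R (s k) - s k = (2 * \<gamma>) *\<^sub>R (x (k + 1) - U k)" if k: "k \<ge> 2" for k
  proof -
    have "?P (s k) - ?Q (s k) - \<gamma> *\<^sub>R x (k + 1) = - v k"
      by (simp add: Ps[OF k] Qs[OF k] v_eq[OF k] algebra_simps)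
    then have "R (s k) - s k = 2 *\<^sub>R (\<gamma> *\<^sub>R x (k + 1) - ?P (s k))"
      using x_sub[of k] k unfolding R_def by (intro mean.DR_reflection_diff[OF g \<gamma>]) simp
    then show ?thesis by (simp add: Ps[OF k] algebra_simps)
  qed
  have W_iter: "W (k + 1) = s k + (lams k / 2) *\<^sub>R (R (s k) - s k)" if k: "k \<ge> 2" for k
  proof -
    have "W (k + 1) = W k + ((lams k * \<gamma>) *\<^sub>R (x (k + 1) - z k) + ((1 - lams k) * \<alpha>s k) *\<^sub>R (W k - W (k - 1)))"
      using W_step[of k] k by (simp add: algebra_simps)
    also have "\<dots> = s k + (lams k * \<gamma>) *\<^sub>R (x (k + 1) - z k) - lams k *\<^sub>R (\<alpha>s k *\<^sub>R (W k - W (k - 1)))"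
      by (simp add: s_def algebra_simps)
    also have "\<dots> = s k + (lams k * \<gamma>) *\<^sub>R (x (k + 1) - U k)"
      unfolding zbar_W[OF k, symmetric] zU[OF k] by (simp add: algebra_simps)
    finally show ?thesis by (simp add: Rs[OF k])
  qed

  \<comment> \<open>A fixed point of \<open>R\<close> and the weak limit of \<open>W\<close>\<close>
  obtain x0 where x0: "primal_opt f x0" using primal_sol by blast
  obtain v0 where v0: "?P v0 = 0" "v0 \<in> subdifferential ?g (\<chi> i. x0)"
    using dual_multiplier_exists[OF f x0 qualification] by blast
  have fixp: "R (\<gamma> *\<^sub>R (\<chi> i. x0) - v0) = \<gamma> *\<^sub>R (\<chi> i. x0) - v0"
    unfolding R_def by (rule mean.DR_reflection_fixpointI[OF g \<gamma> v0(2) _ v0(1)]) simp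
  have ne: "norm (R a - R b) \<le> norm (a - b)" for a b
    unfolding R_def by (rule mean.DR_reflection_nonexpansive[OF g \<gamma>])
  \<comment> \<open>The shift takes \<open>W 1\<close> and \<open>W 2\<close> as starting points, so
    that only \<open>\<alpha>s k\<close> and \<open>lams k\<close> with \<open>k\<close> at least
    \<open>2\<close> occur, where the bounds are available.\<close>
  obtain c where Rc: "R c = c" and Wc: "weakly_tendsto (\<lambda>n. W (n + 1)) c"
    and dW: "(\<lambda>n. W (Suc n + 1) - W (n + 1)) \<longlonglongrightarrow> 0" and Rs0: "(\<lambda>n. R (s (n + 2)) - s (n + 2)) \<longlonglongrightarrow> 0"
  proof (rule inertial_KM_weak_convergence[of R "\<gamma> *\<^sub>R (\<chi> i. x0) - v0" "\<lambda>n. s (n + 2)" "\<lambda>n. W (n + 1)"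
        "\<lambda>n. \<alpha>s (n + 2)" "\<lambda>n. lams (n + 2) / 2" \<alpha> "lam / 2" \<sigma> \<delta>])
    show "incseq (\<lambda>n. \<alpha>s (n + 2))"
      using \<alpha>s_mono by (auto simp: incseq_def mono_on_def)
    show "W (Suc (Suc n) + 1) = s (n + 2) + (lams (n + 2) / 2) *\<^sub>R (R (s (n + 2)) - s (n + 2))" for n
      using W_iter[of "n + 2"] by simp
    show "s (n + 2) = W (Suc n + 1) + \<alpha>s (n + 2) *\<^sub>R (W (Suc n + 1) - W (n + 1))" for n
      by (simp add: s_def)
    show "lams (n + 2) / 2 \<le> (\<delta> - \<alpha> * (\<alpha> * (1 + \<alpha>) + \<alpha> * \<delta> + \<sigma>)) / (\<delta> * (1 + \<alpha> * (1 + \<alpha>) + \<alpha> * \<delta> + \<sigma>))" for n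
      using lams_bounds[of "n + 2"] by linarith
    show "lam / 2 \<le> lams (n + 2) / 2" for n using lams_bounds[of "n + 2"] by simp
  qed (use ne fixp \<alpha>s_bounds \<alpha> pos in auto)
  \<comment> \<open>The fixed point decomposes as \<open>c = \<gamma> xb - vbar\<close>, so its two
    projections give the primal and the dual limit.\<close>
  define xb where "xb = (1 / \<gamma>) *\<^sub>R ?P c"
  define vbar where "vbar = - ?Q c"
  have vb: "vbar \<in> subdifferential ?g xb"
    unfolding vbar_def xb_def using Rc unfolding R_def by (rule mean.DR_reflection_fixpointD[OF g \<gamma>])
  have Pxb: "?P xb = xb" by (simp add: xb_def mean.P_simps mean.idem)
  then obtain xbar where xbar: "xb = (\<chi> i. xbar)" using mean_proj_eq_self by blast
  have Pvb: "?P vbar = 0" by (simp add: vbar_def mean.P_simps)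
  then have vsum: "(\<Sum>i\<in>UNIV. vbar $ i) = 0" by (simp add: mean_proj_eq_0)
  have vsub: "vbar $ i \<in> subdifferential (f i) xbar" for i
    using vb unfolding separable_sum_subdifferential_iff[OF f] by (simp add: xbar)

  \<comment> \<open>Vanishing residuals and weak limits in the product space\<close>
  define e where "e k = x (k + 1) - U k" for k
  have e0: "(\<lambda>n. e (n + 2)) \<longlonglongrightarrow> 0"
    using tendsto_scaleR[OF tendsto_const[of "1 / (2 * \<gamma>)"] Rs0] \<gamma> by (simp add: Rs e_def)
  have zb0: "(\<lambda>n. zbar (n + 2)) \<longlonglongrightarrow> 0"
  proof (rule Lim_null_comparison)
    show "(\<lambda>n. 1 / \<gamma> * norm (W (Suc n + 1) - W (n + 1))) \<longlonglongrightarrow> 0"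
      using tendsto_mult[OF tendsto_const[of "1 / \<gamma>"] tendsto_norm[OF dW]] by simp
    have "norm (zbar (n + 2)) \<le> 1 / \<gamma> * norm (W (Suc n + 1) - W (n + 1))" for n
    proof -
      have "\<gamma> * norm (zbar (n + 2)) = norm (\<gamma> *\<^sub>R zbar (n + 2))" using \<gamma> by simp
      also have "\<dots> = \<alpha>s (n + 2) * norm (W (Suc n + 1) - W (n + 1))"
        using zbar_W[of "n + 2"] \<alpha>s_bounds[of "n + 2"] by simp
      also have "\<dots> \<le> 1 * norm (W (Suc n + 1) - W (n + 1))"
        using \<alpha>s_bounds[of "n + 2"] \<alpha> by (intro mult_right_mono) auto
      finally show ?thesis using \<gamma> by (simp add: field_simps)
    qed
    then show "eventually (\<lambda>n. norm (zbar (n + 2)) \<le> 1 / \<gamma> * norm (W (Suc n + 1) - W (n + 1))) sequentially" by simp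
  qed
  have Wc': "weakly_tendsto (\<lambda>n. W (n + 2)) c"
    using Wc weakly_tendsto_offset[of W 1 c] weakly_tendsto_offset[of W 2 c] by simp
  \<comment> \<open>\<open>s\<close> and \<open>W\<close> differ by a strongly vanishing term and so
    share the weak limit; the projections of \<open>s\<close> are the quantities of
    interest.\<close>
  have "s (n + 2) = W (n + 2) + \<gamma> *\<^sub>R zbar (n + 2)" for n
    using zbar_W[of "n + 2"] by (simp add: s_def)
  moreover have "(\<lambda>n. \<gamma> *\<^sub>R zbar (n + 2)) \<longlonglongrightarrow> 0" using tendsto_scaleR[OF tendsto_const[of \<gamma>] zb0] by simp
  ultimately have sc: "weakly_tendsto (\<lambda>n. s (n + 2)) c"
    using weakly_tendsto_add[OF Wc' tendsto_imp_weakly_tendsto] by fastforce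
  have yw: "weakly_tendsto (\<lambda>n. y (n + 2)) (- vbar)"
    using mean.weakly_tendsto_Q[OF sc] by (simp add: Qs vbar_def)
  have Uw: "weakly_tendsto (\<lambda>n. U (n + 2)) xb"
    using weakly_tendsto_scaleR[OF mean.weakly_tendsto_P[OF sc], of "1 / \<gamma>"] \<gamma> by (simp add: Ps xb_def)
  have xw: "weakly_tendsto (\<lambda>n. x (n + 3)) xb"
    using weakly_tendsto_add[OF Uw tendsto_imp_weakly_tendsto[OF e0]] by (simp add: e_def numeral_3_eq_3)
  have zw: "weakly_tendsto (\<lambda>n. z (n + 2)) xb"
    using weakly_tendsto_add[OF Uw tendsto_imp_weakly_tendsto[OF tendsto_minus[OF zb0]]] by (simp add: zU)
  have vw: "weakly_tendsto (\<lambda>n. v (n + 2)) (- vbar)"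
    using weakly_tendsto_add[OF yw tendsto_imp_weakly_tendsto[OF tendsto_scaleR[OF tendsto_const[of \<gamma>] e0]]]
    by (simp add: v_eq e_def)
  obtain My where My: "\<And>n. norm (y (n + 2)) \<le> My" using weakly_tendsto_bounded[OF yw] by blast
  have xbw: "weakly_tendsto (\<lambda>n. x (n + 3) - xb) 0"
    using weakly_tendsto_add[OF xw tendsto_imp_weakly_tendsto[OF tendsto_const[of "- xb"]]] by simp
  obtain Mx where Mx: "\<And>n. norm (x (n + 3) - xb) \<le> Mx" using weakly_tendsto_bounded[OF xbw] by blast
  \<comment> \<open>Splitting off \<open>e\<close> from both factors leaves the pairing of
    \<open>y\<close> with the diagonal vector \<open>U - xb\<close>, which is zero; each other term
    pairs a bounded sequence with \<open>e\<close>.\<close>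
  have vx: "(\<lambda>n. v (n + 2) \<bullet> (x (n + 3) - xb)) \<longlonglongrightarrow> 0"
  proof -
    have "v (n + 2) \<bullet> (x (n + 3) - xb) = y (n + 2) \<bullet> e (n + 2) + \<gamma> * ((x (n + 3) - xb) \<bullet> e (n + 2))" for n
    proof -
      have orth: "y (n + 2) \<bullet> (U (n + 2) - xb) = 0"
        using mean.selfadj[of "y (n + 2)" "U (n + 2) - xb"] Py PU Pxb by (simp add: mean.P_simps)
      have "x (n + 3) - xb = e (n + 2) + (U (n + 2) - xb)" by (simp add: e_def numeral_3_eq_3)
      then have yx: "y (n + 2) \<bullet> (x (n + 3) - xb) = y (n + 2) \<bullet> e (n + 2) + y (n + 2) \<bullet> (U (n + 2) - xb)"
        by (simp only: inner_add_right)
      have ve: "v (n + 2) = y (n + 2) + \<gamma> *\<^sub>R e (n + 2)" by (simp add: v_eq e_def)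
      show ?thesis unfolding ve inner_add_left inner_scaleR_left yx orth by (simp add: inner_commute)
    qed
    moreover have "(\<lambda>n. y (n + 2) \<bullet> e (n + 2) + \<gamma> * ((x (n + 3) - xb) \<bullet> e (n + 2))) \<longlonglongrightarrow> 0 + \<gamma> * 0"
      using My Mx by (intro tendsto_add tendsto_mult tendsto_const tendsto_inner_bounded_zero e0)
    ultimately show ?thesis by simp
  qed
  have vbx: "(\<lambda>n. vbar \<bullet> (x (n + 3) - xb)) \<longlonglongrightarrow> 0"
    using xbw unfolding weakly_tendsto_def by (auto dest: spec[of _ vbar] simp: inner_commute)

  \<comment> \<open>Primal values along the iteration\<close>
  obtain Gb where Gb: "?g xb = ereal Gb" "\<And>q. ereal (Gb + vbar \<bullet> (q - xb)) \<le> ?g q"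
    using subdifferentialE[OF vb] by blast
  define G where "G i k = real_of_ereal (f i (x (k + 1) $ i))" for i k
  have xi_sub: "- v k $ i \<in> subdifferential (f i) (x (k + 1) $ i)" if "k \<ge> 1" for k i
    using x_sub[OF that] unfolding separable_sum_subdifferential_iff[OF f] by simp
  have G: "f i (x (k + 1) $ i) = ereal (G i k)" if "k \<ge> 1" for i k
    using subdifferentialE[OF xi_sub[OF that]] by (metis G_def real_of_ereal.simps(1))
  define F where "F k = (\<Sum>i\<in>UNIV. G i k)" for k
  have F: "?g (x (k + 1)) = ereal (F k)" if "k \<ge> 1" for k
    using G[OF that] by (simp add: separable_sum_def F_def)
  \<comment> \<open>The subgradient inequality at \<open>xb\<close> bounds \<open>F\<close> from
    below, the one at the iterate bounds it from above, and both error terms vanish.\<close>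
  have Flim: "(\<lambda>n. F (n + 2)) \<longlonglongrightarrow> Gb"
  proof (rule tendsto_sandwich)
    have "Gb + vbar \<bullet> (x (n + 3) - xb) \<le> F (n + 2)" for n
      using Gb(2)[of "x (n + 3)"] F[of "n + 2"] by (simp add: numeral_3_eq_3)
    then show "eventually (\<lambda>n. Gb + vbar \<bullet> (x (n + 3) - xb) \<le> F (n + 2)) sequentially" by simp
    have "F (n + 2) \<le> Gb - v (n + 2) \<bullet> (x (n + 3) - xb)" for n
    proof -
      have "?g (x (n + 3)) + ereal ((- v (n + 2)) \<bullet> (xb - x (n + 3))) \<le> ?g xb"
        using x_sub[of "n + 2"] by (auto simp: subdifferential_def numeral_3_eq_3 split: if_splits)
      then have "F (n + 2) + (- v (n + 2)) \<bullet> (xb - x (n + 3)) \<le> Gb"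
        using F[of "n + 2"] by (simp add: Gb(1) numeral_3_eq_3)
      then show ?thesis by (simp add: inner_diff_right)
    qed
    then show "eventually (\<lambda>n. F (n + 2) \<le> Gb - v (n + 2) \<bullet> (x (n + 3) - xb)) sequentially" by simp
    show "(\<lambda>n. Gb + vbar \<bullet> (x (n + 3) - xb)) \<longlonglongrightarrow> Gb" using tendsto_add[OF tendsto_const vbx] by simp
    show "(\<lambda>n. Gb - v (n + 2) \<bullet> (x (n + 3) - xb)) \<longlonglongrightarrow> Gb" using tendsto_diff[OF tendsto_const vx] by simp
  qed
  note dual = fenchel_duality[OF vsub vsum]
  have pval: "primal_val f = ereal Gb"
    using dual(1) Gb(1) by (simp add: primal_opt_def primal_obj_def separable_sum_def xbar)

  \<comment> \<open>Componentwise limits and limits of the objective values\<close>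
  have comp: "weakly_tendsto (\<lambda>k. t k $ i) (l $ i)" if "weakly_tendsto (\<lambda>n. t (n + N)) l" for t :: "nat \<Rightarrow> 'a ^ 'm" and l N i
    using weakly_tendsto_component[OF that, of i] weakly_tendsto_offset[of "\<lambda>k. t k $ i" N "l $ i"] by blast
  have i1: "weakly_tendsto (\<lambda>k. x k $ i) xbar" for i using comp[OF xw, of i] by (simp add: xbar)
  have i3: "weakly_tendsto (\<lambda>k. z k $ i) xbar" for i using comp[OF zw, of i] by (simp add: xbar)
  have i5: "weakly_tendsto u xbar" using comp[OF Uw] by (simp add: xbar U_def)
  have i6: "weakly_tendsto (\<lambda>k. y k $ i) (- vbar $ i)" for i using comp[OF yw, of i] by simp
  have i8: "weakly_tendsto (\<lambda>k. v k $ i) (- vbar $ i)" for i using comp[OF vw, of i] by simp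
  have i2: "(\<lambda>k. zbar k $ i) \<longlonglongrightarrow> 0" for i
    using LIMSEQ_offset[OF zb0] tendsto_vec_nth[of zbar 0 sequentially i] by simp
  have i4: "(\<lambda>k. x (k + 1) $ i - z k $ i) \<longlonglongrightarrow> 0" for i
  proof (rule LIMSEQ_offset[of _ 2])
    have "x (n + 2 + 1) $ i - z (n + 2) $ i = (e (n + 2) + zbar (n + 2)) $ i" for n
      by (simp add: e_def zU)
    moreover have "(\<lambda>n. (e (n + 2) + zbar (n + 2)) $ i) \<longlonglongrightarrow> (0 + 0) $ i"
      by (intro tendsto_vec_nth tendsto_add e0 zb0)
    ultimately show "(\<lambda>n. x (n + 2 + 1) $ i - z (n + 2) $ i) \<longlonglongrightarrow> 0" by simp
  qed
  have primal_lim: "(\<lambda>k. \<Sum>i\<in>UNIV. f i (x (k + 1) $ i)) \<longlonglongrightarrow> primal_val f"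
  proof (rule LIMSEQ_offset[of _ 2])
    have "(\<Sum>i\<in>UNIV. f i (x (n + 2 + 1) $ i)) = ereal (F (n + 2))" for n
      using F[of "n + 2"] by (simp add: separable_sum_def)
    then show "(\<lambda>n. \<Sum>i\<in>UNIV. f i (x (n + 2 + 1) $ i)) \<longlonglongrightarrow> primal_val f"
      using Flim by (simp add: pval)
  qed
  have dual_lim: "(\<lambda>k. - (\<Sum>i\<in>UNIV. conjugate (f i) (- v k $ i))) \<longlonglongrightarrow> dual_val f"
  proof (rule LIMSEQ_offset[of _ 2])
    \<comment> \<open>The Fenchel-Young equality expresses the dual value by the primal one plus the
      pairing of \<open>v\<close> and \<open>x\<close>; that pairing vanishes because
      \<open>vbar\<close> is orthogonal to the diagonal vector \<open>xb\<close>.\<close>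
    have "- (\<Sum>i\<in>UNIV. conjugate (f i) (- v (n + 2) $ i)) = ereal (F (n + 2) + v (n + 2) \<bullet> x (n + 3))" for n
      using conjugate_subgradient[OF xi_sub[of "n + 2"] G[of "n + 2"]]
      by (simp add: inner_vec_def sum_subtractf sum_negf F_def numeral_3_eq_3)
    moreover have "(\<lambda>n. F (n + 2) + v (n + 2) \<bullet> x (n + 3)) \<longlonglongrightarrow> Gb"
    proof -
      have "(\<lambda>n. v (n + 2) \<bullet> xb) \<longlonglongrightarrow> - vbar \<bullet> xb" using vw by (simp add: weakly_tendsto_def)
      moreover have "vbar \<bullet> xb = 0" using mean.selfadj[of vbar xb] Pvb Pxb by simp
      ultimately have "(\<lambda>n. v (n + 2) \<bullet> xb) \<longlonglongrightarrow> 0" by simp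
      from tendsto_add[OF Flim tendsto_add[OF vx this]] show ?thesis by (simp add: inner_diff_right)
    qed
    ultimately show "(\<lambda>n. - (\<Sum>i\<in>UNIV. conjugate (f i) (- v (n + 2) $ i))) \<longlonglongrightarrow> dual_val f"
      by (simp add: dual(3)[symmetric] pval)
  qed

  \<comment> \<open>Strong convergence of the dual iterates\<close>
  have i7: "(\<exists>!w. dual_opt f w) \<and> (\<forall>w. dual_opt f w \<longrightarrow> (\<lambda>k. - y k) \<longlonglongrightarrow> w)"
    if sc: "\<forall>i. strongly_convex (conjugate (f i))"
  proof -
    have "\<forall>i. \<exists>\<beta>>0. \<forall>v w p q. v \<in> subdifferential (f i) p \<longrightarrow> w \<in> subdifferential (f i) q \<longrightarrow>
        \<beta> * (norm (v - w))\<^sup>2 \<le> (p - q) \<bullet> (v - w)"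
      using sc strongly_convex_conjugate_strongly_monotone by metis
    then obtain \<beta> where \<beta>: "\<And>i. \<beta> i > 0" and sm: "\<And>i v w p q. v \<in> subdifferential (f i) p \<Longrightarrow> w \<in> subdifferential (f i) q \<Longrightarrow>
        \<beta> i * (norm (v - w))\<^sup>2 \<le> (p - q) \<bullet> (v - w)" by metis
    have uniq: "w = vbar" if w: "dual_opt f w" for w
    proof (rule vec_eq_iff[THEN iffD2, rule_format])
      fix i
      have "\<beta> i * (norm (w $ i - vbar $ i))\<^sup>2 \<le> 0" using sm[OF dual(4)[OF w] vsub] by simp
      then show "w $ i = vbar $ i" using \<beta>[of i] by (simp add: mult_le_0_iff)
    qed
    \<comment> \<open>The monotonicity gap of the whole product. By strong monotonicity each
      component of it is nonnegative, so the total controls every single component of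
      \<open>- v - vbar\<close>.\<close>
    define \<tau> where "\<tau> n = (x (n + 3) - xb) \<bullet> (- v (n + 2) - vbar)" for n
    have "(\<lambda>n. - (v (n + 2) \<bullet> (x (n + 3) - xb)) - vbar \<bullet> (x (n + 3) - xb)) \<longlonglongrightarrow> - 0 - 0"
      by (intro tendsto_diff tendsto_minus vx vbx)
    moreover have "\<tau> = (\<lambda>n. - (v (n + 2) \<bullet> (x (n + 3) - xb)) - vbar \<bullet> (x (n + 3) - xb))"
    proof
      fix n
      show "\<tau> n = - (v (n + 2) \<bullet> (x (n + 3) - xb)) - vbar \<bullet> (x (n + 3) - xb)"
        unfolding \<tau>_def inner_commute[of "x (n + 3) - xb"]
        unfolding inner_diff_left[of "- v (n + 2)"] inner_minus_left ..
    qed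
    ultimately have \<tau>0: "\<tau> \<longlonglongrightarrow> 0" by simp
    have le: "\<beta> i * (norm (- v (n + 2) $ i - vbar $ i))\<^sup>2 \<le> \<tau> n" for i n
    proof -
      have "\<beta> j * (norm (- v (n + 2) $ j - vbar $ j))\<^sup>2 \<le> (x (n + 3) $ j - xbar) \<bullet> (- v (n + 2) $ j - vbar $ j)" for j
        using sm[OF xi_sub[of "n + 2" j] vsub[of j]] by (simp add: numeral_3_eq_3)
      moreover have "0 \<le> \<beta> j * (norm (- v (n + 2) $ j - vbar $ j))\<^sup>2" for j
        using \<beta>[of j] by simp
      ultimately have "\<beta> i * (norm (- v (n + 2) $ i - vbar $ i))\<^sup>2 \<le> (x (n + 3) $ i - xbar) \<bullet> (- v (n + 2) $ i - vbar $ i)"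
        "\<And>j. 0 \<le> (x (n + 3) $ j - xbar) \<bullet> (- v (n + 2) $ j - vbar $ j)" by (blast intro: order_trans)+
      moreover have "\<tau> n = (\<Sum>j\<in>UNIV. (x (n + 3) $ j - xbar) \<bullet> (- v (n + 2) $ j - vbar $ j))"
        by (simp add: \<tau>_def inner_vec_def xbar)
      moreover have "(x (n + 3) $ i - xbar) \<bullet> (- v (n + 2) $ i - vbar $ i) \<le> (\<Sum>j\<in>UNIV. (x (n + 3) $ j - xbar) \<bullet> (- v (n + 2) $ j - vbar $ j))"
        using calculation(2) by (intro member_le_sum) auto
      ultimately show ?thesis by linarith
    qed
    have "(\<lambda>n. - y (n + 2)) \<longlonglongrightarrow> vbar"
    proof (rule vec_tendstoI)
      fix i
      have "(\<lambda>n. (norm (- v (n + 2) $ i - vbar $ i))\<^sup>2) \<longlonglongrightarrow> 0"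
      proof (rule tendsto_sandwich[OF _ _ tendsto_const])
        show "(\<lambda>n. 1 / \<beta> i * \<tau> n) \<longlonglongrightarrow> 0" using tendsto_mult[OF tendsto_const[of "1 / \<beta> i"] \<tau>0] by simp
        show "eventually (\<lambda>n. (norm (- v (n + 2) $ i - vbar $ i))\<^sup>2 \<le> 1 / \<beta> i * \<tau> n) sequentially"
          using le[of i] \<beta>[of i] by (simp add: pos_le_divide_eq mult.commute)
      qed auto
      then have "(\<lambda>n. sqrt ((norm (- v (n + 2) $ i - vbar $ i))\<^sup>2)) \<longlonglongrightarrow> sqrt 0" by (intro tendsto_intros)
      then have "(\<lambda>n. - v (n + 2) $ i - vbar $ i) \<longlonglongrightarrow> 0" by (simp add: tendsto_norm_zero_iff)
      moreover have "(\<lambda>n. \<gamma> *\<^sub>R e (n + 2) $ i) \<longlonglongrightarrow> \<gamma> *\<^sub>R 0 $ i"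
        by (intro tendsto_scaleR tendsto_const tendsto_vec_nth e0)
      \<comment> \<open>Adding \<open>\<gamma> e\<close> turns \<open>- v\<close> back into
        \<open>- y\<close>, so strong convergence carries over.\<close>
      ultimately have "(\<lambda>n. (- v (n + 2) $ i - vbar $ i) + \<gamma> *\<^sub>R e (n + 2) $ i + vbar $ i) \<longlonglongrightarrow> 0 + \<gamma> *\<^sub>R 0 $ i + vbar $ i"
        by (intro tendsto_add tendsto_const)
      then show "(\<lambda>n. (- y (n + 2)) $ i) \<longlonglongrightarrow> vbar $ i" by (simp add: v_eq e_def)
    qed
    then have "(\<lambda>k. - y k) \<longlonglongrightarrow> vbar" by (rule LIMSEQ_offset)
    then show ?thesis using uniq dual(2) by blast
  qed
  show ?thesis
    using vsub vsum dual(1-3) i1 i2 i3 i4 i5 i6 i7 i8 primal_lim dual_lim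
    by (intro exI[of _ xbar] exI[of _ vbar]) blast
qed

end
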